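(* Let $g\in\mathcal{G}\cap C^{0,1}\big(S;L^\infty(\Omega;C^{1,1}(\overline{Y}))\big)$, let the data $\boldsymbol f,\boldsymbol q$ be Lipschitz continuous in time, and let $d_0\in\mathcal{D}_0$. Let $d_h\in\mathcal{D}$ be the solution of the damage evolution equation with approximated right-hand side, $d_h'=r_h(d_h)$ in $S\times\Omega$, $d_h(0)=d_0$. For a time step $\tau>0$ and $t\in[0,T-\tau]$ let the consistency error of the explicit Euler scheme be $$\varepsilon(t,x,\tau)=d_h(t+\tau,x)-d_h(t,x)-\tau\,r_h(d_h)(t,x).$$ Then there exists a constant $C>0$, independent of $\tau$, such that $$\|\varepsilon(\cdot,\cdot,\tau)\|_{\infty,S,\Omega}\le C\tau^2,$$ where the norm is the (essential) supremum over all admissible $t$ and $x$.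
   Context: Setting. $S=(0,T)$ with $0<T<\infty$; $\Omega\subset\mathbb{R}^2$ is a bounded Lipschitz domain with boundary split into $\Gamma_0$ (positive measure, clamped), $\Gamma_1$ (traction free) and $\Gamma_2$ (loaded). $V=\{\boldsymbol{v}\in H^1(\Omega)^2:\boldsymbol{v}=0\text{ on }\Gamma_0\}$. $\boldsymbol\varepsilon(\boldsymbol u)=\frac12(\nabla\boldsymbol u+\nabla\boldsymbol u^{T})$ and $\mathbb{E}\boldsymbol\varepsilon=\lambda_L\,\mathrm{tr}(\boldsymbol\varepsilon)I+2\mu_L\boldsymbol\varepsilon$ with Lamé coefficients $\lambda_L,\mu_L\in L^\infty(\Omega)$ such that $\mathbb{E}$ is uniformly elliptic on symmetric matrices. The data are a volume force $\boldsymbol f$ with values in $L^2(\Omega)^2$ and a boundary traction $\boldsymbol q$ on $\Gamma_2$ with values in $L^2(\Gamma_2)^2$; "Lipschitz in time" means $\boldsymbol f\in C^{0,1}(S;L^2(\Omega)^2)$ and $\boldsymbol q\in C^{0,1}(S;L^2(\Gamma_2)^2)$. Fixed constants: $\alpha\ge1$ and $0\le\omega_0\le\omega_1<1$. Damage functions: $\mathcal{D}=\{d\in W^{1,\infty}(S;L^\infty(\Omega)):0\le d\le\omega_1\text{ a.e.}\}$. Initial damage: $\mathcal{D}_0=\{d_0\in L^\infty(\Omega):0\le d_0\le\omega_0\text{ a.e.}\}$. $\overline{Y}\subset\mathbb{R}^4$ is the closed ball of radius $\bar y>0$ centred at $0$. Damage processes: $\mathcal{G}$ is the set of $g\in L^\infty(S;L^\infty(\Omega;C^{1,1}(\overline{Y})))$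 such that for all $\boldsymbol y\in\overline{Y}$, $0\le g(\cdot,\cdot,\boldsymbol y)\le T^{-1}(\omega_1-\omega_0)(1-\omega_1)^\alpha$ a.e. in $S\times\Omega$. Mollified gradient: $\nabla^\mu\boldsymbol v=\eta_\mu*\nabla\boldsymbol v$ ($\nabla\boldsymbol v$ extended by zero) with a fixed smooth compactly supported mollifier kernel $\eta_\mu$, so $\nabla^\mu:H^1(\Omega)^2\to L^\infty(\Omega;\mathbb{R}^4)$ is bounded and linear. The radius $\bar y$ is large enough that all mollified gradients inserted into $g$ take values in $\overline{Y}$. Discrete displacement operator. Let $V_h\subset V$ be the space of continuous piecewise affine (P1 Lagrange) vector fields vanishing on $\Gamma_0$ over a regular triangulation of $\Omega$ of mesh size $h$. For $d_t\in L^\infty(\Omega)$ with $0\le d_t\le\omega_1$, $O_{E,h,t}(d_t)=\boldsymbol u_h\in V_h$ is the solution of $\int_\Omega(1-d_t)\,\mathbb{E}\boldsymbol\varepsilon(\boldsymbol u_h):\boldsymbol\varepsilon(\boldsymbol\varphi)\,dx=\int_\Omega\boldsymbol f(t)\cdot\boldsymbol\varphi\,dx+\int_{\Gamma_2}\boldsymbol q(t)\cdot\boldsymbol\varphi\,d\mathcal{H}^1$ for all $\boldsymbol\varphi\in V_h$. Approximated right-hand side: $r_h(d)(t,x)=g\big(t,x,\nabla^\mu O_{E,h,t}(d(t))(x)\big)(1-d(t,x))^{-\alpha}$. *)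

theory Defs
  imports "HOL-Analysis.Analysis" "HOL-Probability.Essential_Supremum"
begin

section \<open>One-dimensional Hausdorff measure\<close>

text \<open>Normalised so that it agrees with arc length on rectifiable curves.\<close>

definition hausdorff1_pre :: "real \<Rightarrow> 'a::metric_space set \<Rightarrow> ennreal" where
  "hausdorff1_pre \<delta> A =
     (INF U \<in> {U :: nat \<Rightarrow> 'a set. A \<subseteq> (\<Union>i. U i) \<and> (\<forall>i. bounded (U i) \<and> diameter (U i) \<le> \<delta>)}.
        \<Sum>i. ennreal (diameter (U i)))"

definition hausdorff1_outer :: "'a::metric_space set \<Rightarrow> ennreal" where
  "hausdorff1_outer A = (SUP \<delta> \<in> {0<..}. hausdorff1_pre \<delta> A)"

definition hausdorff1 :: "'a::metric_space measure" where
  "hausdorff1 = measure_of UNIV (sets borel) hausdorff1_outer"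

lemma hausdorff1_pre_mono: "A \<subseteq> B \<Longrightarrow> hausdorff1_pre \<delta> A \<le> hausdorff1_pre \<delta> B"
  unfolding hausdorff1_pre_def by (rule INF_superset_mono) auto

lemma hausdorff1_pre_antimono: "\<delta> \<le> \<delta>' \<Longrightarrow> hausdorff1_pre \<delta>' A \<le> hausdorff1_pre \<delta> A"
  unfolding hausdorff1_pre_def by (rule INF_superset_mono) (auto intro: order_trans)

lemma hausdorff1_pre_le_outer: "0 < \<delta> \<Longrightarrow> hausdorff1_pre \<delta> A \<le> hausdorff1_outer A"
  unfolding hausdorff1_outer_def by (rule SUP_upper) simp

lemma hausdorff1_pre_le:
  "A \<subseteq> (\<Union>i. U i) \<Longrightarrow> (\<And>i. bounded (U i)) \<Longrightarrow> (\<And>i. diameter (U i) \<le> \<delta>)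
    \<Longrightarrow> hausdorff1_pre \<delta> A \<le> (\<Sum>i. ennreal (diameter (U i)))"
  unfolding hausdorff1_pre_def by (rule INF_lower) auto

lemma hausdorff1_outer_mono: "A \<subseteq> B \<Longrightarrow> hausdorff1_outer A \<le> hausdorff1_outer B"
  unfolding hausdorff1_outer_def by (intro SUP_mono) (auto intro: hausdorff1_pre_mono)

lemma hausdorff1_outer_empty: "hausdorff1_outer ({} :: 'a::metric_space set) = 0"
proof -
  have "hausdorff1_pre \<delta> ({} :: 'a set) = 0" if "0 < \<delta>" for \<delta>
    using hausdorff1_pre_le[of "{}" "\<lambda>_. {}" \<delta>] that by auto
  then have "hausdorff1_outer ({} :: 'a set) \<le> 0"
    unfolding hausdorff1_outer_def by (intro SUP_least) simp
  then show ?thesis by simp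
qed

lemma hausdorff1_pre_subadd:
  fixes A :: "nat \<Rightarrow> 'a::metric_space set"
  shows "hausdorff1_pre \<delta> (\<Union>i. A i) \<le> (\<Sum>i. hausdorff1_pre \<delta> (A i))"
proof (rule ennreal_le_epsilon)
  fix e :: real assume e: "0 < e" and fin: "(\<Sum>i. hausdorff1_pre \<delta> (A i)) < top"
  have ex: "\<exists>U. A n \<subseteq> (\<Union>i. U i) \<and> (\<forall>i. bounded (U i) \<and> diameter (U i) \<le> \<delta>) \<and>
      (\<Sum>i. ennreal (diameter (U i))) \<le> hausdorff1_pre \<delta> (A n) + ennreal (e * (1/2)^Suc n)" for n
  proof -
    have "hausdorff1_pre \<delta> (A n) \<noteq> top"
      using ennreal_suminf_lessD[OF fin, of n] by auto
    then have "hausdorff1_pre \<delta> (A n) < hausdorff1_pre \<delta> (A n) + ennreal (e * (1/2)^Suc n)"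
      using e by (simp add: ennreal_add_left_cancel_less[of _ 0, simplified] less_top)
    then show ?thesis
      by (subst (asm) (1) hausdorff1_pre_def) (auto simp: INF_less_iff intro: less_imp_le)
  qed
  obtain U where U: "\<And>n. A n \<subseteq> (\<Union>i. U n i)" "\<And>n i. bounded (U n i)" "\<And>n i. diameter (U n i) \<le> \<delta>"
     "\<And>n. (\<Sum>i. ennreal (diameter (U n i))) \<le> hausdorff1_pre \<delta> (A n) + ennreal (e * (1/2)^Suc n)"
    using ex by metis
  define W where "W k = (case prod_decode k of (n, i) \<Rightarrow> U n i)" for k
  have "(\<Union>i. A i) \<subseteq> (\<Union>k. W k)"
  proof
    fix x assume "x \<in> (\<Union>i. A i)"
    then obtain n i where "x \<in> U n i" using U(1) by blast
    then have "x \<in> W (prod_encode (n,i))" by (simp add: W_def)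
    then show "x \<in> (\<Union>k. W k)" by blast
  qed
  then have "hausdorff1_pre \<delta> (\<Union>i. A i) \<le> (\<Sum>k. ennreal (diameter (W k)))"
    by (rule hausdorff1_pre_le) (auto simp: W_def U split: prod.split)
  also have "\<dots> = (\<Sum>k. (\<lambda>(n,i). ennreal (diameter (U n i))) (prod_decode k))"
    by (intro suminf_cong) (auto simp: W_def split: prod.split)
  also have "\<dots> = (\<Sum>n. \<Sum>i. ennreal (diameter (U n i)))"
    by (rule suminf_ennreal_2dimen) simp
  also have "\<dots> \<le> (\<Sum>n. hausdorff1_pre \<delta> (A n) + ennreal (e * (1/2)^Suc n))"
    by (intro suminf_le U) auto
  also have "\<dots> = (\<Sum>n. hausdorff1_pre \<delta> (A n)) + (\<Sum>n. ennreal (e * (1/2)^Suc n))"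
    by (intro suminf_add[symmetric]) auto
  also have "(\<Sum>n. ennreal (e * (1/2)^Suc n)) = ennreal e"
    using sums_mult[OF power_half_series, of e] e by (intro suminf_ennreal_eq) auto
  finally show "hausdorff1_pre \<delta> (\<Union>i. A i) \<le> (\<Sum>i. hausdorff1_pre \<delta> (A i)) + ennreal e" .
qed

lemma hausdorff1_outer_subadd:
  fixes A :: "nat \<Rightarrow> 'a::metric_space set"
  shows "hausdorff1_outer (\<Union>i. A i) \<le> (\<Sum>i. hausdorff1_outer (A i))"
proof -
  have "hausdorff1_pre \<delta> (\<Union>i. A i) \<le> (\<Sum>i. hausdorff1_outer (A i))" if "0 < \<delta>" for \<delta>
    by (rule order_trans[OF hausdorff1_pre_subadd])
       (intro suminf_le hausdorff1_pre_le_outer that, auto)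
  then show ?thesis
    by (subst hausdorff1_outer_def) (auto intro: SUP_least)
qed

lemma hausdorff1_outer_Un: "hausdorff1_outer (A \<union> B) \<le> hausdorff1_outer A + hausdorff1_outer B"
proof -
  have "A \<union> B = (\<Union>i. (\<lambda>n::nat. if n = 0 then A else if n = 1 then B else {}) i)"
    by (auto split: if_splits intro: exI[of _ 0] exI[of _ 1])
  then have "hausdorff1_outer (A \<union> B) \<le>
      (\<Sum>i. hausdorff1_outer ((\<lambda>n::nat. if n = 0 then A else if n = 1 then B else {}) i))"
    using hausdorff1_outer_subadd by metis
  also have "\<dots> = (\<Sum>i\<in>{0,1}. hausdorff1_outer ((\<lambda>n::nat. if n = 0 then A else if n = 1 then B else {}) i))"
    by (rule suminf_finite) (auto simp: hausdorff1_outer_empty)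
  finally show ?thesis by simp
qed

lemma hausdorff1_outer_measure_space: "outer_measure_space (Pow UNIV) hausdorff1_outer"
  by (auto simp: outer_measure_space_def positive_def increasing_def countably_subadditive_def
      hausdorff1_outer_empty intro: hausdorff1_outer_mono hausdorff1_outer_subadd)

lemma hausdorff1_pre_separated:
  fixes A B :: "'a::metric_space set"
  assumes "\<And>x y. x \<in> A \<Longrightarrow> y \<in> B \<Longrightarrow> r \<le> dist x y" "0 < \<delta>" "\<delta> < r"
  shows "hausdorff1_pre \<delta> A + hausdorff1_pre \<delta> B \<le> hausdorff1_pre \<delta> (A \<union> B)"
proof (subst (3) hausdorff1_pre_def, rule INF_greatest, safe)
  fix U :: "nat \<Rightarrow> 'a set"
  assume U: "A \<union> B \<subseteq> (\<Union>i. U i)" "\<forall>i. bounded (U i) \<and> diameter (U i) \<le> \<delta>"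
  define UA where "UA i = (if U i \<inter> A \<noteq> {} then U i else {})" for i
  define UB where "UB i = (if U i \<inter> B \<noteq> {} then U i else {})" for i
  have a: "hausdorff1_pre \<delta> A \<le> (\<Sum>i. ennreal (diameter (UA i)))"
    by (rule hausdorff1_pre_le) (use U assms in \<open>auto simp: UA_def split: if_splits, blast\<close>)
  have b: "hausdorff1_pre \<delta> B \<le> (\<Sum>i. ennreal (diameter (UB i)))"
    by (rule hausdorff1_pre_le) (use U assms in \<open>auto simp: UB_def split: if_splits, blast\<close>)
  have dis: "U i \<inter> A = {} \<or> U i \<inter> B = {}" for i
  proof (rule ccontr)
    assume "\<not> ?thesis"
    then obtain x y where "x \<in> U i" "x \<in> A" "y \<in> U i" "y \<in> B" by blast
    then have "r \<le> dist x y" "dist x y \<le> diameter (U i)"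
      using assms(1) U(2) diameter_bounded_bound by blast+
    then show False using U(2) assms(3) by (meson le_less_trans not_less order_trans)
  qed
  have "hausdorff1_pre \<delta> A + hausdorff1_pre \<delta> B
      \<le> (\<Sum>i. ennreal (diameter (UA i))) + (\<Sum>i. ennreal (diameter (UB i)))"
    by (rule add_mono[OF a b])
  also have "\<dots> = (\<Sum>i. ennreal (diameter (UA i)) + ennreal (diameter (UB i)))"
    by (rule suminf_add) auto
  also have "\<dots> \<le> (\<Sum>i. ennreal (diameter (U i)))"
    by (intro suminf_le) (use dis in \<open>auto simp: UA_def UB_def\<close>)
  finally show "hausdorff1_pre \<delta> A + hausdorff1_pre \<delta> B \<le> (\<Sum>i. ennreal (diameter (U i)))" .
qed

lemma hausdorff1_outer_separated:
  fixes A B :: "'a::metric_space set"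
  assumes "\<And>x y. x \<in> A \<Longrightarrow> y \<in> B \<Longrightarrow> r \<le> dist x y" "0 < r"
  shows "hausdorff1_outer A + hausdorff1_outer B \<le> hausdorff1_outer (A \<union> B)"
proof -
  have *: "hausdorff1_pre \<delta> A + hausdorff1_pre \<delta>' B \<le> hausdorff1_outer (A \<union> B)"
    if "0 < \<delta>" "0 < \<delta>'" for \<delta> \<delta>'
  proof -
    define e where "e = min (min \<delta> \<delta>') (r/2)"
    have e: "0 < e" "e < r" "e \<le> \<delta>" "e \<le> \<delta>'" using that assms(2) by (auto simp: e_def)
    have "hausdorff1_pre \<delta> A + hausdorff1_pre \<delta>' B \<le> hausdorff1_pre e A + hausdorff1_pre e B"
      using e by (intro add_mono hausdorff1_pre_antimono)
    also have "\<dots> \<le> hausdorff1_pre e (A \<union> B)"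
      by (rule hausdorff1_pre_separated[OF assms(1) e(1,2)])
    also have "\<dots> \<le> hausdorff1_outer (A \<union> B)" by (rule hausdorff1_pre_le_outer[OF e(1)])
    finally show ?thesis .
  qed
  have "hausdorff1_pre \<delta> A + hausdorff1_outer B \<le> hausdorff1_outer (A \<union> B)" if "0 < \<delta>" for \<delta>
    unfolding hausdorff1_outer_def[of B]
    by (subst ennreal_SUP_add_right) (auto intro!: SUP_least * that exI[of _ 1])
  then show ?thesis
    unfolding hausdorff1_outer_def[of A]
    by (subst ennreal_SUP_add_left[symmetric]) (auto intro!: SUP_least exI[of _ 1])
qed

lemma hausdorff1_outer_separated_sum:
  fixes R :: "nat \<Rightarrow> 'a::metric_space set"
  assumes "\<And>i j. i < j \<Longrightarrow> \<exists>r>0. \<forall>x\<in>(\<Union>k\<le>i. R k). \<forall>y\<in>R j. r \<le> dist x y"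
  shows "(\<Sum>k<n. hausdorff1_outer (R k)) \<le> hausdorff1_outer (\<Union>k<n. R k)"
proof (induction n)
  case (Suc n)
  have "(\<Sum>k<Suc n. hausdorff1_outer (R k)) \<le> hausdorff1_outer (\<Union>k<n. R k) + hausdorff1_outer (R n)"
    using Suc by (simp add: add_mono)
  also have "\<dots> \<le> hausdorff1_outer ((\<Union>k<n. R k) \<union> R n)"
  proof (cases n)
    case (Suc m)
    then obtain r where "r > 0" "\<forall>x\<in>(\<Union>k\<le>m. R k). \<forall>y\<in>R n. r \<le> dist x y"
      using assms[of m n] by auto
    then show ?thesis
      by (intro hausdorff1_outer_separated[of _ _ r]) (auto simp: Suc less_Suc_eq_le)
  qed (simp add: hausdorff1_outer_empty)
  also have "(\<Union>k<n. R k) \<union> R n = (\<Union>k<Suc n. R k)" by (auto simp: less_Suc_eq)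
  finally show ?case .
qed (simp add: hausdorff1_outer_empty)

lemma hausdorff1_outer_closed:
  fixes C X :: "'a::metric_space set"
  assumes "closed C"
  shows "hausdorff1_outer (X \<inter> C) + hausdorff1_outer (X - C) \<le> hausdorff1_outer X"
proof (cases "C = {} \<or> hausdorff1_outer X = top")
  case True
  then show ?thesis by (auto simp: hausdorff1_outer_empty)
next
  case False
  then have C: "C \<noteq> {}" and fin: "hausdorff1_outer X \<noteq> top" by auto
  define B where "B n = {x\<in>X. 1 / real (Suc n) \<le> infdist x C}" for n
  define R where "R n = {x\<in>X. 1 / real (Suc (Suc n)) \<le> infdist x C \<and> infdist x C < 1 / real (Suc n)}" for n
  have sub: "R n \<subseteq> X" for n by (auto simp: R_def)
  have sep: "\<exists>r>0. \<forall>x\<in>R i. \<forall>y\<in>R j. r \<le> dist x y" if "Suc i < j" for i j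
  proof (intro exI conjI ballI)
    have "1 / real (Suc j) < 1 / real (Suc (Suc i))"
      using that by (intro divide_strict_left_mono) auto
    then show "0 < 1 / real (Suc (Suc i)) - 1 / real (Suc j)" by simp
    fix x y assume "x \<in> R i" "y \<in> R j"
    then show "1 / real (Suc (Suc i)) - 1 / real (Suc j) \<le> dist x y"
      using infdist_triangle[of x C y] by (auto simp: R_def)
  qed
  have sepU: "\<exists>r>0. \<forall>x\<in>(\<Union>k\<le>i. R (2*k+c)). \<forall>y\<in>R (2*j+c). r \<le> dist x y" if "i < j" for i j c
  proof -
    have "\<forall>k\<in>{..i}. \<exists>r>0. \<forall>x\<in>R (2*k+c). \<forall>y\<in>R (2*j+c). r \<le> dist x y"
      using that by (auto intro!: sep)
    then obtain r where r: "\<And>k. k \<le> i \<Longrightarrow> r k > 0 \<and> (\<forall>x\<in>R (2*k+c). \<forall>y\<in>R (2*j+c). r k \<le> dist x y)"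
      unfolding Ball_def atMost_iff by metis
    have "Min (r ` {..i}) > 0" using r by (subst Min_gr_iff) auto
    moreover have "Min (r ` {..i}) \<le> dist x y"
      if "k \<le> i" "x \<in> R (2*k+c)" "y \<in> R (2*j+c)" for k x y
      using r[OF that(1)] that by (intro order_trans[OF Min_le[of _ "r k"]]) auto
    ultimately show ?thesis by blast
  qed
  have part: "(\<Sum>k<n. hausdorff1_outer (R (2*k+c))) \<le> hausdorff1_outer X" for n c
    by (rule order_trans[OF hausdorff1_outer_separated_sum hausdorff1_outer_mono])
       (use sepU sub in \<open>fastforce+\<close>)
  have "(\<Sum>k<n. hausdorff1_outer (R k)) \<le> 2 * hausdorff1_outer X" for n
  proof -
    have "(\<Sum>k<n. hausdorff1_outer (R k)) \<le> (\<Sum>k<2*n. hausdorff1_outer (R k))"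
      by (rule sum_mono2) auto
    also have "\<dots> = (\<Sum>k<n. hausdorff1_outer (R (2*k+0))) + (\<Sum>k<n. hausdorff1_outer (R (2*k+1)))"
      by (induction n) (auto simp: algebra_simps)
    also have "\<dots> \<le> hausdorff1_outer X + hausdorff1_outer X"
      by (intro add_mono part)
    finally show ?thesis by (simp add: mult_2)
  qed
  then have "(\<Sum>k. hausdorff1_outer (R k)) \<le> 2 * hausdorff1_outer X"
    by (auto simp: suminf_eq_SUP intro: SUP_least)
  also have "\<dots> < top" using fin by (simp add: ennreal_mult_less_top less_top)
  finally have sumfin: "(\<Sum>k. hausdorff1_outer (R k)) < top" .
  have main: "hausdorff1_outer (X \<inter> C) + hausdorff1_outer (B n) \<le> hausdorff1_outer X" for n
  proof -
    have "hausdorff1_outer (X \<inter> C) + hausdorff1_outer (B n) \<le> hausdorff1_outer ((X \<inter> C) \<union> B n)"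
    proof (rule hausdorff1_outer_separated[of _ _ "1 / real (Suc n)"])
      fix x y assume "x \<in> X \<inter> C" "y \<in> B n"
      then show "1 / real (Suc n) \<le> dist x y"
        using infdist_le[of x C y] by (auto simp: B_def dist_commute)
    qed simp
    also have "\<dots> \<le> hausdorff1_outer X" by (rule hausdorff1_outer_mono) (auto simp: B_def)
    finally show ?thesis .
  qed
  have cov: "X - C \<subseteq> B n \<union> (\<Union>k. R (k + n))" for n
  proof
    fix x assume x: "x \<in> X - C"
    then have pos: "0 < infdist x C"
      using assms C in_closed_iff_infdist_zero[of C x] infdist_nonneg[of x C] by auto
    show "x \<in> B n \<union> (\<Union>k. R (k + n))"
    proof (cases "1 / real (Suc n) \<le> infdist x C")
      case True then show ?thesis using x by (auto simp: B_def)
    next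
      case False
      obtain m where m: "1 / real (Suc m) \<le> infdist x C"
        using pos nat_approx_posE less_imp_le by metis
      define l where "l = (LEAST m. 1 / real (Suc m) \<le> infdist x C)"
      have l: "1 / real (Suc l) \<le> infdist x C" unfolding l_def by (rule LeastI[of _ m]) (rule m)
      have ln: "n < l"
      proof (rule ccontr)
        assume "\<not> n < l"
        then have "1 / real (Suc n) \<le> 1 / real (Suc l)" by (simp add: field_simps)
        then show False using l False by linarith
      qed
      then obtain k where k: "l = Suc k" by (cases l) auto
      have "\<not> 1 / real (Suc k) \<le> infdist x C"
        using not_less_Least[of k "\<lambda>m. 1 / real (Suc m) \<le> infdist x C"] k l_def by auto
      then have "x \<in> R ((k - n) + n)" using l k x ln by (auto simp: R_def)
      then show ?thesis by blast
    qed
  qed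
  have "hausdorff1_outer (X \<inter> C) + hausdorff1_outer (X - C)
      \<le> hausdorff1_outer X + (\<Sum>k. hausdorff1_outer (R (k + n)))" for n
  proof -
    have "hausdorff1_outer (X - C) \<le> hausdorff1_outer (B n) + hausdorff1_outer (\<Union>k. R (k + n))"
      by (rule order_trans[OF hausdorff1_outer_mono[OF cov] hausdorff1_outer_Un])
    also have "\<dots> \<le> hausdorff1_outer (B n) + (\<Sum>k. hausdorff1_outer (R (k + n)))"
      by (intro add_mono order_refl hausdorff1_outer_subadd)
    finally have "hausdorff1_outer (X \<inter> C) + hausdorff1_outer (X - C)
      \<le> (hausdorff1_outer (X \<inter> C) + hausdorff1_outer (B n)) + (\<Sum>k. hausdorff1_outer (R (k + n)))"
      by (simp add: add_mono add.assoc)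
    also have "\<dots> \<le> hausdorff1_outer X + (\<Sum>k. hausdorff1_outer (R (k + n)))"
      by (intro add_mono main order_refl)
    finally show ?thesis .
  qed
  moreover have "(\<lambda>n. hausdorff1_outer X + (\<Sum>k. hausdorff1_outer (R (k + n)))) \<longlonglongrightarrow> hausdorff1_outer X + 0"
  proof (intro tendsto_add tendsto_const)
    define a where "a k = enn2real (hausdorff1_outer (R k))" for k
    have fk: "hausdorff1_outer (R k) < top" for k
      using ennreal_suminf_lessD[OF sumfin] .
    have a: "hausdorff1_outer (R k) = ennreal (a k)" "0 \<le> a k" for k
      using fk[of k] by (auto simp: a_def)
    have sm: "summable a"
      using sumfin a by (intro summable_suminf_not_top) auto
    have "(\<Sum>k. hausdorff1_outer (R (k + n))) = ennreal (\<Sum>k. a (k + n))" for n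
      unfolding a(1) using sm a by (intro suminf_ennreal2) (auto simp: summable_iff_shift)
    moreover have "(\<lambda>n. ennreal (\<Sum>k. a (k + n))) \<longlonglongrightarrow> ennreal 0"
      by (intro tendsto_ennrealI suminf_exist_split2 sm)
    ultimately show "(\<lambda>n. \<Sum>k. hausdorff1_outer (R (k + n))) \<longlonglongrightarrow> 0" by simp
  qed
  ultimately show ?thesis
    by (intro LIMSEQ_le_const[of _ "hausdorff1_outer X"]) auto
qed

lemma hausdorff1_measure_space:
  "measure_space (UNIV::'a::metric_space set) (sets borel) hausdorff1_outer"
proof (rule measure_down)
  let ?L = "lambda_system UNIV (Pow UNIV) (hausdorff1_outer :: 'a set \<Rightarrow> ennreal)"
  interpret sigma_algebra "UNIV::'a set" "Pow UNIV" by (rule sigma_algebra_Pow)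
  show ms: "measure_space UNIV ?L hausdorff1_outer"
    by (rule caratheodory_lemma) (rule hausdorff1_outer_measure_space)
  show "sigma_algebra UNIV (sets (borel :: 'a measure))"
    using sets.sigma_algebra_axioms[of "borel :: 'a measure"] by simp
  have "C \<in> ?L" if "closed C" for C
    unfolding lambda_system_eq
  proof (clarsimp, rule antisym)
    fix X
    show "hausdorff1_outer (X \<inter> C) + hausdorff1_outer (X - C) \<le> hausdorff1_outer X"
      by (rule hausdorff1_outer_closed[OF that])
    show "hausdorff1_outer X \<le> hausdorff1_outer (X \<inter> C) + hausdorff1_outer (X - C)"
      using hausdorff1_outer_Un[of "X \<inter> C" "X - C"] by (simp add: Int_Diff_Un)
  qed
  then have "sigma_sets UNIV (Collect closed) \<subseteq> ?L"
    using ms by (intro sigma_algebra.sigma_sets_subset) (auto simp: measure_space_def)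
  then show "sets (borel::'a measure) \<subseteq> ?L"
    by (simp add: borel_eq_closed)
qed

lemma space_hausdorff1 [simp]: "space hausdorff1 = UNIV"
  by (simp add: hausdorff1_def)

lemma sets_hausdorff1 [measurable_cong, simp]: "sets hausdorff1 = sets borel"
  using sets.sigma_sets_eq[of "borel :: 'a::metric_space measure"]
  by (simp add: hausdorff1_def)

lemma emeasure_hausdorff1: "A \<in> sets borel \<Longrightarrow> emeasure hausdorff1 A = hausdorff1_outer A"
  using hausdorff1_measure_space[where 'a='a] sets_hausdorff1[where 'a='a]
  by (intro emeasure_measure_of[OF hausdorff1_def]) (auto simp: measure_space_def)


section \<open>Lipschitz domains and test functions\<close>

definition lipschitz_domain :: "(real^2) set \<Rightarrow> bool" where
  "lipschitz_domain \<Omega> \<longleftrightarrow>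
     open \<Omega> \<and> connected \<Omega> \<and> bounded \<Omega> \<and> \<Omega> \<noteq> {} \<and>
     (\<forall>p \<in> frontier \<Omega>. \<exists>U e1 e2 \<gamma> L.
        open U \<and> p \<in> U \<and> norm e1 = 1 \<and> norm e2 = 1 \<and> e1 \<bullet> e2 = 0 \<and>
        L-lipschitz_on (UNIV :: real set) \<gamma> \<and>
        \<Omega> \<inter> U = {x \<in> U. \<gamma> (x \<bullet> e1) < x \<bullet> e2})"

primrec Ck :: "nat \<Rightarrow> ('a::euclidean_space \<Rightarrow> real) \<Rightarrow> bool" where
  "Ck 0 \<phi> \<longleftrightarrow> continuous_on UNIV \<phi>"
| "Ck (Suc k) \<phi> \<longleftrightarrow>
     (\<forall>x. \<phi> differentiable at x) \<and> (\<forall>b\<in>Basis. Ck k (\<lambda>x. frechet_derivative \<phi> (at x) b))"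

definition smooth :: "('a::euclidean_space \<Rightarrow> real) \<Rightarrow> bool" where
  "smooth \<phi> \<longleftrightarrow> (\<forall>k. Ck k \<phi>)"

definition test_functions :: "'a::euclidean_space set \<Rightarrow> ('a \<Rightarrow> real) set" where
  "test_functions U =
     {\<phi>. smooth \<phi> \<and> compact (closure {x. \<phi> x \<noteq> 0}) \<and> closure {x. \<phi> x \<noteq> 0} \<subseteq> U}"

definition mollifier_kernel :: "(real^2 \<Rightarrow> real) \<Rightarrow> bool" where
  "mollifier_kernel \<eta> \<longleftrightarrow> \<eta> \<in> test_functions UNIV \<and> (\<forall>x. 0 \<le> \<eta> x) \<and> (\<integral>x. \<eta> x \<partial>lborel) = 1"


section \<open>Function spaces\<close>

text \<open>
  Elements of function spaces are represented by functions, not by equivalence classes. A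
  (semi)normed space of functions is a carrier set \<open>X\<close> with a seminorm \<open>N\<close>; differences are taken
  pointwise. Two representatives are identified if and only if the seminorm of their difference
  vanishes.
\<close>

definition L2_space :: "'a measure \<Rightarrow> ('a \<Rightarrow> 'b::euclidean_space) set" where
  "L2_space M = {v \<in> borel_measurable M. integrable M (\<lambda>x. (norm (v x))\<^sup>2)}"

definition L2_norm :: "'a measure \<Rightarrow> ('a \<Rightarrow> 'b::euclidean_space) \<Rightarrow> real" where
  "L2_norm M v = sqrt (\<integral>x. (norm (v x))\<^sup>2 \<partial>M)"

definition strongly_measurable ::
    "'a measure \<Rightarrow> 'v set \<Rightarrow> ('v::minus \<Rightarrow> real) \<Rightarrow> ('a \<Rightarrow> 'v) \<Rightarrow> bool" where
  "strongly_measurable M X N u \<longleftrightarrow>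
     (AE t in M. u t \<in> X) \<and>
     (\<exists>s. (\<forall>n::nat. simple_function M (s n) \<and> s n ` space M \<subseteq> X) \<and>
          (AE t in M. (\<lambda>n. N (s n t - u t)) \<longlonglongrightarrow> 0))"

definition Linf_space ::
    "'a measure \<Rightarrow> 'v set \<Rightarrow> ('v::minus \<Rightarrow> real) \<Rightarrow> ('a \<Rightarrow> 'v) set" where
  "Linf_space M X N = {u. strongly_measurable M X N u \<and> (\<exists>C. AE t in M. N (u t) \<le> C)}"

definition Linf_norm :: "'a measure \<Rightarrow> ('v \<Rightarrow> real) \<Rightarrow> ('a \<Rightarrow> 'v) \<Rightarrow> real" where
  "Linf_norm M N u = Inf {C. 0 \<le> C \<and> (AE t in M. N (u t) \<le> C)}"

definition C_space :: "real set \<Rightarrow> 'v set \<Rightarrow> ('v::minus \<Rightarrow> real) \<Rightarrow> (real \<Rightarrow> 'v) set" where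
  "C_space I X N =
     {u. (\<forall>t\<in>I. u t \<in> X) \<and> (\<forall>t\<in>I. ((\<lambda>s. N (u s - u t)) \<longlongrightarrow> 0) (at t within I))}"

definition C01_space :: "real set \<Rightarrow> 'v set \<Rightarrow> ('v::minus \<Rightarrow> real) \<Rightarrow> (real \<Rightarrow> 'v) set" where
  "C01_space I X N =
     {u. (\<forall>t\<in>I. u t \<in> X) \<and> (\<exists>L. \<forall>s\<in>I. \<forall>t\<in>I. N (u s - u t) \<le> L * \<bar>s - t\<bar>)}"

abbreviation Linf :: "(real^2) set \<Rightarrow> (real^2 \<Rightarrow> real) set" where
  "Linf \<Omega> \<equiv> Linf_space (lebesgue_on \<Omega>) UNIV abs"

abbreviation normLinf :: "(real^2) set \<Rightarrow> (real^2 \<Rightarrow> real) \<Rightarrow> real" where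
  "normLinf \<Omega> \<equiv> Linf_norm (lebesgue_on \<Omega>) abs"

text \<open>For finite measures only: the simple functions are not required to have support of finite measure.\<close>

definition simple_integral_fun :: "'a measure \<Rightarrow> ('a \<Rightarrow> 'x \<Rightarrow> real) \<Rightarrow> 'x \<Rightarrow> real" where
  "simple_integral_fun M s = (\<lambda>x. \<Sum>v \<in> s ` space M. measure M (s -` {v} \<inter> space M) * v x)"

definition has_bochner_integral_in ::
    "'a measure \<Rightarrow> ('x \<Rightarrow> real) set \<Rightarrow> (('x \<Rightarrow> real) \<Rightarrow> real) \<Rightarrow> ('a \<Rightarrow> 'x \<Rightarrow> real) \<Rightarrow> ('x \<Rightarrow> real) \<Rightarrow> bool"
  where
  "has_bochner_integral_in M X N u J \<longleftrightarrow>
     strongly_measurable M X N u \<and> J \<in> X \<and>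
     (\<exists>s. (\<forall>n::nat. simple_function M (s n) \<and> s n ` space M \<subseteq> X) \<and>
          (\<lambda>n. \<integral>\<^sup>+ t. ennreal (N (s n t - u t)) \<partial>M) \<longlonglongrightarrow> 0 \<and>
          (\<lambda>n. N (simple_integral_fun M (s n) - J)) \<longlonglongrightarrow> 0)"

definition weak_time_derivative ::
    "real \<Rightarrow> (real^2) set \<Rightarrow> (real \<Rightarrow> real^2 \<Rightarrow> real) \<Rightarrow> (real \<Rightarrow> real^2 \<Rightarrow> real) \<Rightarrow> bool" where
  "weak_time_derivative T \<Omega> u w \<longleftrightarrow>
     (\<forall>\<phi> \<in> test_functions {0<..<T}. \<exists>J.
        has_bochner_integral_in (lebesgue_on {0<..<T}) (Linf \<Omega>) (normLinf \<Omega>)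
          (\<lambda>t x. deriv \<phi> t * u t x) J \<and>
        has_bochner_integral_in (lebesgue_on {0<..<T}) (Linf \<Omega>) (normLinf \<Omega>)
          (\<lambda>t x. \<phi> t * w t x) (- J))"

text \<open>\<open>W\<^sup>1\<^sup>,\<^sup>\<infinity>\<close> in time with values in \<open>L\<^sup>\<infinity>(\<Omega>)\<close>. Each class has exactly one representative that is
  continuous from the closed interval \<open>[0, T]\<close> to \<open>L\<^sup>\<infinity>(\<Omega>)\<close>; membership in \<open>C_space\<close> selects it, so
  that \<open>u t\<close> is meaningful for every \<open>t\<close> in \<open>[0, T]\<close>, in particular for \<open>t = 0\<close>.\<close>

definition W1inf :: "real \<Rightarrow> (real^2) set \<Rightarrow> (real \<Rightarrow> real^2 \<Rightarrow> real) set" where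
  "W1inf T \<Omega> =
     {u \<in> Linf_space (lebesgue_on {0<..<T}) (Linf \<Omega>) (normLinf \<Omega>).
        u \<in> C_space {0..T} (Linf \<Omega>) (normLinf \<Omega>) \<and>
        (\<exists>w \<in> Linf_space (lebesgue_on {0<..<T}) (Linf \<Omega>) (normLinf \<Omega>).
           weak_time_derivative T \<Omega> u w)}"

text \<open>Used for closed balls \<open>Y\<close> of positive radius, where the derivative within \<open>Y\<close> is unique and, for
  \<open>C\<^sup>1\<close> functions, its value at a boundary point is the limit of the gradients from the interior.\<close>

definition grad_within :: "'a::euclidean_space set \<Rightarrow> ('a \<Rightarrow> real) \<Rightarrow> 'a \<Rightarrow> 'a" where
  "grad_within Y k y = (\<Sum>b\<in>Basis. frechet_derivative k (at y within Y) b *\<^sub>R b)"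

definition C11_space :: "'a::euclidean_space set \<Rightarrow> ('a \<Rightarrow> real) set" where
  "C11_space Y = {k. k differentiable_on Y \<and> (\<exists>L. L-lipschitz_on Y (grad_within Y k))}"

definition C11_norm :: "'a::euclidean_space set \<Rightarrow> ('a \<Rightarrow> real) \<Rightarrow> real" where
  "C11_norm Y k =
     (SUP y\<in>Y. \<bar>k y\<bar>) + (SUP y\<in>Y. norm (grad_within Y k y)) + Inf {L. L-lipschitz_on Y (grad_within Y k)}"


section \<open>Weak gradient and linearised elasticity\<close>

text \<open>Row \<open>i\<close> of the gradient of a vector field \<open>v\<close> is the gradient of \<open>v $ i\<close>. The type \<^typ>\<open>real^2^2\<close>
  with its inner product (Frobenius) is Euclidean \<open>\<real>\<^sup>4\<close>.\<close>

definition is_weak_gradient :: "(real^2) set \<Rightarrow> (real^2 \<Rightarrow> real^2) \<Rightarrow> (real^2 \<Rightarrow> real^2^2) \<Rightarrow> bool" where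
  "is_weak_gradient \<Omega> v G \<longleftrightarrow>
     (\<forall>\<phi> \<in> test_functions \<Omega>. \<forall>i j.
        (\<integral>x. v x $ i * frechet_derivative \<phi> (at x) (axis j 1) \<partial>lebesgue_on \<Omega>)
        = - (\<integral>x. G x $ i $ j * \<phi> x \<partial>lebesgue_on \<Omega>))"

definition H1_space :: "(real^2) set \<Rightarrow> (real^2 \<Rightarrow> real^2) set" where
  "H1_space \<Omega> =
     {v \<in> L2_space (lebesgue_on \<Omega>). \<exists>G \<in> L2_space (lebesgue_on \<Omega>). is_weak_gradient \<Omega> v G}"

definition weak_grad :: "(real^2) set \<Rightarrow> (real^2 \<Rightarrow> real^2) \<Rightarrow> real^2 \<Rightarrow> real^2^2" where
  "weak_grad \<Omega> v = (SOME G. G \<in> L2_space (lebesgue_on \<Omega>) \<and> is_weak_gradient \<Omega> v G)"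

definition mollified_grad :: "(real^2) set \<Rightarrow> (real^2 \<Rightarrow> real) \<Rightarrow> (real^2 \<Rightarrow> real^2) \<Rightarrow> real^2 \<Rightarrow> real^2^2" where
  "mollified_grad \<Omega> \<eta> v x = (\<integral>z. \<eta> (x - z) *\<^sub>R weak_grad \<Omega> v z \<partial>lebesgue_on \<Omega>)"

definition strain :: "(real^2) set \<Rightarrow> (real^2 \<Rightarrow> real^2) \<Rightarrow> real^2 \<Rightarrow> real^2^2" where
  "strain \<Omega> v x = (1/2) *\<^sub>R (weak_grad \<Omega> v x + transpose (weak_grad \<Omega> v x))"

definition elasticity :: "(real^2 \<Rightarrow> real) \<Rightarrow> (real^2 \<Rightarrow> real) \<Rightarrow> real^2 \<Rightarrow> real^2^2 \<Rightarrow> real^2^2" where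
  "elasticity lam mu x A = (lam x * trace A) *\<^sub>R mat 1 + (2 * mu x) *\<^sub>R A"

definition uniformly_elliptic :: "(real^2) set \<Rightarrow> (real^2 \<Rightarrow> real) \<Rightarrow> (real^2 \<Rightarrow> real) \<Rightarrow> bool" where
  "uniformly_elliptic \<Omega> lam mu \<longleftrightarrow>
     (\<exists>c>0. AE x in lebesgue_on \<Omega>. \<forall>A. transpose A = A \<longrightarrow> c * (norm A)\<^sup>2 \<le> elasticity lam mu x A \<bullet> A)"


section \<open>Discrete displacement\<close>

definition mesh :: "(real^2) set \<Rightarrow> real \<Rightarrow> (real^2) set set \<Rightarrow> bool" where
  "mesh \<Omega> h \<T> \<longleftrightarrow>
     triangulation \<T> \<and> (\<forall>K\<in>\<T>. 2 simplex K) \<and> \<Union>\<T> = closure \<Omega> \<and> h = Max (diameter ` \<T>)"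

text \<open>Fields in the finite element space are extended by zero outside the closed domain, so that the
  solution is unique as a function on the plane. The trace of such a (continuous) field on the
  boundary is its restriction.\<close>

definition P1_space :: "(real^2) set \<Rightarrow> (real^2) set \<Rightarrow> (real^2) set set \<Rightarrow> (real^2 \<Rightarrow> real^2) set" where
  "P1_space \<Omega> \<Gamma>\<^sub>0 \<T> =
     {v \<in> H1_space \<Omega>. continuous_on (closure \<Omega>) v \<and>
        (\<forall>K\<in>\<T>. \<exists>A b. \<forall>x\<in>K. v x = A *v x + b) \<and>
        (\<forall>x\<in>\<Gamma>\<^sub>0. v x = 0) \<and> (\<forall>x. x \<notin> closure \<Omega> \<longrightarrow> v x = 0)}"

definition discrete_displacement ::
    "(real^2) set \<Rightarrow> (real^2) set \<Rightarrow> (real^2) set \<Rightarrow> (real^2) set set \<Rightarrow> (real^2 \<Rightarrow> real) \<Rightarrow> (real^2 \<Rightarrow> real)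
      \<Rightarrow> (real \<Rightarrow> real^2 \<Rightarrow> real^2) \<Rightarrow> (real \<Rightarrow> real^2 \<Rightarrow> real^2) \<Rightarrow> real \<Rightarrow> (real^2 \<Rightarrow> real) \<Rightarrow> real^2 \<Rightarrow> real^2"
  where
  "discrete_displacement \<Omega> \<Gamma>\<^sub>0 \<Gamma>\<^sub>2 \<T> lam mu f q t dt =
     (THE u. u \<in> P1_space \<Omega> \<Gamma>\<^sub>0 \<T> \<and>
        (\<forall>\<phi> \<in> P1_space \<Omega> \<Gamma>\<^sub>0 \<T>.
           (\<integral>x. (1 - dt x) * (elasticity lam mu x (strain \<Omega> u x) \<bullet> strain \<Omega> \<phi> x) \<partial>lebesgue_on \<Omega>)
           = (\<integral>x. f t x \<bullet> \<phi> x \<partial>lebesgue_on \<Omega>)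
             + (\<integral>x. q t x \<bullet> \<phi> x \<partial>restrict_space hausdorff1 \<Gamma>\<^sub>2)))"


section \<open>Damage evolution\<close>

definition damage_functions :: "real \<Rightarrow> (real^2) set \<Rightarrow> real \<Rightarrow> (real \<Rightarrow> real^2 \<Rightarrow> real) set" where
  "damage_functions T \<Omega> \<omega>\<^sub>1 =
     {d \<in> W1inf T \<Omega>. AE t in lebesgue_on {0<..<T}. AE x in lebesgue_on \<Omega>. 0 \<le> d t x \<and> d t x \<le> \<omega>\<^sub>1}"

definition initial_damage :: "(real^2) set \<Rightarrow> real \<Rightarrow> (real^2 \<Rightarrow> real) set" where
  "initial_damage \<Omega> \<omega>\<^sub>0 = {d \<in> Linf \<Omega>. AE x in lebesgue_on \<Omega>. 0 \<le> d x \<and> d x \<le> \<omega>\<^sub>0}"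

text \<open>The value \<open>g t x\<close> is a function on \<open>Y\<close>; its values outside \<open>Y\<close> are irrelevant.\<close>

definition damage_processes ::
    "real \<Rightarrow> (real^2) set \<Rightarrow> real \<Rightarrow> real \<Rightarrow> real \<Rightarrow> (real^2^2) set \<Rightarrow> (real \<Rightarrow> real^2 \<Rightarrow> real^2^2 \<Rightarrow> real) set"
  where
  "damage_processes T \<Omega> \<alpha> \<omega>\<^sub>0 \<omega>\<^sub>1 Y =
     {g \<in> Linf_space (lebesgue_on {0<..<T})
            (Linf_space (lebesgue_on \<Omega>) (C11_space Y) (C11_norm Y))
            (Linf_norm (lebesgue_on \<Omega>) (C11_norm Y)).
        \<forall>y\<in>Y. AE t in lebesgue_on {0<..<T}. AE x in lebesgue_on \<Omega>.
          0 \<le> g t x y \<and> g t x y \<le> inverse T * (\<omega>\<^sub>1 - \<omega>\<^sub>0) * (1 - \<omega>\<^sub>1) powr \<alpha>}"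

definition damage_rhs ::
    "(real^2) set \<Rightarrow> (real^2 \<Rightarrow> real) \<Rightarrow> real \<Rightarrow> (real \<Rightarrow> real^2 \<Rightarrow> real^2^2 \<Rightarrow> real)
      \<Rightarrow> (real \<Rightarrow> (real^2 \<Rightarrow> real) \<Rightarrow> real^2 \<Rightarrow> real^2) \<Rightarrow> (real \<Rightarrow> real^2 \<Rightarrow> real) \<Rightarrow> real \<Rightarrow> real^2 \<Rightarrow> real"
  where
  "damage_rhs \<Omega> \<eta> \<alpha> g disp d t x =
     g t x (mollified_grad \<Omega> \<eta> (disp t (d t)) x) * (1 - d t x) powr (- \<alpha>)"

definition solves_damage_evolution ::
    "real \<Rightarrow> (real^2) set \<Rightarrow> ((real \<Rightarrow> real^2 \<Rightarrow> real) \<Rightarrow> real \<Rightarrow> real^2 \<Rightarrow> real)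
      \<Rightarrow> (real^2 \<Rightarrow> real) \<Rightarrow> (real \<Rightarrow> real^2 \<Rightarrow> real) \<Rightarrow> bool"
  where
  "solves_damage_evolution T \<Omega> r d\<^sub>0 d \<longleftrightarrow>
     (\<exists>w \<in> Linf_space (lebesgue_on {0<..<T}) (Linf \<Omega>) (normLinf \<Omega>).
        weak_time_derivative T \<Omega> d w \<and>
        (AE t in lebesgue_on {0<..<T}. AE x in lebesgue_on \<Omega>. w t x = r d t x)) \<and>
     (AE x in lebesgue_on \<Omega>. d 0 x = d\<^sub>0 x)"

definition consistency_error ::
    "((real \<Rightarrow> real^2 \<Rightarrow> real) \<Rightarrow> real \<Rightarrow> real^2 \<Rightarrow> real) \<Rightarrow> (real \<Rightarrow> real^2 \<Rightarrow> real) \<Rightarrow> real \<Rightarrow> real^2 \<Rightarrow> real \<Rightarrow> real"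
  where
  "consistency_error r d t x \<tau> = d (t + \<tau>) x - d t x - \<tau> * r d t x"

end

theory Submission
  imports Defs
begin

text \<open>
  Since \<open>d\<^sub>h\<close> has an essentially bounded weak time derivative, it is Lipschitz in time with values in
  \<open>L\<^sup>\<infinity>(\<Omega>)\<close>. The discrete displacement is a Lipschitz function of time along \<open>d\<^sub>h\<close>: in coordinates with
  respect to a basis of the finite element space that is orthonormal for the strain product, this is
  the standard perturbation argument for a coercive form (definiteness is a discrete Korn inequality).
  Mollified gradients are linear on this finite-dimensional space, and \<open>g\<close> and
  \<open>d \<mapsto> (1 - d)\<^sup>-\<^sup>\<alpha>\<close> are Lipschitz, so \<open>t \<mapsto> r\<^sub>h(d\<^sub>h)(t)\<close> is Lipschitz into \<open>L\<^sup>\<infinity>(\<Omega>)\<close>, with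
  constant \<open>L\<close> say. The error is the integral of \<open>r\<^sub>h(d\<^sub>h)(s) - r\<^sub>h(d\<^sub>h)(t)\<close> over \<open>[t, t + \<tau>]\<close>, hence
  at most \<open>L \<tau>\<^sup>2\<close>. Test functions are built from antiderivatives of a slice of the given
  mollifier kernel.
\<close>

section \<open>Essentially bounded functions\<close>

text \<open>Null sets shape the argument. The evolution equation holds at almost every time only,
  while the error is bounded at every \<open>t\<close>. So the bounds on \<open>d\<^sub>h\<close>
  are first extended to every time by norm continuity, and most estimates fix \<open>s\<close> and
  \<open>t\<close> and hold off a null set of points that may depend on them. Similarly,
  \<open>weak_grad\<close> selects some representative, so its linearity rests on uniqueness of weak
  gradients, hence on the fundamental lemma of the calculus of variations.

  The mesh is fixed, so constants may depend on it, and finite sums over a basis take the place of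
  continuity estimates in Sobolev norms. The traction term still needs a boundary of finite length,
  so that bounded fields pair with square integrable tractions.

  Bochner integrals with values in essentially bounded functions enter only through integration over
  measurable sets \<open>B\<close>: these functionals commute with the Bochner integral, and
  together they control the essential supremum. The resulting increment bound compares the weak
  derivative with a fixed \<open>z\<close>: \<open>z = 0\<close> makes \<open>d\<^sub>h\<close>
  Lipschitz, and \<open>z = r\<^sub>h d\<^sub>h t\<close> gives the consistency error.\<close>

lemma borel_measurable_lebesgue_on_AE:
  fixes f g :: "'a::euclidean_space \<Rightarrow> 'b::euclidean_space"
  assumes "S \<in> sets lebesgue" "f \<in> borel_measurable (lebesgue_on S)" "AE x in lebesgue_on S. f x = g x"
  shows "g \<in> borel_measurable (lebesgue_on S)"
proof -
  have "(\<lambda>x. if x \<in> S then f x else 0) \<in> borel_measurable lebesgue"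
    using assms by (simp add: borel_measurable_if)
  moreover have "AE x in lebesgue. (if x \<in> S then f x else 0) = (if x \<in> S then g x else 0)"
    using assms by (subst (asm) AE_restrict_space_iff) auto
  ultimately have "(\<lambda>x. if x \<in> S then g x else 0) \<in> borel_measurable lebesgue"
    by (rule borel_measurable_AE)
  then show ?thesis using assms by (simp add: borel_measurable_if)
qed

text \<open>Where the sequence diverges \<open>lim\<close> is an arbitrary value, but this happens
  only on a null set, and Lebesgue measure is complete.\<close>

lemma borel_measurable_lebesgue_on_AE_LIMSEQ:
  fixes f :: "nat \<Rightarrow> 'a::euclidean_space \<Rightarrow> 'b::euclidean_space"
  assumes S: "S \<in> sets lebesgue" and f: "\<And>n. f n \<in> borel_measurable (lebesgue_on S)"
    and lim: "AE x in lebesgue_on S. (\<lambda>n. f n x) \<longlonglongrightarrow> g x"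
  shows "g \<in> borel_measurable (lebesgue_on S)"
proof (rule borel_measurable_lebesgue_on_AE[OF S])
  show "(\<lambda>x. lim (\<lambda>n. f n x)) \<in> borel_measurable (lebesgue_on S)"
    using f by (rule borel_measurable_lim_metric)
  show "AE x in lebesgue_on S. lim (\<lambda>n. f n x) = g x"
    using lim by eventually_elim (rule limI)
qed

text \<open>For real values strong measurability is ordinary measurability: measurable functions are
  pointwise limits of simple ones, and a.e. limits of simple functions are measurable. This
  translates the abstract class into familiar terms.\<close>

lemma Linf_space_iff:
  fixes v :: "'a::euclidean_space \<Rightarrow> real"
  assumes S: "S \<in> sets lebesgue"
  shows "v \<in> Linf_space (lebesgue_on S) UNIV abs \<longleftrightarrow>
    v \<in> borel_measurable (lebesgue_on S) \<and> (\<exists>C. AE x in lebesgue_on S. \<bar>v x\<bar> \<le> C)"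
proof safe
  assume "v \<in> Linf_space (lebesgue_on S) UNIV abs"
  then obtain s where s: "\<And>n::nat. simple_function (lebesgue_on S) (s n)"
      "AE x in lebesgue_on S. (\<lambda>n. \<bar>s n x - v x\<bar>) \<longlonglongrightarrow> 0"
    unfolding Linf_space_def strongly_measurable_def by blast
  show "v \<in> borel_measurable (lebesgue_on S)"
  proof (rule borel_measurable_lebesgue_on_AE_LIMSEQ[OF S])
    show "s n \<in> borel_measurable (lebesgue_on S)" for n
      by (rule borel_measurable_simple_function[OF s(1)])
    show "AE x in lebesgue_on S. (\<lambda>n. s n x) \<longlonglongrightarrow> v x"
      using s(2) by eventually_elim (simp add: tendsto_rabs_zero_iff LIM_zero_iff)
  qed
next
  assume "v \<in> Linf_space (lebesgue_on S) UNIV abs"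
  then show "\<exists>C. AE x in lebesgue_on S. \<bar>v x\<bar> \<le> C" by (auto simp: Linf_space_def)
next
  fix C assume v: "v \<in> borel_measurable (lebesgue_on S)" "AE x in lebesgue_on S. \<bar>v x\<bar> \<le> C"
  obtain s where "\<And>n. simple_function (lebesgue_on S) (s n)"
     "\<And>x. x \<in> space (lebesgue_on S) \<Longrightarrow> (\<lambda>n. s n x) \<longlonglongrightarrow> v x"
    using borel_measurable_implies_sequence_metric[OF v(1), of 0] by metis
  then have "\<exists>s. (\<forall>n::nat. simple_function (lebesgue_on S) (s n) \<and> s n ` space (lebesgue_on S) \<subseteq> UNIV) \<and>
      (AE x in lebesgue_on S. (\<lambda>n. \<bar>s n x - v x\<bar>) \<longlonglongrightarrow> 0)"
    by (intro exI[of _ s] conjI allI AE_I2 tendsto_rabs_zero LIM_zero) simp_all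
  then show "v \<in> Linf_space (lebesgue_on S) UNIV abs"
    unfolding Linf_space_def strongly_measurable_def using v(2) by blast
qed

text \<open>The infimum defining the norm is attained, because the bounds with slack
  \<open>1 / Suc n\<close> fail only on countably many null sets. The hypothesis ensures that the
  infimum is taken over a nonempty set.\<close>

lemma AE_le_Linf_norm:
  assumes "AE x in M. N (v x) \<le> C"
  shows "AE x in M. N (v x) \<le> Linf_norm M N v"
proof -
  let ?A = "{C. 0 \<le> C \<and> (AE x in M. N (v x) \<le> C)}"
  have "max 0 C \<in> ?A" using assms by auto
  then have ne: "?A \<noteq> {}" by blast
  have "AE x in M. N (v x) \<le> Linf_norm M N v + 1 / Suc n" for n
  proof -
    have "Inf ?A < Linf_norm M N v + 1 / Suc n" by (simp add: Linf_norm_def)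
    then obtain c where "c \<in> ?A" "c < Linf_norm M N v + 1 / Suc n"
      using cInf_lessD[OF ne] by blast
    then show ?thesis by (auto elim: eventually_mono)
  qed
  then have "AE x in M. \<forall>n. N (v x) \<le> Linf_norm M N v + 1 / Suc n"
    by (simp add: AE_all_countable)
  then show ?thesis
  proof eventually_elim
    case (elim x)
    have "(\<lambda>n. Linf_norm M N v + 1 / Suc n) \<longlonglongrightarrow> Linf_norm M N v + 0"
      by (intro tendsto_add tendsto_const LIMSEQ_Suc lim_1_over_n)
    with elim show ?case by (intro LIMSEQ_le_const) auto
  qed
qed

lemma Linf_norm_nonneg: "AE x in M. N (v x) \<le> C \<Longrightarrow> 0 \<le> Linf_norm M N v"
proof -
  assume "AE x in M. N (v x) \<le> C"
  then have "AE x in M. N (v x) \<le> max 0 C" by (auto elim: eventually_mono)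
  then have "max 0 C \<in> {C. 0 \<le> C \<and> (AE x in M. N (v x) \<le> C)}" by simp
  then have "{C. 0 \<le> C \<and> (AE x in M. N (v x) \<le> C)} \<noteq> {}" by blast
  then show ?thesis unfolding Linf_norm_def by (rule cInf_greatest) auto
qed

section \<open>Smooth functions\<close>

lemma Ck_differentiable: "Ck (Suc k) \<phi> \<Longrightarrow> \<phi> differentiable at x"
  by simp

lemma Ck_has_derivative:
  "Ck (Suc k) \<phi> \<Longrightarrow> (\<phi> has_derivative frechet_derivative \<phi> (at x)) (at x)"
  by (rule frechet_derivative_works[THEN iffD1]) simp

lemma smooth_differentiable: "smooth \<phi> \<Longrightarrow> \<phi> differentiable at x"
  unfolding smooth_def by (metis Ck_differentiable)

lemma smooth_continuous: "smooth \<phi> \<Longrightarrow> continuous_on S \<phi>"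
  unfolding smooth_def by (metis Ck.simps(1) continuous_on_subset subset_UNIV)

lemma smooth_partial: "smooth \<phi> \<Longrightarrow> b \<in> Basis \<Longrightarrow> smooth (\<lambda>x. frechet_derivative \<phi> (at x) b)"
  unfolding smooth_def by (metis Ck.simps(2))

lemma Ck_const: "Ck k (\<lambda>_. c)"
  by (induction k arbitrary: c) auto

lemma Ck_scale: "Ck k \<phi> \<Longrightarrow> Ck k (\<lambda>x. c * \<phi> x)"
proof (induction k arbitrary: \<phi>)
  case 0 then show ?case by (auto intro: continuous_intros)
next
  case (Suc k)
  have "frechet_derivative (\<lambda>x. c * \<phi> x) (at x) = (\<lambda>b. c * frechet_derivative \<phi> (at x) b)" for x
    by (rule frechet_derivative_at[symmetric], rule has_derivative_mult_right)
      (rule Ck_has_derivative[OF Suc.prems])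
  with Suc show ?case by (auto intro!: derivative_intros)
qed

lemma Ck_diff: "Ck k \<phi> \<Longrightarrow> Ck k \<psi> \<Longrightarrow> Ck k (\<lambda>x. \<phi> x - \<psi> x)"
proof (induction k arbitrary: \<phi> \<psi>)
  case 0 then show ?case by (auto intro: continuous_intros)
next
  case (Suc k)
  have "frechet_derivative (\<lambda>x. \<phi> x - \<psi> x) (at x)
      = (\<lambda>b. frechet_derivative \<phi> (at x) b - frechet_derivative \<psi> (at x) b)" for x
    by (rule frechet_derivative_at[symmetric], rule has_derivative_diff)
      (rule Ck_has_derivative[OF Suc.prems(1)], rule Ck_has_derivative[OF Suc.prems(2)])
  with Suc show ?case by (auto intro!: derivative_intros)
qed

text \<open>\<open>Ck\<close> speaks of partial derivatives in basis directions only. If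
  \<open>L\<close> sends basis vectors to multiples of basis vectors, the chain rule expresses each
  partial derivative by a single partial derivative of \<open>\<phi>\<close>, so the induction stays
  within functions of the same form.\<close>

lemma Ck_affine:
  fixes L :: "'a::euclidean_space \<Rightarrow> 'b::euclidean_space"
  assumes L: "linear L" and LB: "\<And>b. b \<in> Basis \<Longrightarrow> \<exists>c. \<exists>b'\<in>Basis. L b = c *\<^sub>R b'"
  shows "Ck k \<phi> \<Longrightarrow> Ck k (\<lambda>x. \<phi> (p + L x))"
proof (induction k arbitrary: \<phi>)
  case 0
  have "continuous_on UNIV L" using L by (intro linear_continuous_on) (simp add: linear_conv_bounded_linear)
  then have "continuous_on UNIV (\<lambda>x. p + L x)" by (intro continuous_intros)
  then show ?case using 0 by (auto intro: continuous_on_compose2[of UNIV \<phi>])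
next
  case (Suc k)
  have bl: "bounded_linear L" using L by (simp add: linear_conv_bounded_linear)
  have d: "((\<lambda>x. \<phi> (p + L x)) has_derivative (\<lambda>b. frechet_derivative \<phi> (at (p + L x)) (L b))) (at x)" for x
  proof -
    have 1: "((\<lambda>x. p + L x) has_derivative L) (at x)"
      using bl by (auto intro!: derivative_eq_intros bounded_linear_imp_has_derivative)
    have "(\<phi> has_derivative frechet_derivative \<phi> (at (p + L x))) (at (p + L x))"
      by (rule Ck_has_derivative[OF Suc.prems])
    from diff_chain_at[OF 1 this] show ?thesis by (simp add: o_def)
  qed
  then have eq: "frechet_derivative (\<lambda>x. \<phi> (p + L x)) (at x) = (\<lambda>b. frechet_derivative \<phi> (at (p + L x)) (L b))" for x
    using frechet_derivative_at by metis
  have "Ck k (\<lambda>x. frechet_derivative \<phi> (at (p + L x)) (L b))" if b: "b \<in> Basis" for b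
  proof -
    obtain c b' where cb: "b' \<in> Basis" "L b = c *\<^sub>R b'" using LB[OF b] by blast
    have "linear (frechet_derivative \<phi> (at y))" for y
      using Suc.prems by (auto intro: linear_frechet_derivative)
    then have "(\<lambda>x. frechet_derivative \<phi> (at (p + L x)) (L b)) = (\<lambda>x. c * frechet_derivative \<phi> (at (p + L x)) b')"
      by (simp add: cb(2) linear_scale)
    moreover have "Ck k (\<lambda>x. c * frechet_derivative \<phi> (at (p + L x)) b')"
      using Suc.prems cb(1) by (intro Ck_scale Suc.IH[of "\<lambda>y. frechet_derivative \<phi> (at y) b'"]) auto
    ultimately show ?thesis by (simp only:)
  qed
  then show ?case using d by (auto simp: eq differentiable_def)
qed

lemma smooth_diff: "smooth \<phi> \<Longrightarrow> smooth \<psi> \<Longrightarrow> smooth (\<lambda>x. \<phi> x - \<psi> x)"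
  by (simp add: smooth_def Ck_diff)

lemma smooth_scale: "smooth \<phi> \<Longrightarrow> smooth (\<lambda>x. c * \<phi> x)"
  by (simp add: smooth_def Ck_scale)

lemma smooth_affine_real:
  fixes \<phi> :: "real \<Rightarrow> real"
  assumes "smooth \<phi>"
  shows "smooth (\<lambda>t. \<phi> (p + c * t))"
  using assms Ck_affine[of "(*) c" _ \<phi> p]
  by (auto simp: smooth_def linear_times)

lemma frechet_derivative_real:
  fixes \<phi> :: "real \<Rightarrow> real"
  assumes "\<phi> differentiable at x"
  shows "frechet_derivative \<phi> (at x) = (\<lambda>h. deriv \<phi> x * h)"
proof -
  have "(\<phi> has_real_derivative deriv \<phi> x) (at x)"
    using assms by (simp add: DERIV_deriv_iff_real_differentiable)
  then show ?thesis
    unfolding has_field_derivative_def by (rule frechet_derivative_at[symmetric])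
qed

lemma smooth_deriv:
  fixes \<phi> :: "real \<Rightarrow> real"
  assumes "smooth \<phi>"
  shows "smooth (deriv \<phi>)"
proof -
  have "(\<lambda>x. frechet_derivative \<phi> (at x) 1) = deriv \<phi>"
    using frechet_derivative_real[OF smooth_differentiable[OF assms]] by auto
  then show ?thesis using smooth_partial[OF assms, of 1] by simp
qed

lemma smooth_DERIV:
  fixes \<phi> :: "real \<Rightarrow> real"
  shows "smooth \<phi> \<Longrightarrow> (\<phi> has_real_derivative deriv \<phi> x) (at x)"
  by (simp add: DERIV_deriv_iff_real_differentiable smooth_differentiable)

text \<open>The only partial derivative of \<open>F\<close> is \<open>f\<close>, so each order of
  smoothness of \<open>F\<close> is one of \<open>f\<close>.\<close>

lemma smooth_antiderivative:
  fixes F f :: "real \<Rightarrow> real"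
  assumes f: "smooth f" and F: "\<And>x. (F has_real_derivative f x) (at x)"
  shows "smooth F"
  unfolding smooth_def
proof
  fix k
  have d: "F differentiable at x" for x
    using F real_differentiable_def by blast
  show "Ck k F"
  proof (cases k)
    case 0
    have "continuous_on UNIV F"
      using d by (simp add: continuous_on_eq_continuous_at differentiable_imp_continuous_within)
    then show ?thesis by (simp add: 0)
  next
    case (Suc j)
    have "(\<lambda>x. frechet_derivative F (at x) 1) = f"
      using frechet_derivative_real[OF d] DERIV_imp_deriv[OF F] by auto
    then show ?thesis using f d by (simp add: Suc smooth_def)
  qed
qed

text \<open>A partial derivative of a tensor product is again a tensor product, with one factor
  replaced by its derivative. Hence the induction is on the order, for all families
  \<open>\<phi>\<close> at once.\<close>

lemma smooth_prod:
  fixes \<phi> :: "'a::euclidean_space \<Rightarrow> real \<Rightarrow> real"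
  assumes "\<And>i. i \<in> Basis \<Longrightarrow> smooth (\<phi> i)"
  shows "smooth (\<lambda>x. \<Prod>i\<in>Basis. \<phi> i (x \<bullet> i))"
  unfolding smooth_def
proof
  fix k
  show "Ck k (\<lambda>x. \<Prod>i\<in>Basis. \<phi> i (x \<bullet> i))"
    using assms
  proof (induction k arbitrary: \<phi>)
    case 0
    have "continuous_on UNIV (\<lambda>x. \<phi> i (x \<bullet> i))" if "i \<in> Basis" for i
      by (rule continuous_on_compose2[OF smooth_continuous[OF 0[OF that], of UNIV]])
         (auto intro: continuous_intros)
    then show ?case by (simp add: continuous_on_prod)
  next
    case (Suc k)
    have 1: "((\<lambda>x. \<phi> i (x \<bullet> i)) has_derivative (\<lambda>h. deriv (\<phi> i) (x \<bullet> i) * (h \<bullet> i))) (at x)"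
      if "i \<in> Basis" for i x
    proof -
      have "((\<lambda>x. x \<bullet> i) has_derivative (\<lambda>h. h \<bullet> i)) (at x)" by (auto intro!: derivative_eq_intros)
      moreover have "(\<phi> i has_derivative (*) (deriv (\<phi> i) (x \<bullet> i))) (at (x \<bullet> i))"
        using smooth_DERIV[OF Suc.prems[OF that]] unfolding has_field_derivative_def .
      ultimately show ?thesis using diff_chain_at by (fastforce simp: o_def)
    qed
    have d: "((\<lambda>x. \<Prod>i\<in>Basis. \<phi> i (x \<bullet> i)) has_derivative
       (\<lambda>h. \<Sum>i\<in>Basis. deriv (\<phi> i) (x \<bullet> i) * (h \<bullet> i) * (\<Prod>j\<in>Basis - {i}. \<phi> j (x \<bullet> j)))) (at x)" for x
      by (rule has_derivative_prod) (rule 1)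
    have eq: "frechet_derivative (\<lambda>x. \<Prod>i\<in>Basis. \<phi> i (x \<bullet> i)) (at x) b
       = (\<Prod>i\<in>Basis. (\<phi>(b := deriv (\<phi> b))) i (x \<bullet> i))" if b: "b \<in> Basis" for b x
    proof -
      have "frechet_derivative (\<lambda>x. \<Prod>i\<in>Basis. \<phi> i (x \<bullet> i)) (at x) b
         = (\<Sum>i\<in>Basis. deriv (\<phi> i) (x \<bullet> i) * (b \<bullet> i) * (\<Prod>j\<in>Basis - {i}. \<phi> j (x \<bullet> j)))"
        by (subst frechet_derivative_at[OF d, symmetric]) simp
      also have "\<dots> = (\<Sum>i\<in>Basis. if i = b then deriv (\<phi> b) (x \<bullet> b) * (\<Prod>j\<in>Basis - {b}. \<phi> j (x \<bullet> j)) else 0)"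
        using b by (intro sum.cong) (auto simp: inner_Basis)
      also have "\<dots> = deriv (\<phi> b) (x \<bullet> b) * (\<Prod>j\<in>Basis - {b}. \<phi> j (x \<bullet> j))" using b by simp
      also have "\<dots> = (\<Prod>i\<in>Basis. (\<phi>(b := deriv (\<phi> b))) i (x \<bullet> i))"
        using b by (subst prod.remove[of Basis b]) auto
      finally show ?thesis .
    qed
    have "Ck k (\<lambda>x. frechet_derivative (\<lambda>x. \<Prod>i\<in>Basis. \<phi> i (x \<bullet> i)) (at x) b)" if "b \<in> Basis" for b
      unfolding eq[OF that] using Suc.prems that by (intro Suc.IH) (auto intro: smooth_deriv)
    then show ?case using d by (auto simp: differentiable_def)
  qed
qed

text \<open>Monotonicity is part of the notion because it makes the derivative a nonnegative density
  of total mass 1; this turns weak derivatives into differences of local averages later on.\<close>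

definition smooth_step :: "(real \<Rightarrow> real) \<Rightarrow> bool" where
  "smooth_step h \<longleftrightarrow> smooth h \<and> mono h \<and> (\<forall>t\<le>0. h t = 0) \<and> (\<forall>t\<ge>1. h t = 1)"

text \<open>The step is an antiderivative of the bump, normalised to increase by 1, with
  \<open>[-S, S]\<close> rescaled to \<open>[0, 1]\<close>.\<close>

lemma smooth_step_exists_of_bump:
  fixes \<rho> :: "real \<Rightarrow> real"
  assumes \<rho>: "smooth \<rho>" "\<And>t. 0 \<le> \<rho> t" "0 < \<rho> 0" and R: "\<And>t. R < \<bar>t\<bar> \<Longrightarrow> \<rho> t = 0"
  shows "\<exists>h. smooth_step h"
proof -
  define F where "F t = (LBINT y=ereal 0..ereal t. \<rho> y)" for t
  have F: "(F has_real_derivative \<rho> x) (at x)" for x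
  proof -
    have "(F has_vector_derivative \<rho> x) (at x within {- (\<bar>x\<bar> + 1)..\<bar>x\<bar> + 1})"
      unfolding F_def
      by (rule interval_integral_FTC2) (auto intro!: smooth_continuous \<rho>)
    moreover have "at x within {- (\<bar>x\<bar> + 1)..\<bar>x\<bar> + 1} = at x"
      by (rule at_within_interior) (auto simp: interior_atLeastAtMost_real)
    ultimately show ?thesis
      by (simp add: has_real_derivative_iff_has_vector_derivative)
  qed
  have mono: "F s \<le> F t" if "s \<le> t" for s t
    using F \<rho>(2) that by (intro DERIV_nonneg_imp_nondecreasing[of s t F]) auto
  \<comment> \<open>The antiderivative increases strictly to the right of 0, so the normalising
    denominator \<open>F S - F (- S)\<close> is positive.\<close>
  obtain d where d: "d > 0" "\<And>h. 0 < h \<Longrightarrow> h < d \<Longrightarrow> F 0 < F (0 + h)"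
    using DERIV_pos_inc_right[OF F \<rho>(3)] by auto
  have "0 \<le> R" using R[of 0] \<rho>(3) by (cases "R < 0") auto
  \<comment> \<open>The extra 1 makes \<open>S\<close> positive and turns the strict condition
    \<open>R < \<bar>t\<bar>\<close> into \<open>S \<le> \<bar>t\<bar>\<close>.\<close>
  define S where "S = R + 1"
  have S: "S > 0" "\<And>t. S \<le> \<bar>t\<bar> \<Longrightarrow> \<rho> t = 0" using \<open>0 \<le> R\<close> R by (auto simp: S_def)
  have "F (- S) \<le> F 0" "F 0 < F (min (d/2) S)" "F (min (d/2) S) \<le> F S"
    using mono S(1) d(1) d(2)[of "min (d/2) S"] by auto
  then have FS: "F (- S) < F S" by linarith
  have const: "F t = F s" if st: "s < t" and z: "\<And>y. s \<le> y \<Longrightarrow> y \<le> t \<Longrightarrow> \<rho> y = 0" for s t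
    using st
  proof (rule DERIV_isconst_end)
    show "continuous_on {s..t} F"
      by (rule DERIV_continuous_on[OF DERIV_subset[OF F]]) auto
    show "(F has_real_derivative 0) (at y)" if "s < y" "y < t" for y
      using F[of y] z[of y] that by simp
  qed
  have right: "F t = F S" if "S \<le> t" for t
    using const[of S t] S that by (cases "S = t") auto
  have left: "F t = F (- S)" if "t \<le> - S" for t
    using const[of t "- S"] S that by (cases "t = - S") auto
  define G where "G t = F (- S + (2 * S) * t)" for t
  define h where "h t = inverse (F S - F (- S)) * (G t - F (- S))" for t
  have "smooth F" by (rule smooth_antiderivative[OF \<rho>(1) F])
  then have "smooth G" unfolding G_def by (rule smooth_affine_real)
  then have "smooth h" unfolding h_def
    by (intro smooth_scale smooth_diff) (auto simp: smooth_def Ck_const)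
  moreover have "mono h"
  proof (rule monoI)
    fix s t :: real assume "s \<le> t"
    then have "G s \<le> G t" using S(1) by (auto simp: G_def intro!: mono mult_left_mono)
    then show "h s \<le> h t" using FS by (auto simp: h_def intro!: mult_left_mono)
  qed
  moreover have "h t = 0" if "t \<le> 0" for t
  proof -
    have "2 * S * t \<le> 0" using that S(1) by (simp add: mult_nonneg_nonpos)
    then show ?thesis using left[of "- S + 2 * S * t"] by (simp add: h_def G_def)
  qed
  moreover have "h t = 1" if "1 \<le> t" for t
  proof -
    have "2 * S * 1 \<le> 2 * S * t" using that S(1) by (intro mult_left_mono) auto
    then show ?thesis using right[of "- S + 2 * S * t"] FS by (simp add: h_def G_def)
  qed
  ultimately show ?thesis by (auto simp: smooth_step_def)
qed

text \<open>A kernel of integral 1 is positive at some \<open>p\<close>. Its restriction to the line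
  through \<open>p\<close> along a coordinate axis is smooth, nonnegative, positive at parameter 0
  and compactly supported.\<close>

lemma smooth_step_exists:
  assumes "mollifier_kernel \<eta>"
  shows "\<exists>h. smooth_step h"
proof -
  have \<eta>: "smooth \<eta>" "compact (closure {x. \<eta> x \<noteq> 0})" "\<And>x. 0 \<le> \<eta> x" "(\<integral>x. \<eta> x \<partial>lborel) = 1"
    using assms by (auto simp: mollifier_kernel_def test_functions_def)
  have "\<eta> \<noteq> (\<lambda>_. 0)" using \<eta>(4) by auto
  then obtain p where "\<eta> p \<noteq> 0" by auto
  then have p: "0 < \<eta> p" using \<eta>(3)[of p] by simp
  obtain R where "\<forall>x\<in>closure {x. \<eta> x \<noteq> 0}. norm x \<le> R"
    using compact_imp_bounded[OF \<eta>(2)] unfolding bounded_iff by auto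
  then have R: "norm x \<le> R" if "\<eta> x \<noteq> 0" for x
    using that closure_subset[of "{x. \<eta> x \<noteq> 0}"] by auto
  define e :: "real^2" where "e = axis 1 1"
  have e: "e \<in> Basis" by (simp add: e_def axis_in_Basis_iff)
  then have e1: "norm e = 1" by (rule norm_Basis)
  show ?thesis
  proof (rule smooth_step_exists_of_bump[of "\<lambda>t. \<eta> (p + t *\<^sub>R e)" "R + norm p"])
    show "smooth (\<lambda>t. \<eta> (p + t *\<^sub>R e))"
      unfolding smooth_def
    proof (intro allI Ck_affine)
      show "linear (\<lambda>t. t *\<^sub>R e)" by (simp add: linearI scaleR_left_distrib)
      show "\<exists>c. \<exists>b'\<in>Basis. b *\<^sub>R e = c *\<^sub>R b'" for b using e by blast
      show "Ck k \<eta>" for k using \<eta>(1) by (simp add: smooth_def)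
    qed
    show "\<eta> (p + t *\<^sub>R e) = 0" if "R + norm p < \<bar>t\<bar>" for t
    proof (rule ccontr)
      assume "\<eta> (p + t *\<^sub>R e) \<noteq> 0"
      then have "norm (p + t *\<^sub>R e) \<le> R" by (rule R)
      moreover have "norm (t *\<^sub>R e) \<le> norm (p + t *\<^sub>R e) + norm p"
        using norm_triangle_ineq4[of "p + t *\<^sub>R e" p] by simp
      ultimately show False using that e1 by simp
    qed
  qed (use \<eta>(3) p in auto)
qed

section \<open>Cut-off functions and the fundamental lemma\<close>

text \<open>The function rises on \<open>[a + e, a + 2 * e]\<close> and falls on
  \<open>[b - 2 * e, b - e]\<close>. The summand 4 in the denominator of \<open>e\<close> gives
  \<open>4 * e \<le> b - a\<close>, so the two ramps do not overlap, and it keeps the support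
  compactly inside \<open>(a, b)\<close>.\<close>

definition cutoff :: "(real \<Rightarrow> real) \<Rightarrow> real \<Rightarrow> real \<Rightarrow> nat \<Rightarrow> real \<Rightarrow> real" where
  "cutoff h a b n t = (let e = (b - a) / (real n + 4) in h ((t - a) / e - 1) - h ((t - b) / e + 2))"

lemma smooth_stepD:
  assumes "smooth_step h"
  shows "smooth h" "s \<le> t \<Longrightarrow> h s \<le> h t" "t \<le> 0 \<Longrightarrow> h t = 0" "1 \<le> t \<Longrightarrow> h t = 1"
    "0 \<le> h t" "h t \<le> 1"
proof -
  show 1: "smooth h" "s \<le> t \<Longrightarrow> h s \<le> h t" for s t
    using assms by (auto simp: smooth_step_def mono_def)
  show 2: "t \<le> 0 \<Longrightarrow> h t = 0" "1 \<le> t \<Longrightarrow> h t = 1" for t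
    using assms by (auto simp: smooth_step_def)
  show "0 \<le> h t" using 1(2)[of "min t 0" t] 2(1)[of "min t 0"] by simp
  show "h t \<le> 1" using 1(2)[of t "max t 1"] 2(2)[of "max t 1"] by simp
qed

lemma smooth_cutoff:
  assumes h: "smooth_step h"
  shows "smooth (cutoff h a b n)"
proof -
  define e where "e = (b - a) / (real n + 4)"
  have eq: "cutoff h a b n = (\<lambda>t. h ((- a / e - 1) + inverse e * t) - h ((- b / e + 2) + inverse e * t))"
  proof
    fix t
    have "(t - a) / e - 1 = (- a / e - 1) + inverse e * t" "(t - b) / e + 2 = (- b / e + 2) + inverse e * t"
      by (simp_all add: divide_inverse algebra_simps)
    then show "cutoff h a b n t = h ((- a / e - 1) + inverse e * t) - h ((- b / e + 2) + inverse e * t)"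
      unfolding cutoff_def Let_def e_def[symmetric] by (simp only:)
  qed
  show ?thesis unfolding eq
    by (intro smooth_diff smooth_affine_real smooth_stepD[OF h])
qed

lemma cutoff_values:
  fixes a b :: real and n :: nat
  assumes h: "smooth_step h" and ab: "a < b"
  defines "e \<equiv> (b - a) / (real n + 4)"
  shows "0 < e" "a + 2 * e \<le> b - 2 * e"
    and cutoff_eq_0: "t \<le> a + e \<or> b - e \<le> t \<Longrightarrow> cutoff h a b n t = 0"
    and cutoff_eq_1: "a + 2 * e \<le> t \<Longrightarrow> t \<le> b - 2 * e \<Longrightarrow> cutoff h a b n t = 1"
    and cutoff_nonneg: "0 \<le> cutoff h a b n t" and cutoff_le_1: "cutoff h a b n t \<le> 1"
proof -
  show e: "0 < e" using ab by (simp add: e_def)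
  have "(b - a) * 4 \<le> (b - a) * (real n + 4)" using ab by (intro mult_left_mono) auto
  then have e4: "4 * e \<le> b - a" by (simp add: e_def divide_le_eq ac_simps)
  then show "a + 2 * e \<le> b - 2 * e" by simp
  have eq: "cutoff h a b n t = h ((t - a) / e - 1) - h ((t - b) / e + 2)" for t
    by (simp add: cutoff_def e_def Let_def)
  have l0: "t \<le> a + e \<Longrightarrow> (t - a) / e - 1 \<le> 0" and l1: "a + 2 * e \<le> t \<Longrightarrow> 1 \<le> (t - a) / e - 1"
    and r0: "t \<le> b - 2 * e \<Longrightarrow> (t - b) / e + 2 \<le> 0" and r1: "b - e \<le> t \<Longrightarrow> 1 \<le> (t - b) / e + 2" for t
    using e by (auto simp: field_simps)
  note hv = smooth_stepD(3,4)[OF h]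
  show "t \<le> a + e \<or> b - e \<le> t \<Longrightarrow> cutoff h a b n t = 0"
    using hv(1)[OF l0] hv(1)[OF r0] hv(2)[OF l1] hv(2)[OF r1] e e4 by (auto simp: eq)
  show "a + 2 * e \<le> t \<Longrightarrow> t \<le> b - 2 * e \<Longrightarrow> cutoff h a b n t = 1"
    using hv(1)[OF r0] hv(2)[OF l1] by (auto simp: eq)
  show "cutoff h a b n t \<le> 1"
    using smooth_stepD(5)[OF h, of "(t - b) / e + 2"] smooth_stepD(6)[OF h, of "(t - a) / e - 1"]
    by (simp add: eq)
  \<comment> \<open>Since the ramps are disjoint, at each \<open>t\<close> either the subtracted
    step is still 0 or the first step has already reached 1.\<close>
  show "0 \<le> cutoff h a b n t"
  proof (cases "t \<le> b - 2 * e")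
    case True
    then show ?thesis using hv(1)[OF r0] smooth_stepD(5)[OF h] by (simp add: eq)
  next
    case False
    then have "a + 2 * e \<le> t" using e4 by simp
    then show ?thesis using hv(2)[OF l1] smooth_stepD(6)[OF h] by (simp add: eq)
  qed
qed

lemma cutoff_tendsto:
  assumes h: "smooth_step h" and ab: "a < b"
  shows "(\<lambda>n. cutoff h a b n t) \<longlonglongrightarrow> indicator {a<..<b} t"
proof (cases "a < t \<and> t < b")
  case True
  have "(\<lambda>n. 2 * ((b - a) / (real n + 4))) \<longlonglongrightarrow> 0" by real_asymp
  moreover have "0 < min (t - a) (b - t)" using True by simp
  ultimately have "\<forall>\<^sub>F n in sequentially. 2 * ((b - a) / (real n + 4)) < min (t - a) (b - t)"
    by (rule order_tendstoD)
  then have "\<forall>\<^sub>F n in sequentially. cutoff h a b n t = 1"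
    by eventually_elim (rule cutoff_eq_1[OF h ab], auto)
  then show ?thesis using True by (auto intro: tendsto_eventually)
next
  case False
  have "cutoff h a b n t = 0" for n
    using False cutoff_values(1)[OF h ab, of n] by (intro cutoff_eq_0[OF h ab]) auto
  then show ?thesis using False by simp
qed

section \<open>Tensor-product cut-offs approximating indicators of boxes\<close>

definition box_cutoff :: "(real \<Rightarrow> real) \<Rightarrow> 'a::euclidean_space \<Rightarrow> 'a \<Rightarrow> nat \<Rightarrow> 'a \<Rightarrow> real" where
  "box_cutoff h a b n x = (\<Prod>i\<in>Basis. cutoff h (a \<bullet> i) (b \<bullet> i) n (x \<bullet> i))"

lemma box_cutoff_bounds:
  assumes h: "smooth_step h" and ab: "\<And>i. i \<in> Basis \<Longrightarrow> a \<bullet> i < b \<bullet> i"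
  shows "0 \<le> box_cutoff h a b n x" "box_cutoff h a b n x \<le> 1"
  unfolding box_cutoff_def
  by (intro prod_nonneg ballI cutoff_nonneg[OF h ab], assumption)
     (intro prod_le_1 conjI cutoff_nonneg[OF h ab] cutoff_le_1[OF h ab]; assumption)

lemma box_cutoff_tendsto:
  assumes h: "smooth_step h" and ab: "\<And>i. i \<in> Basis \<Longrightarrow> a \<bullet> i < b \<bullet> i"
  shows "(\<lambda>n. box_cutoff h a b n x) \<longlonglongrightarrow> indicator (box a b) x"
proof -
  have "(\<lambda>n. box_cutoff h a b n x) \<longlonglongrightarrow> (\<Prod>i\<in>Basis. indicator {a \<bullet> i<..<b \<bullet> i} (x \<bullet> i))"
    unfolding box_cutoff_def by (intro tendsto_prod cutoff_tendsto[OF h ab])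
  also have "(\<Prod>i\<in>Basis. indicator {a \<bullet> i<..<b \<bullet> i} (x \<bullet> i)) = (indicator (box a b) x :: real)"
    by (auto simp: indicator_def mem_box)
  finally show ?thesis .
qed

lemma box_cutoff_support:
  assumes h: "smooth_step h" and ab: "\<And>i. i \<in> Basis \<Longrightarrow> a \<bullet> i < b \<bullet> i"
  obtains c d where "cbox c d \<subseteq> box a b" "\<And>x. x \<notin> cbox c d \<Longrightarrow> box_cutoff h a b n x = 0"
proof
  define e where "e i = (b \<bullet> i - a \<bullet> i) / (real n + 4)" for i
  define c d where "c = (\<Sum>i\<in>Basis. (a \<bullet> i + e i) *\<^sub>R i)" and "d = (\<Sum>i\<in>Basis. (b \<bullet> i - e i) *\<^sub>R i)"
  have e: "0 < e i" if "i \<in> Basis" for i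
    using cutoff_values(1)[OF h ab[OF that], of n] by (simp add: e_def)
  show "cbox c d \<subseteq> box a b"
    unfolding subset_iff mem_box using e by (force simp: c_def d_def)
  show "box_cutoff h a b n x = 0" if "x \<notin> cbox c d" for x
  proof -
    obtain i where i: "i \<in> Basis" "x \<bullet> i \<le> a \<bullet> i + e i \<or> b \<bullet> i - e i \<le> x \<bullet> i"
      using \<open>x \<notin> cbox c d\<close> by (force simp: c_def d_def mem_box)
    then have "cutoff h (a \<bullet> i) (b \<bullet> i) n (x \<bullet> i) = 0"
      by (intro cutoff_eq_0[OF h ab]) (auto simp: e_def)
    then show ?thesis using i(1) by (auto simp: box_cutoff_def intro!: prod_zero)
  qed
qed

lemma test_functionsI:
  assumes "smooth \<phi>" "\<And>x. x \<notin> K \<Longrightarrow> \<phi> x = 0" "compact K" "K \<subseteq> U"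
  shows "\<phi> \<in> test_functions U"
proof -
  have "closure {x. \<phi> x \<noteq> 0} \<subseteq> K"
    using assms by (intro closure_minimal compact_imp_closed) auto
  moreover then have "compact (closure {x. \<phi> x \<noteq> 0})"
    using compact_Int_closed[OF assms(3) closed_closure, of "{x. \<phi> x \<noteq> 0}"] by (simp add: Int_absorb1)
  ultimately show ?thesis using assms by (auto simp: test_functions_def)
qed

lemma box_cutoff_test_function:
  assumes h: "smooth_step h" and ab: "\<And>i. i \<in> Basis \<Longrightarrow> a \<bullet> i < b \<bullet> i" and U: "box a b \<subseteq> U"
  shows "box_cutoff h a b n \<in> test_functions U"
proof -
  obtain c d where cd: "cbox c d \<subseteq> box a b" "\<And>x. x \<notin> cbox c d \<Longrightarrow> box_cutoff h a b n x = 0"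
    using box_cutoff_support[OF h ab] by blast
  have "smooth (box_cutoff h a b n)"
    unfolding box_cutoff_def[abs_def] by (intro smooth_prod smooth_cutoff[OF h])
  then show ?thesis using cd U by (intro test_functionsI[of _ "cbox c d"]) auto
qed

text \<open>Dominated convergence of the box cut-offs gives zero integral over every open box in
  \<open>U\<close>. Inside one box, boxes generate the Borel sets, so the density vanishes there
  almost everywhere; countably many boxes cover \<open>U\<close>.\<close>

lemma fundamental_lemma:
  fixes G :: "'a::euclidean_space \<Rightarrow> real"
  assumes h: "smooth_step h" and U: "open U" and G: "integrable (lebesgue_on U) G"
    and test: "\<And>\<phi>. \<phi> \<in> test_functions U \<Longrightarrow> (\<integral>x. G x * \<phi> x \<partial>lebesgue_on U) = 0"
  shows "AE x in lebesgue_on U. G x = 0"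
proof -
  have Us: "U \<in> sets lebesgue" using U by auto
  have GU: "integrable lebesgue (\<lambda>x. indicator U x * G x)"
    using G Us by (simp add: integrable_restrict_space)
  \<comment> \<open>Lebesgue measure is the completion of \<open>lborel\<close>, so there is a Borel
    representative, and the argument below can stay with Borel sets.\<close>
  obtain g where g: "g \<in> borel_measurable lborel" "AE x in lborel. indicator U x * G x = g x"
    using completion_ex_borel_measurable_real[OF borel_measurable_integrable[OF GU]] by auto
  have gL: "AE x in lebesgue. indicator U x * G x = g x"
    using g(2) by (rule AE_completion)
  have gi: "integrable lborel g"
  proof -
    have "integrable lebesgue g"
      by (rule integrable_cong_AE_imp[OF GU]) (use g gL in \<open>auto intro: measurable_completion\<close>)
    then show ?thesis using g(1) by (simp add: integrable_completion)
  qed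
  have box0: "(\<integral>x. indicator (box a b) x * g x \<partial>lborel) = 0" if "box a b \<subseteq> U" for a b
  proof (cases "\<forall>i\<in>Basis. a \<bullet> i < b \<bullet> i")
    case False
    then have "box a b = {}" by (force simp: box_eq_empty)
    then show ?thesis by simp
  next
    case True
    then have ab: "\<And>i. i \<in> Basis \<Longrightarrow> a \<bullet> i < b \<bullet> i" by auto
    have bm: "box_cutoff h a b n \<in> borel_measurable borel" for n
      using box_cutoff_test_function[OF h ab that, of n] smooth_continuous[of _ UNIV]
      by (auto simp: test_functions_def intro: borel_measurable_continuous_onI)
    have "(\<integral>x. box_cutoff h a b n x * g x \<partial>lborel) = 0" for n
    proof -
      have "0 = (\<integral>x. G x * box_cutoff h a b n x \<partial>lebesgue_on U)"
        by (rule test[OF box_cutoff_test_function[OF h ab that], symmetric])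
      also have "\<dots> = (\<integral>x. indicator U x *\<^sub>R (G x * box_cutoff h a b n x) \<partial>lebesgue)"
        using Us by (intro integral_restrict_space) auto
      also have "\<dots> = (\<integral>x. box_cutoff h a b n x * g x \<partial>lebesgue)"
      proof (rule integral_cong_AE)
        have "(\<lambda>x. (indicator U x * G x) * box_cutoff h a b n x) \<in> borel_measurable lebesgue"
          by (rule borel_measurable_times[OF borel_measurable_integrable[OF GU]])
            (use bm in \<open>auto intro: measurable_completion\<close>)
        then show "(\<lambda>x. indicator U x *\<^sub>R (G x * box_cutoff h a b n x)) \<in> borel_measurable lebesgue"
          by (simp add: mult.assoc)
        show "(\<lambda>x. box_cutoff h a b n x * g x) \<in> borel_measurable lebesgue"
          using g(1) bm by (intro measurable_completion borel_measurable_times) auto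
        show "AE x in lebesgue. indicator U x *\<^sub>R (G x * box_cutoff h a b n x) = box_cutoff h a b n x * g x"
          using gL by eventually_elim (auto simp: ac_simps)
      qed
      also have "\<dots> = (\<integral>x. box_cutoff h a b n x * g x \<partial>lborel)"
        using g(1) bm by (intro integral_completion) auto
      finally show ?thesis by simp
    qed
    moreover have "(\<lambda>n. \<integral>x. box_cutoff h a b n x * g x \<partial>lborel) \<longlonglongrightarrow> (\<integral>x. indicator (box a b) x * g x \<partial>lborel)"
    proof (rule integral_dominated_convergence[where w="\<lambda>x. norm (g x)"])
      show "AE x in lborel. (\<lambda>n. box_cutoff h a b n x * g x) \<longlonglongrightarrow> indicator (box a b) x * g x"
        by (intro AE_I2 tendsto_intros box_cutoff_tendsto[OF h ab])
      show "AE x in lborel. norm (box_cutoff h a b n x * g x) \<le> norm (g x)" for n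
        using box_cutoff_bounds[OF h ab, of n] by (intro AE_I2) (simp add: abs_mult mult_left_le_one_le)
    qed (use g(1) bm gi in \<open>auto intro: borel_measurable_times\<close>)
    ultimately show ?thesis by (simp add: LIMSEQ_const_iff)
  qed
  have AEbox: "AE x in lborel. x \<in> box a b \<longrightarrow> g x = 0" if ab: "box a b \<subseteq> U" for a b
  proof -
    let ?f = "\<lambda>x. indicator (box a b) x * g x"
    have fi: "integrable lborel ?f"
      using integrable_mult_indicator[OF _ gi, of "box a b"] by auto
    have fA: "set_integrable lborel A ?f" if "A \<in> sets borel" for A
      unfolding set_integrable_def using that fi by (intro integrable_mult_indicator) auto
    have borel: "sigma_sets UNIV (range (\<lambda>(a, b). box a b :: 'a set)) = sets borel"
      by (subst borel_eq_box) simp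
    \<comment> \<open>Dynkin induction from the intersection-stable family of boxes. The fixed
      indicator in \<open>?f\<close> turns each generator into a box inside \<open>U\<close>, where
      \<open>box0\<close> applies; the complement case uses that the total integral of
      \<open>?f\<close> is zero.\<close>
    have z: "(\<integral>x\<in>A. ?f x \<partial>lborel) = 0" if "A \<in> sigma_sets UNIV (range (\<lambda>(a, b). box a b :: 'a set))" for A
    proof -
      have "Int_stable (range (\<lambda>(a, b). box a b :: 'a set))"
        unfolding Int_stable_def by (fastforce simp: Int_interval box_Int_box)
      moreover have "range (\<lambda>(a, b). box a b :: 'a set) \<subseteq> Pow UNIV" by simp
      ultimately show ?thesis using that
      proof (induction rule: sigma_sets_induct_disjoint)
        case (basic A)
        then obtain c d where A: "A = box c d" by auto
        obtain p q where pq: "box c d \<inter> box a b = box p q" by (rule that, rule box_Int_box)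
        have "(\<integral>x\<in>A. ?f x \<partial>lborel) = (\<integral>x. indicator (box p q) x * g x \<partial>lborel)"
          unfolding set_lebesgue_integral_def A pq[symmetric]
          by (intro Bochner_Integration.integral_cong) (auto simp: indicator_def)
        also have "\<dots> = 0" using pq ab by (intro box0) auto
        finally show ?case .
      next
        case (compl A)
        then have A: "A \<in> sets borel" by (simp add: borel)
        have "(\<integral>x\<in>A \<union> (UNIV - A). ?f x \<partial>lborel) = (\<integral>x\<in>A. ?f x \<partial>lborel) + (\<integral>x\<in>UNIV - A. ?f x \<partial>lborel)"
          using A by (intro set_integral_Un fA) auto
        moreover have "(\<integral>x\<in>A \<union> (UNIV - A). ?f x \<partial>lborel) = 0"
          using box0[OF ab] by (simp add: set_lebesgue_integral_def)
        ultimately show ?case using compl by simp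
      next
        case (union A)
        then have A: "\<And>i. A i \<in> sets borel" by (auto simp: borel)
        have "(\<integral>x\<in>(\<Union>i. A i). ?f x \<partial>lborel) = (\<Sum>i. (\<integral>x\<in>A i. ?f x \<partial>lborel))"
          using A union by (intro lebesgue_integral_countable_add fA) (auto simp: disjoint_family_on_def)
        then show ?case using union by simp
      qed (simp_all add: set_lebesgue_integral_def)
    qed
    have "AE x in lborel. ?f x = 0"
    proof (rule density_unique_real[OF fi])
      show "(\<integral>x\<in>A. ?f x \<partial>lborel) = (\<integral>x\<in>A. 0 \<partial>lborel)" if "A \<in> sets lborel" for A
        using z[of A] that borel by simp
    qed simp
    then show ?thesis by eventually_elim (auto simp: indicator_def)
  qed
  have "AE x in lborel. x \<in> U \<longrightarrow> g x = 0"
  proof -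
    obtain D where D: "countable D" "D \<subseteq> Pow U" "\<And>X. X \<in> D \<Longrightarrow> \<exists>a b. X = box a b" "\<Union>D = U"
      using open_countable_Union_open_box[OF U] by metis
    have "AE x in lborel. x \<in> X \<longrightarrow> g x = 0" if X: "X \<in> D" for X
    proof -
      obtain a b where "X = box a b" using D(3)[OF X] by auto
      then show ?thesis using AEbox[of a b] D(2) X by auto
    qed
    then have "AE x in lborel. \<forall>X\<in>D. x \<in> X \<longrightarrow> g x = 0"
      by (subst AE_ball_countable[OF D(1)]) blast
    then show ?thesis by eventually_elim (use D(4) in auto)
  qed
  then have "AE x in lebesgue. x \<in> U \<longrightarrow> g x = 0" by (rule AE_completion)
  with gL have "AE x in lebesgue. x \<in> U \<longrightarrow> G x = 0" by eventually_elim auto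
  then show ?thesis using Us by (simp add: AE_restrict_space_iff)
qed

section \<open>Integration by parts against test functions\<close>

lemma integral_lborel_translate:
  fixes F :: "'a::euclidean_space \<Rightarrow> real"
  assumes "F \<in> borel_measurable borel"
  shows "(\<integral>x. F (c + x) \<partial>lborel) = (\<integral>x. F x \<partial>lborel)"
proof -
  have "(\<integral>x. F x \<partial>distr lborel borel ((+) c)) = (\<integral>x. F (c + x) \<partial>lborel)"
    using assms by (intro integral_distr) auto
  then show ?thesis by (simp add: lborel_distr_plus)
qed

text \<open>By translation invariance all difference quotients of \<open>\<Phi>\<close> have integral zero.\<close>

lemma integral_directional_derivative_eq_0:
  fixes \<Phi> :: "'a::euclidean_space \<Rightarrow> real"
  assumes d: "\<And>x. (\<Phi> has_derivative \<Phi>' x) (at x)" and c: "continuous_on UNIV (\<lambda>x. \<Phi>' x b)"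
    and R: "\<And>x. R < norm x \<Longrightarrow> \<Phi> x = 0"
  shows "(\<integral>x. \<Phi>' x b \<partial>lborel) = 0"
proof -
  have z: "\<Phi>' x b = 0" if x: "R < norm x" for x
  proof -
    have "(\<Phi> has_derivative (\<lambda>_. 0)) (at x)"
    proof (rule has_derivative_transform_within_open[of "\<lambda>_. 0" "\<lambda>_. 0" x UNIV "{x. R < norm x}"])
      show "open {x::'a. R < norm x}" by (intro open_Collect_less continuous_intros)
      show "0 = \<Phi> y" if "y \<in> {x. R < norm x}" for y using that R[of y] by simp
    qed (use x in simp_all)
    then have "\<Phi>' x = (\<lambda>_. 0)" by (rule has_derivative_unique[OF d])
    then show ?thesis by simp
  qed
  have "bounded ((\<lambda>x. \<Phi>' x b) ` cball 0 R)"
    by (intro compact_imp_bounded compact_continuous_image continuous_on_subset[OF c]) auto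
  then obtain K0 where K0: "\<forall>y\<in>(\<lambda>x. \<Phi>' x b) ` cball 0 R. norm y \<le> K0"
    unfolding bounded_iff by (rule exE)
  define K where "K = max 0 K0"
  have K: "\<bar>\<Phi>' x b\<bar> \<le> K" for x
  proof (cases "R < norm x")
    case False
    then have "norm (\<Phi>' x b) \<le> K0" by (intro bspec[OF K0] imageI) simp
    then show ?thesis by (simp add: K_def)
  qed (simp add: z K_def)
  have line: "((\<lambda>t. \<Phi> (x + t *\<^sub>R b)) has_real_derivative \<Phi>' (x + t *\<^sub>R b) b) (at t)" for x t
  proof -
    have "((\<lambda>t. x + t *\<^sub>R b) has_derivative (\<lambda>h. h *\<^sub>R b)) (at t)"
      by (auto intro!: derivative_eq_intros)
    from diff_chain_at[OF this d] have "((\<lambda>t. \<Phi> (x + t *\<^sub>R b)) has_derivative (\<lambda>h. \<Phi>' (x + t *\<^sub>R b) (h *\<^sub>R b))) (at t)"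
      by (simp add: o_def)
    moreover have "\<Phi>' (x + t *\<^sub>R b) (h *\<^sub>R b) = \<Phi>' (x + t *\<^sub>R b) b * h" for h
      using linear_scale[OF has_derivative_linear[OF d], of "x + t *\<^sub>R b" h b] by simp
    ultimately show ?thesis by (simp add: has_field_derivative_def)
  qed
  define q where "q n x = (\<Phi> (inverse (real (Suc n)) *\<^sub>R b + x) - \<Phi> x) / inverse (real (Suc n))" for n x
  have cont: "continuous_on UNIV \<Phi>"
    using d by (meson has_derivative_continuous_on)
  have \<Phi>b: "\<Phi> \<in> borel_measurable borel" using cont by (rule borel_measurable_continuous_onI)
  have \<Phi>i: "integrable lborel \<Phi>"
  proof -
    have "integrable lborel (\<lambda>x. indicator (cball 0 R) x *\<^sub>R \<Phi> x)"
      by (intro borel_integrable_compact continuous_on_subset[OF cont]) auto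
    moreover have "(\<lambda>x. indicator (cball 0 R) x *\<^sub>R \<Phi> x) = \<Phi>"
      using R by (auto simp: indicator_def fun_eq_iff not_le)
    ultimately show ?thesis by simp
  qed
  have \<Phi>ti: "integrable lborel (\<lambda>x. \<Phi> (v + x))" for v
  proof -
    have "integrable (distr lborel borel ((+) v)) \<Phi>" using \<Phi>i by (simp add: lborel_distr_plus)
    then show ?thesis by (subst (asm) integrable_distr_eq) (use \<Phi>b in auto)
  qed
  have q0: "(\<integral>x. q n x \<partial>lborel) = 0" for n
    unfolding q_def using \<Phi>i \<Phi>ti integral_lborel_translate[OF \<Phi>b] by simp
  \<comment> \<open>Domination: by the mean value theorem \<open>q n x\<close> is a value of the
    directional derivative, hence at most \<open>K\<close>. The increments have length at most
    \<open>norm b\<close>, so \<open>q n\<close> vanishes beyond radius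
    \<open>R + norm b\<close>.\<close>
  have "(\<lambda>n. \<integral>x. q n x \<partial>lborel) \<longlonglongrightarrow> (\<integral>x. \<Phi>' x b \<partial>lborel)"
  proof (rule integral_dominated_convergence[where w="\<lambda>x. K * indicator (cball (0::'a) (R + norm b)) x"])
    show "(\<lambda>x. \<Phi>' x b) \<in> borel_measurable lborel"
      using borel_measurable_continuous_onI[OF c] by simp
    show "q n \<in> borel_measurable lborel" for n
      unfolding q_def using \<Phi>b \<Phi>i \<Phi>ti by (intro borel_measurable_divide borel_measurable_diff borel_measurable_integrable) auto
    show "integrable lborel (\<lambda>x. K * indicator (cball (0::'a) (R + norm b)) x)"
    proof (intro integrable_mult_right integrable_real_indicator)
      show "emeasure lborel (cball (0::'a) (R + norm b)) < \<infinity>" by (rule emeasure_bounded_finite) simp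
    qed simp
    show "AE x in lborel. (\<lambda>n. q n x) \<longlonglongrightarrow> \<Phi>' x b"
    proof (rule AE_I2)
      fix x
      have "((\<lambda>h. (\<Phi> (x + (0 + h) *\<^sub>R b) - \<Phi> (x + 0 *\<^sub>R b)) / h) \<longlongrightarrow> \<Phi>' (x + 0 *\<^sub>R b) b) (at 0)"
        by (rule DERIV_D[OF line])
      moreover have "filterlim (\<lambda>n. inverse (real (Suc n))) (at 0) sequentially"
        by (rule filterlim_atI[OF LIMSEQ_inverse_real_of_nat]) auto
      ultimately have "(\<lambda>n. (\<Phi> (x + (0 + inverse (real (Suc n))) *\<^sub>R b) - \<Phi> (x + 0 *\<^sub>R b)) / inverse (real (Suc n))) \<longlonglongrightarrow> \<Phi>' (x + 0 *\<^sub>R b) b"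
        by (rule filterlim_compose)
      then show "(\<lambda>n. q n x) \<longlonglongrightarrow> \<Phi>' x b" by (simp add: q_def add.commute)
    qed
    show "AE x in lborel. norm (q n x) \<le> K * indicator (cball (0::'a) (R + norm b)) x" for n
    proof (rule AE_I2)
      fix x
      define s where "s = inverse (real (Suc n))"
      have s: "0 < s" "s \<le> 1" by (auto simp: s_def inverse_le_1_iff)
      show "norm (q n x) \<le> K * indicator (cball (0::'a) (R + norm b)) x"
      proof (cases "norm x \<le> R + norm b")
        case True
        have "\<exists>\<xi>. 0 < \<xi> \<and> \<xi> < s \<and> \<Phi> (x + s *\<^sub>R b) - \<Phi> (x + 0 *\<^sub>R b) = (s - 0) * \<Phi>' (x + \<xi> *\<^sub>R b) b"
          by (rule MVT2[OF s(1)]) (rule line)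
        then obtain \<xi> where "\<Phi> (x + s *\<^sub>R b) - \<Phi> (x + 0 *\<^sub>R b) = (s - 0) * \<Phi>' (x + \<xi> *\<^sub>R b) b"
          by (elim exE conjE)
        moreover have "q n x = (\<Phi> (x + s *\<^sub>R b) - \<Phi> x) / s" by (simp only: q_def s_def add.commute[of _ x])
        ultimately have "q n x = \<Phi>' (x + \<xi> *\<^sub>R b) b" using s(1) by simp
        then show ?thesis using K True by (simp add: indicator_def)
      next
        case False
        have "norm (s *\<^sub>R b) \<le> norm b" using s by (simp add: mult_left_le_one_le)
        moreover have "norm x \<le> norm (s *\<^sub>R b + x) + norm (s *\<^sub>R b)"
          using norm_triangle_ineq4[of "s *\<^sub>R b + x" "s *\<^sub>R b"] by simp
        ultimately have "R < norm (s *\<^sub>R b + x)" "R < norm x" using False norm_ge_zero[of b] by linarith+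
        then have "q n x = 0" unfolding q_def s_def[symmetric] using R by simp
        then show ?thesis using False by (simp add: indicator_def)
      qed
    qed
  qed
  then show ?thesis using q0 by (simp add: LIMSEQ_const_iff)
qed

lemma test_functionsD:
  assumes "\<phi> \<in> test_functions U"
  shows test_function_smooth: "smooth \<phi>"
    and test_function_eq_0: "x \<notin> U \<Longrightarrow> \<phi> x = 0"
    and test_function_partial_eq_0: "x \<notin> U \<Longrightarrow> frechet_derivative \<phi> (at x) b = 0"
    and test_function_bounded_support: "\<exists>R. \<forall>x. R < norm x \<longrightarrow> \<phi> x = 0"
proof -
  let ?K = "closure {x. \<phi> x \<noteq> 0}"
  have K: "compact ?K" "?K \<subseteq> U" and s: "smooth \<phi>" using assms by (auto simp: test_functions_def)
  show "smooth \<phi>" by (rule s)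
  have z: "\<phi> x = 0" if "x \<notin> ?K" for x using that closure_subset[of "{x. \<phi> x \<noteq> 0}"] by auto
  show "x \<notin> U \<Longrightarrow> \<phi> x = 0" for x using K z by blast
  show "frechet_derivative \<phi> (at x) b = 0" if "x \<notin> U" for x
  proof -
    have x: "x \<in> - ?K" using that K(2) by auto
    have "(\<phi> has_derivative (\<lambda>_. 0)) (at x)"
    proof (rule has_derivative_transform_within_open[of "\<lambda>_. 0" _ _ UNIV])
      show "open (- ?K)" by (intro open_Compl closed_closure)
      show "0 = \<phi> y" if "y \<in> - ?K" for y using that z[of y] by simp
    qed (use x in simp_all)
    then show ?thesis by (subst frechet_derivative_at[symmetric]) auto
  qed
  obtain R where "\<forall>x\<in>?K. norm x \<le> R"
    using compact_imp_bounded[OF K(1)] unfolding bounded_iff by auto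
  then have "\<phi> x = 0" if "R < norm x" for x using z[of x] that by force
  then show "\<exists>R. \<forall>x. R < norm x \<longrightarrow> \<phi> x = 0" by blast
qed

lemma integral_lebesgue_on_eq_lborel:
  fixes F :: "'a::euclidean_space \<Rightarrow> real"
  assumes "F \<in> borel_measurable borel" "U \<in> sets lebesgue" "\<And>x. x \<notin> U \<Longrightarrow> F x = 0"
  shows "(\<integral>x. F x \<partial>lebesgue_on U) = (\<integral>x. F x \<partial>lborel)"
proof -
  have "(\<integral>x. F x \<partial>lebesgue_on U) = (\<integral>x. indicator U x *\<^sub>R F x \<partial>lebesgue)"
    using assms by (intro integral_restrict_space) auto
  also have "(\<lambda>x. indicator U x *\<^sub>R F x) = F" using assms(3) by (fastforce simp: indicator_def)
  also have "(\<integral>x. F x \<partial>lebesgue) = (\<integral>x. F x \<partial>lborel)"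
    using assms(1) by (intro integral_completion) simp
  finally show ?thesis .
qed

text \<open>The product of the affine function with \<open>\<phi>\<close> has bounded support, so
  its directional derivative integrates to zero over the whole space. The boundary of
  \<open>U\<close> never enters, because \<open>\<phi>\<close> and its derivatives vanish outside
  \<open>U\<close>.\<close>

lemma integral_affine_by_parts:
  fixes L :: "'a::euclidean_space \<Rightarrow> real"
  assumes \<phi>: "\<phi> \<in> test_functions U" and U: "U \<in> sets lebesgue" and L: "linear L" and b: "b \<in> Basis"
  shows "(\<integral>x. (L x + c) * frechet_derivative \<phi> (at x) b \<partial>lebesgue_on U) = - (\<integral>x. L b * \<phi> x \<partial>lebesgue_on U)"
proof -
  note s = test_function_smooth[OF \<phi>]
  define D where "D x = frechet_derivative \<phi> (at x) b" for x
  have Dc: "continuous_on UNIV D" unfolding D_def by (rule smooth_continuous[OF smooth_partial[OF s b]])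
  have \<phi>c: "continuous_on UNIV \<phi>" by (rule smooth_continuous[OF s])
  have bl: "bounded_linear L" using L by (simp add: linear_conv_bounded_linear)
  have Lc: "continuous_on UNIV L" by (rule linear_continuous_on[OF bl])
  obtain R where R: "\<And>x. R < norm x \<Longrightarrow> \<phi> x = 0" using test_function_bounded_support[OF \<phi>] by auto
  have D0: "D x = 0" if "x \<notin> U" for x using test_function_partial_eq_0[OF \<phi> that] by (simp add: D_def)
  have z: "D x = 0" if x: "R < norm x" for x
  proof -
    have "(\<phi> has_derivative (\<lambda>_. 0)) (at x)"
    proof (rule has_derivative_transform_within_open[of "\<lambda>_. 0" "\<lambda>_. 0" x UNIV "{x. R < norm x}"])
      show "open {x::'a. R < norm x}" by (intro open_Collect_less continuous_intros)
      show "0 = \<phi> y" if "y \<in> {x. R < norm x}" for y using that R[of y] by simp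
    qed (use x in simp_all)
    then show ?thesis unfolding D_def by (subst frechet_derivative_at[symmetric]) auto
  qed
  define \<Phi> where "\<Phi> x = (L x + c) * \<phi> x" for x
  define \<Phi>' where "\<Phi>' x h = (L x + c) * frechet_derivative \<phi> (at x) h + L h * \<phi> x" for x h
  have "(\<integral>x. \<Phi>' x b \<partial>lborel) = 0"
  proof (rule integral_directional_derivative_eq_0)
    show "(\<Phi> has_derivative \<Phi>' x) (at x)" for x
    proof -
      have "(\<phi> has_derivative frechet_derivative \<phi> (at x)) (at x)"
        using smooth_differentiable[OF s] by (rule frechet_derivative_works[THEN iffD1])
      moreover have "((\<lambda>x. L x + c) has_derivative L) (at x)"
        using bounded_linear_imp_has_derivative[OF bl] by (auto intro!: derivative_eq_intros)
      ultimately show ?thesis unfolding \<Phi>_def[abs_def] \<Phi>'_def[abs_def] by (intro has_derivative_mult)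
    qed
    show "continuous_on UNIV (\<lambda>x. \<Phi>' x b)"
      unfolding \<Phi>'_def D_def[symmetric] by (intro continuous_intros Dc \<phi>c Lc)
    show "\<Phi> x = 0" if "R < norm x" for x using R[OF that] by (simp add: \<Phi>_def)
  qed
  moreover have int: "integrable lborel F" if "continuous_on UNIV F" "\<And>x. R < norm x \<Longrightarrow> F x = 0" for F :: "'a \<Rightarrow> real"
  proof -
    have "integrable lborel (\<lambda>x. indicator (cball 0 R) x *\<^sub>R F x)"
      by (intro borel_integrable_compact continuous_on_subset[OF that(1)]) auto
    moreover have "(\<lambda>x. indicator (cball 0 R) x *\<^sub>R F x) = F"
      using that(2) by (auto simp: indicator_def fun_eq_iff not_le)
    ultimately show ?thesis by simp
  qed
  have "integrable lborel (\<lambda>x. (L x + c) * D x)" "integrable lborel (\<lambda>x. L b * \<phi> x)"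
    using z R by (intro int continuous_intros Dc \<phi>c Lc; simp)+
  then have "(\<integral>x. \<Phi>' x b \<partial>lborel) = (\<integral>x. (L x + c) * D x \<partial>lborel) + (\<integral>x. L b * \<phi> x \<partial>lborel)"
    unfolding \<Phi>'_def D_def[symmetric] by (rule Bochner_Integration.integral_add)
  moreover have "(\<integral>x. (L x + c) * D x \<partial>lebesgue_on U) = (\<integral>x. (L x + c) * D x \<partial>lborel)"
    using D0 by (intro integral_lebesgue_on_eq_lborel[OF _ U] borel_measurable_continuous_onI continuous_intros Dc Lc) auto
  moreover have "(\<integral>x. L b * \<phi> x \<partial>lebesgue_on U) = (\<integral>x. L b * \<phi> x \<partial>lborel)"
    using test_function_eq_0[OF \<phi>]
    by (intro integral_lebesgue_on_eq_lborel[OF _ U] borel_measurable_continuous_onI continuous_intros \<phi>c) auto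
  ultimately have "(\<integral>x. (L x + c) * D x \<partial>lebesgue_on U) + (\<integral>x. L b * \<phi> x \<partial>lebesgue_on U) = 0"
    by linarith
  then show ?thesis by (simp add: D_def[symmetric])
qed

section \<open>Square integrable functions\<close>

lemma L2_space_measurable: "v \<in> L2_space M \<Longrightarrow> v \<in> borel_measurable M"
  and L2_space_integrable_square: "v \<in> L2_space M \<Longrightarrow> integrable M (\<lambda>x. (norm (v x))\<^sup>2)"
  by (auto simp: L2_space_def)

lemma norm_add_square_le:
  fixes a b :: "'a::real_normed_vector"
  shows "(norm (a + b))\<^sup>2 \<le> 2 * (norm a)\<^sup>2 + 2 * (norm b)\<^sup>2"
proof -
  have "(norm (a + b))\<^sup>2 \<le> (norm a + norm b)\<^sup>2" by (intro power_mono norm_triangle_ineq) simp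
  also have "\<dots> \<le> 2 * (norm a)\<^sup>2 + 2 * (norm b)\<^sup>2"
    using sum_squares_ge_zero[of "norm a - norm b" 0] by (simp add: power2_eq_square algebra_simps)
  finally show ?thesis .
qed

lemma L2_space_add:
  assumes "v \<in> L2_space M" "w \<in> L2_space M"
  shows "(\<lambda>x. v x + w x) \<in> L2_space M"
proof -
  have m: "v \<in> borel_measurable M" "w \<in> borel_measurable M" using assms by (auto simp: L2_space_def)
  have "integrable M (\<lambda>x. (norm (v x + w x))\<^sup>2)"
  proof (rule Bochner_Integration.integrable_bound)
    show "integrable M (\<lambda>x. 2 * (norm (v x))\<^sup>2 + 2 * (norm (w x))\<^sup>2)"
      using assms by (auto simp: L2_space_def)
    show "(\<lambda>x. (norm (v x + w x))\<^sup>2) \<in> borel_measurable M" using m by measurable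
    show "AE x in M. norm ((norm (v x + w x))\<^sup>2) \<le> norm (2 * (norm (v x))\<^sup>2 + 2 * (norm (w x))\<^sup>2)"
      using norm_add_square_le by (intro AE_I2) (simp add: abs_of_nonneg)
  qed
  then show ?thesis using m by (auto simp: L2_space_def)
qed

lemma L2_space_scale:
  assumes "v \<in> L2_space M"
  shows "(\<lambda>x. c *\<^sub>R v x) \<in> L2_space M"
  using assms by (auto simp: L2_space_def power_mult_distrib)

lemma L2_space_diff:
  assumes "v \<in> L2_space M" "w \<in> L2_space M"
  shows "(\<lambda>x. v x - w x) \<in> L2_space M"
  using L2_space_add[OF assms(1) L2_space_scale[OF assms(2), of "-1"]] by simp

lemma L2_space_integrable_inner:
  fixes v w :: "'a \<Rightarrow> 'b::euclidean_space"
  assumes "v \<in> L2_space M" "w \<in> L2_space M" "c \<in> borel_measurable M" "AE x in M. \<bar>c x\<bar> \<le> C"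
  shows "integrable M (\<lambda>x. c x * (v x \<bullet> w x))"
proof (rule Bochner_Integration.integrable_bound)
  have m: "v \<in> borel_measurable M" "w \<in> borel_measurable M" using assms by (auto simp: L2_space_def)
  show "integrable M (\<lambda>x. C * ((norm (v x))\<^sup>2 + (norm (w x))\<^sup>2))"
    using assms by (auto simp: L2_space_def)
  show "(\<lambda>x. c x * (v x \<bullet> w x)) \<in> borel_measurable M" using m assms(3) by measurable
  show "AE x in M. norm (c x * (v x \<bullet> w x)) \<le> norm (C * ((norm (v x))\<^sup>2 + (norm (w x))\<^sup>2))"
    using assms(4)
  proof eventually_elim
    case (elim x)
    have "\<bar>v x \<bullet> w x\<bar> \<le> norm (v x) * norm (w x)" by (rule Cauchy_Schwarz_ineq2)
    also have "\<dots> \<le> (norm (v x))\<^sup>2 + (norm (w x))\<^sup>2"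
      using sum_squares_bound[of "norm (v x)" "norm (w x)"]
        mult_nonneg_nonneg[OF norm_ge_zero[of "v x"] norm_ge_zero[of "w x"]] by linarith
    finally have "\<bar>c x\<bar> * \<bar>v x \<bullet> w x\<bar> \<le> C * ((norm (v x))\<^sup>2 + (norm (w x))\<^sup>2)"
      using elim by (intro mult_mono) auto
    also have "\<dots> \<le> \<bar>C * ((norm (v x))\<^sup>2 + (norm (w x))\<^sup>2)\<bar>" by (rule abs_ge_self)
    finally show ?case by (simp only: real_norm_def abs_mult)
  qed
qed

text \<open>On a finite measure space \<open>norm (v x)\<close> is dominated by the integrable
  function \<open>1 + (norm (v x))\<^sup>2\<close>.\<close>

lemma L2_space_integrable:
  assumes "v \<in> L2_space M" "finite_measure M"
  shows "integrable M v"
proof (rule Bochner_Integration.integrable_bound)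
  show "integrable M (\<lambda>x. 1 + (norm (v x))\<^sup>2)"
    using assms by (auto simp: L2_space_def finite_measure.integrable_const)
  show "v \<in> borel_measurable M" using assms by (simp add: L2_space_def)
  show "AE x in M. norm (v x) \<le> norm (1 + (norm (v x))\<^sup>2)"
  proof (rule AE_I2)
    fix x
    have "0 \<le> (norm (v x) - 1)\<^sup>2" by simp
    then have "2 * norm (v x) \<le> 1 + (norm (v x))\<^sup>2" by (simp add: power2_eq_square algebra_simps)
    then have "norm (v x) \<le> 1 + (norm (v x))\<^sup>2" using norm_ge_zero[of "v x"] by linarith
    then show "norm (v x) \<le> norm (1 + (norm (v x))\<^sup>2)" by simp
  qed
qed

lemma L2_space_bounded:
  assumes "finite_measure M" "v \<in> borel_measurable M" "\<And>x. x \<in> space M \<Longrightarrow> norm (v x) \<le> C"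
  shows "v \<in> L2_space M"
proof -
  interpret finite_measure M by fact
  have "integrable M (\<lambda>x. (norm (v x))\<^sup>2)"
  proof (rule integrable_const_bound[where B="C\<^sup>2"])
    show "AE x in M. norm ((norm (v x))\<^sup>2) \<le> C\<^sup>2"
      using assms(3) by (intro AE_I2) (auto intro: power_mono)
    show "(\<lambda>x. (norm (v x))\<^sup>2) \<in> borel_measurable M" using assms(2) by measurable
  qed
  with assms(2) show ?thesis by (simp add: L2_space_def)
qed

lemma integrable_bounded_mult:
  fixes f c :: "'a \<Rightarrow> real"
  assumes "integrable M f" "c \<in> borel_measurable M" "\<And>x. \<bar>c x\<bar> \<le> C"
  shows "integrable M (\<lambda>x. f x * c x)"
proof (rule Bochner_Integration.integrable_bound[of _ "\<lambda>x. C * f x"])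
  show "integrable M (\<lambda>x. C * f x)" using assms(1) by simp
  show "(\<lambda>x. f x * c x) \<in> borel_measurable M" using assms(1,2) by measurable
  have "0 \<le> C" using assms(3) abs_ge_zero order_trans by blast
  then show "AE x in M. norm (f x * c x) \<le> norm (C * f x)"
    using assms(3) by (intro AE_I2) (auto simp: abs_mult mult.commute[of "\<bar>f _\<bar>"] intro: mult_right_mono)
qed

section \<open>Weak gradients\<close>

lemma finite_measure_lebesgue_on_open_bounded:
  fixes \<Omega> :: "'a::euclidean_space set"
  assumes "open \<Omega>" "bounded \<Omega>"
  shows "\<Omega> \<in> sets lebesgue" "\<Omega> \<in> lmeasurable" "finite_measure (lebesgue_on \<Omega>)"
  using assms by (auto intro!: finite_measure_lebesgue_on simp: lmeasurable_open bounded_set_imp_lmeasurable)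

lemma test_function_bounded_measurable:
  fixes \<phi> :: "'a::euclidean_space \<Rightarrow> real"
  assumes \<phi>: "\<phi> \<in> test_functions U"
  shows "\<phi> \<in> borel_measurable borel" "\<exists>C. \<forall>x. \<bar>\<phi> x\<bar> \<le> C"
    "b \<in> Basis \<Longrightarrow> (\<lambda>x. frechet_derivative \<phi> (at x) b) \<in> borel_measurable borel"
    "b \<in> Basis \<Longrightarrow> \<exists>C. \<forall>x. \<bar>frechet_derivative \<phi> (at x) b\<bar> \<le> C"
proof -
  let ?K = "closure {x. \<phi> x \<noteq> 0}"
  \<comment> \<open>A test function of \<open>U\<close> is also one of its own closed support; this
    puts the partial derivatives to zero off a compact set and hence bounds them.\<close>
  have K: "compact ?K" and \<phi>K: "\<phi> \<in> test_functions ?K" using \<phi> by (auto simp: test_functions_def)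
  note s = test_function_smooth[OF \<phi>]
  have bd: "\<exists>C. \<forall>x. \<bar>F x\<bar> \<le> C" if F: "continuous_on UNIV F" and z: "\<And>x. x \<notin> ?K \<Longrightarrow> F x = 0" for F :: "'a \<Rightarrow> real"
  proof -
    have "bounded (F ` ?K)"
      by (intro compact_imp_bounded compact_continuous_image K continuous_on_subset[OF F]) auto
    then obtain C where C: "\<forall>y\<in>F ` ?K. norm y \<le> C" unfolding bounded_iff by (rule exE)
    have "\<bar>F x\<bar> \<le> max 0 C" for x
    proof (cases "x \<in> ?K")
      case True
      then have "norm (F x) \<le> C" by (intro bspec[OF C] imageI)
      then show ?thesis by simp
    qed (simp add: z)
    then show ?thesis by blast
  qed
  show "\<phi> \<in> borel_measurable borel" by (intro borel_measurable_continuous_onI smooth_continuous[OF s])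
  show "\<exists>C. \<forall>x. \<bar>\<phi> x\<bar> \<le> C"
    by (rule bd[OF smooth_continuous[OF s]]) (rule test_function_eq_0[OF \<phi>K])
  assume b: "b \<in> Basis"
  show "(\<lambda>x. frechet_derivative \<phi> (at x) b) \<in> borel_measurable borel"
    by (intro borel_measurable_continuous_onI smooth_continuous[OF smooth_partial[OF s b]])
  show "\<exists>C. \<forall>x. \<bar>frechet_derivative \<phi> (at x) b\<bar> \<le> C"
    by (rule bd[OF smooth_continuous[OF smooth_partial[OF s b]]]) (rule test_function_partial_eq_0[OF \<phi>K])
qed

lemma borel_measurable_lebesgue_onI:
  "f \<in> borel_measurable borel \<Longrightarrow> f \<in> borel_measurable (lebesgue_on S)"
  by (intro measurable_restrict_space1 measurable_completion) simp

lemma integrable_mult_test_function: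
  assumes "\<phi> \<in> test_functions U" "integrable (lebesgue_on S) f"
  shows "integrable (lebesgue_on S) (\<lambda>x. f x * \<phi> x)"
    "b \<in> Basis \<Longrightarrow> integrable (lebesgue_on S) (\<lambda>x. f x * frechet_derivative \<phi> (at x) b)"
proof -
  note t = test_function_bounded_measurable[OF assms(1)]
  obtain C where "\<forall>x. \<bar>\<phi> x\<bar> \<le> C" using t(2) by (rule exE)
  then show "integrable (lebesgue_on S) (\<lambda>x. f x * \<phi> x)"
    by (intro integrable_bounded_mult[OF assms(2) borel_measurable_lebesgue_onI[OF t(1)], of C]) simp
  assume b: "b \<in> Basis"
  obtain C where "\<forall>x. \<bar>frechet_derivative \<phi> (at x) b\<bar> \<le> C" using t(4)[OF b] by (rule exE)
  then show "integrable (lebesgue_on S) (\<lambda>x. f x * frechet_derivative \<phi> (at x) b)"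
    by (intro integrable_bounded_mult[OF assms(2) borel_measurable_lebesgue_onI[OF t(3)[OF b]], of C]) simp
qed

lemma weak_grad_H1:
  assumes "v \<in> H1_space \<Omega>"
  shows "weak_grad \<Omega> v \<in> L2_space (lebesgue_on \<Omega>)" "is_weak_gradient \<Omega> v (weak_grad \<Omega> v)"
proof -
  have "\<exists>G. G \<in> L2_space (lebesgue_on \<Omega>) \<and> is_weak_gradient \<Omega> v G"
    using assms by (auto simp: H1_space_def)
  from someI_ex[OF this] show "weak_grad \<Omega> v \<in> L2_space (lebesgue_on \<Omega>)" "is_weak_gradient \<Omega> v (weak_grad \<Omega> v)"
    unfolding weak_grad_def by blast+
qed

lemma integrable_component:
  fixes v :: "'a \<Rightarrow> real^'n"
  assumes "integrable M v" shows "integrable M (\<lambda>x. v x $ i)"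
  using integrable_inner_left[of "axis i 1" M v] assms by (simp add: inner_axis)

lemma integrable_component2:
  fixes v :: "'a \<Rightarrow> real^'n^'m"
  assumes "integrable M v" shows "integrable M (\<lambda>x. v x $ i $ j)"
proof -
  have "integrable M (\<lambda>x. v x \<bullet> axis i (axis j 1))" using assms by (intro integrable_inner_left) auto
  then show ?thesis by (simp add: inner_axis)
qed

text \<open>The entries of \<open>G - H\<close> integrate to zero against every test function. The
  choice of representative inside \<open>weak_grad\<close> is therefore immaterial up to null
  sets.\<close>

lemma weak_gradient_unique:
  assumes h: "smooth_step h" and \<Omega>: "open \<Omega>" "bounded \<Omega>"
    and G: "G \<in> L2_space (lebesgue_on \<Omega>)" "is_weak_gradient \<Omega> v G"
    and H: "H \<in> L2_space (lebesgue_on \<Omega>)" "is_weak_gradient \<Omega> v H"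
  shows "AE x in lebesgue_on \<Omega>. G x = H x"
proof -
  note M = finite_measure_lebesgue_on_open_bounded[OF \<Omega>]
  have Gi: "integrable (lebesgue_on \<Omega>) (\<lambda>x. G x $ i $ j)" and Hi: "integrable (lebesgue_on \<Omega>) (\<lambda>x. H x $ i $ j)" for i j
    using L2_space_integrable[OF G(1) M(3)] L2_space_integrable[OF H(1) M(3)] by (auto intro: integrable_component2)
  have "AE x in lebesgue_on \<Omega>. G x $ i $ j - H x $ i $ j = 0" for i j
  proof (rule fundamental_lemma[OF h \<Omega>(1)])
    show "integrable (lebesgue_on \<Omega>) (\<lambda>x. G x $ i $ j - H x $ i $ j)" using Gi Hi by simp
    fix \<phi> assume \<phi>: "\<phi> \<in> test_functions \<Omega>"
    have "(\<integral>x. (G x $ i $ j - H x $ i $ j) * \<phi> x \<partial>lebesgue_on \<Omega>)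
      = (\<integral>x. G x $ i $ j * \<phi> x \<partial>lebesgue_on \<Omega>) - (\<integral>x. H x $ i $ j * \<phi> x \<partial>lebesgue_on \<Omega>)"
      unfolding left_diff_distrib
      by (intro Bochner_Integration.integral_diff integrable_mult_test_function[OF \<phi>] Gi Hi)
    also have "\<dots> = 0" using G(2) H(2) \<phi> unfolding is_weak_gradient_def by fastforce
    finally show "(\<integral>x. (G x $ i $ j - H x $ i $ j) * \<phi> x \<partial>lebesgue_on \<Omega>) = 0" .
  qed
  then have "AE x in lebesgue_on \<Omega>. \<forall>i\<in>UNIV. \<forall>j\<in>UNIV. G x $ i $ j - H x $ i $ j = 0"
    by (intro AE_finite_allI) auto
  then show ?thesis by eventually_elim (simp add: vec_eq_iff)
qed

lemma is_weak_gradient_linear: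
  assumes \<Omega>: "open \<Omega>" "bounded \<Omega>"
    and v: "v \<in> L2_space (lebesgue_on \<Omega>)" "G \<in> L2_space (lebesgue_on \<Omega>)" "is_weak_gradient \<Omega> v G"
    and w: "w \<in> L2_space (lebesgue_on \<Omega>)" "H \<in> L2_space (lebesgue_on \<Omega>)" "is_weak_gradient \<Omega> w H"
  shows "is_weak_gradient \<Omega> (\<lambda>x. a *\<^sub>R v x + b *\<^sub>R w x) (\<lambda>x. a *\<^sub>R G x + b *\<^sub>R H x)"
  unfolding is_weak_gradient_def
proof (intro ballI allI)
  fix \<phi> and i j :: 2 assume \<phi>: "\<phi> \<in> test_functions \<Omega>"
  note M = finite_measure_lebesgue_on_open_bounded[OF \<Omega>]
  let ?D = "\<lambda>x. frechet_derivative \<phi> (at x) (axis j 1)"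
  have jB: "axis j (1::real) \<in> Basis" by (simp add: axis_in_Basis_iff)
  have i1: "integrable (lebesgue_on \<Omega>) (\<lambda>x. v x $ i * ?D x)" "integrable (lebesgue_on \<Omega>) (\<lambda>x. w x $ i * ?D x)"
    using L2_space_integrable[OF v(1) M(3)] L2_space_integrable[OF w(1) M(3)]
    by (auto intro!: integrable_mult_test_function(2)[OF \<phi> _ jB] integrable_component)
  have i2: "integrable (lebesgue_on \<Omega>) (\<lambda>x. G x $ i $ j * \<phi> x)" "integrable (lebesgue_on \<Omega>) (\<lambda>x. H x $ i $ j * \<phi> x)"
    using L2_space_integrable[OF v(2) M(3)] L2_space_integrable[OF w(2) M(3)]
    by (auto intro!: integrable_mult_test_function(1)[OF \<phi>] integrable_component2)
  have "(\<integral>x. (a *\<^sub>R v x + b *\<^sub>R w x) $ i * ?D x \<partial>lebesgue_on \<Omega>)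
     = (\<integral>x. a * (v x $ i * ?D x) + b * (w x $ i * ?D x) \<partial>lebesgue_on \<Omega>)"
    by (intro Bochner_Integration.integral_cong) (auto simp: algebra_simps)
  also have "\<dots> = a * (\<integral>x. v x $ i * ?D x \<partial>lebesgue_on \<Omega>) + b * (\<integral>x. w x $ i * ?D x \<partial>lebesgue_on \<Omega>)"
    using i1 by simp
  also have "\<dots> = - (a * (\<integral>x. G x $ i $ j * \<phi> x \<partial>lebesgue_on \<Omega>) + b * (\<integral>x. H x $ i $ j * \<phi> x \<partial>lebesgue_on \<Omega>))"
    using v(3) w(3) \<phi> by (simp add: is_weak_gradient_def)
  also have "a * (\<integral>x. G x $ i $ j * \<phi> x \<partial>lebesgue_on \<Omega>) + b * (\<integral>x. H x $ i $ j * \<phi> x \<partial>lebesgue_on \<Omega>)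
     = (\<integral>x. a * (G x $ i $ j * \<phi> x) + b * (H x $ i $ j * \<phi> x) \<partial>lebesgue_on \<Omega>)"
    using i2 by simp
  also have "\<dots> = (\<integral>x. (a *\<^sub>R G x + b *\<^sub>R H x) $ i $ j * \<phi> x \<partial>lebesgue_on \<Omega>)"
    by (intro Bochner_Integration.integral_cong) (auto simp: algebra_simps)
  finally show "(\<integral>x. (a *\<^sub>R v x + b *\<^sub>R w x) $ i * ?D x \<partial>lebesgue_on \<Omega>)
     = - (\<integral>x. (a *\<^sub>R G x + b *\<^sub>R H x) $ i $ j * \<phi> x \<partial>lebesgue_on \<Omega>)" .
qed

lemma H1_space_L2: "v \<in> H1_space \<Omega> \<Longrightarrow> v \<in> L2_space (lebesgue_on \<Omega>)"
  by (simp add: H1_space_def)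

lemma H1_space_linear:
  assumes \<Omega>: "open \<Omega>" "bounded \<Omega>" and "v \<in> H1_space \<Omega>" "w \<in> H1_space \<Omega>"
  shows "(\<lambda>x. a *\<^sub>R v x + b *\<^sub>R w x) \<in> H1_space \<Omega>"
proof -
  note v = H1_space_L2[OF assms(3)] weak_grad_H1[OF assms(3)]
  note w = H1_space_L2[OF assms(4)] weak_grad_H1[OF assms(4)]
  have "(\<lambda>x. a *\<^sub>R weak_grad \<Omega> v x + b *\<^sub>R weak_grad \<Omega> w x) \<in> L2_space (lebesgue_on \<Omega>)"
    by (intro L2_space_add L2_space_scale v w)
  moreover have "(\<lambda>x. a *\<^sub>R v x + b *\<^sub>R w x) \<in> L2_space (lebesgue_on \<Omega>)"
    by (intro L2_space_add L2_space_scale v w)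
  ultimately show ?thesis
    using is_weak_gradient_linear[OF \<Omega> v w] by (auto simp: H1_space_def)
qed

text \<open>\<open>weak_grad\<close> is defined by choice and need not be linear pointwise, but both
  sides are weak gradients of the same field.\<close>

lemma weak_grad_linear:
  assumes h: "smooth_step h" and \<Omega>: "open \<Omega>" "bounded \<Omega>" and "v \<in> H1_space \<Omega>" "w \<in> H1_space \<Omega>"
  shows "AE x in lebesgue_on \<Omega>. weak_grad \<Omega> (\<lambda>x. a *\<^sub>R v x + b *\<^sub>R w x) x = a *\<^sub>R weak_grad \<Omega> v x + b *\<^sub>R weak_grad \<Omega> w x"
proof (rule weak_gradient_unique[OF h \<Omega>])
  note v = H1_space_L2[OF assms(4)] weak_grad_H1[OF assms(4)]
  note w = H1_space_L2[OF assms(5)] weak_grad_H1[OF assms(5)]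
  note vw = weak_grad_H1[OF H1_space_linear[OF \<Omega> assms(4,5)]]
  show "weak_grad \<Omega> (\<lambda>x. a *\<^sub>R v x + b *\<^sub>R w x) \<in> L2_space (lebesgue_on \<Omega>)" by (rule vw)
  show "is_weak_gradient \<Omega> (\<lambda>x. a *\<^sub>R v x + b *\<^sub>R w x) (weak_grad \<Omega> (\<lambda>x. a *\<^sub>R v x + b *\<^sub>R w x))" by (rule vw)
  show "(\<lambda>x. a *\<^sub>R weak_grad \<Omega> v x + b *\<^sub>R weak_grad \<Omega> w x) \<in> L2_space (lebesgue_on \<Omega>)"
    by (intro L2_space_add L2_space_scale v w)
  show "is_weak_gradient \<Omega> (\<lambda>x. a *\<^sub>R v x + b *\<^sub>R w x) (\<lambda>x. a *\<^sub>R weak_grad \<Omega> v x + b *\<^sub>R weak_grad \<Omega> w x)"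
    by (rule is_weak_gradient_linear[OF \<Omega> v w])
qed

lemma integral_lebesgue_on_subset:
  fixes F :: "'a::euclidean_space \<Rightarrow> real"
  assumes "W \<subseteq> \<Omega>" "W \<in> sets lebesgue" "\<Omega> \<in> sets lebesgue" "\<And>x. x \<in> \<Omega> - W \<Longrightarrow> F x = 0"
  shows "(\<integral>x. F x \<partial>lebesgue_on \<Omega>) = (\<integral>x. F x \<partial>lebesgue_on W)"
proof -
  have "(\<lambda>x. indicator \<Omega> x *\<^sub>R F x) = (\<lambda>x. indicator W x *\<^sub>R F x)"
    using assms(1,4) by (fastforce simp: indicator_def)
  then show ?thesis using assms(2,3) by (simp add: integral_restrict_space)
qed

lemma integrable_lebesgue_on_subset:
  fixes F :: "'a::euclidean_space \<Rightarrow> real"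
  assumes W: "W \<subseteq> \<Omega>" "W \<in> sets lebesgue" "\<Omega> \<in> sets lebesgue" and F: "integrable (lebesgue_on \<Omega>) F"
  shows "integrable (lebesgue_on W) F"
proof -
  have "integrable lebesgue (\<lambda>x. indicator W x *\<^sub>R (indicator \<Omega> x *\<^sub>R F x))"
  proof (rule integrable_mult_indicator[OF W(2)])
    show "integrable lebesgue (\<lambda>x. indicator \<Omega> x *\<^sub>R F x)" using F W(3) by (simp add: integrable_restrict_space)
  qed
  also have "(\<lambda>x. indicator W x *\<^sub>R (indicator \<Omega> x *\<^sub>R F x)) = (\<lambda>x. indicator W x *\<^sub>R F x)"
    using W(1) by (auto simp: indicator_def fun_eq_iff)
  finally show ?thesis using W(2) by (simp add: integrable_restrict_space)
qed

text \<open>Weak gradients are local: test functions of \<open>W\<close> are test functions of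
  \<open>\<Omega>\<close>, and against them the gradient of an affine field acts as the constant
  matrix \<open>A\<close>. It is applied to the part of a triangle's interior lying in the
  domain.\<close>

lemma weak_grad_affine_on:
  assumes h: "smooth_step h" and \<Omega>: "open \<Omega>" "bounded \<Omega>" and v: "v \<in> H1_space \<Omega>"
    and W: "open W" "W \<subseteq> \<Omega>" and A: "\<And>x. x \<in> W \<Longrightarrow> v x = A *v x + c"
  shows "AE x in lebesgue_on W. weak_grad \<Omega> v x = A"
proof -
  have Wb: "bounded W" using \<Omega>(2) W(2) by (rule bounded_subset)
  note M = finite_measure_lebesgue_on_open_bounded[OF \<Omega>]
  note MW = finite_measure_lebesgue_on_open_bounded[OF W(1) Wb]
  interpret W: finite_measure "lebesgue_on W" by (rule MW)
  define G where "G = weak_grad \<Omega> v"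
  note Gw = weak_grad_H1[OF v, folded G_def]
  have Gi: "integrable (lebesgue_on W) (\<lambda>x. G x $ i $ j)" for i j
  proof -
    have "integrable (lebesgue_on \<Omega>) (\<lambda>x. G x $ i $ j)"
      using L2_space_integrable[OF Gw(1) M(3)] by (rule integrable_component2)
    then show ?thesis by (rule integrable_lebesgue_on_subset[OF W(2) MW(1) M(1)])
  qed
  have "AE x in lebesgue_on W. G x $ i $ j - A $ i $ j = 0" for i j
  proof (rule fundamental_lemma[OF h W(1)])
    show "integrable (lebesgue_on W) (\<lambda>x. G x $ i $ j - A $ i $ j)" using Gi by simp
    fix \<phi> assume \<phi>: "\<phi> \<in> test_functions W"
    then have \<phi>\<Omega>: "\<phi> \<in> test_functions \<Omega>" using W(2) by (auto simp: test_functions_def)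
    let ?D = "\<lambda>x. frechet_derivative \<phi> (at x) (axis j 1)"
    have jB: "axis j (1::real) \<in> Basis" by (simp add: axis_in_Basis_iff)
    have lin: "linear (\<lambda>x. (A *v x) $ i)"
      by (rule linearI) (simp_all add: matrix_vector_right_distrib matrix_vector_mult_scaleR)
    have Aij: "(A *v axis j 1) $ i = A $ i $ j" by (simp add: matrix_vector_mul_component inner_axis)
    have "(\<integral>x. G x $ i $ j * \<phi> x \<partial>lebesgue_on W) = (\<integral>x. G x $ i $ j * \<phi> x \<partial>lebesgue_on \<Omega>)"
      using test_function_eq_0[OF \<phi>] by (intro integral_lebesgue_on_subset[symmetric] W MW M) auto
    also have "\<dots> = - (\<integral>x. v x $ i * ?D x \<partial>lebesgue_on \<Omega>)"
      using Gw(2) \<phi>\<Omega> by (simp add: is_weak_gradient_def)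
    also have "(\<integral>x. v x $ i * ?D x \<partial>lebesgue_on \<Omega>) = (\<integral>x. v x $ i * ?D x \<partial>lebesgue_on W)"
      using test_function_partial_eq_0[OF \<phi>] by (intro integral_lebesgue_on_subset W MW M) auto
    also have "\<dots> = (\<integral>x. ((A *v x) $ i + c $ i) * ?D x \<partial>lebesgue_on W)"
      by (intro Bochner_Integration.integral_cong) (auto simp: A)
    also have "\<dots> = - (\<integral>x. A $ i $ j * \<phi> x \<partial>lebesgue_on W)"
      using integral_affine_by_parts[OF \<phi> MW(1) lin jB, of "c $ i"] by (simp only: Aij)
    finally have eq: "(\<integral>x. G x $ i $ j * \<phi> x \<partial>lebesgue_on W) = (\<integral>x. A $ i $ j * \<phi> x \<partial>lebesgue_on W)" by simp
    have "(\<integral>x. (G x $ i $ j - A $ i $ j) * \<phi> x \<partial>lebesgue_on W)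
      = (\<integral>x. G x $ i $ j * \<phi> x \<partial>lebesgue_on W) - (\<integral>x. A $ i $ j * \<phi> x \<partial>lebesgue_on W)"
      unfolding left_diff_distrib
      by (intro Bochner_Integration.integral_diff integrable_mult_test_function[OF \<phi>] Gi) simp
    then show "(\<integral>x. (G x $ i $ j - A $ i $ j) * \<phi> x \<partial>lebesgue_on W) = 0" using eq by simp
  qed
  then have "AE x in lebesgue_on W. \<forall>i\<in>UNIV. \<forall>j\<in>UNIV. G x $ i $ j - A $ i $ j = 0"
    by (intro AE_finite_allI) auto
  then show ?thesis unfolding G_def by eventually_elim (simp add: vec_eq_iff)
qed

section \<open>Mollified gradients\<close>

lemma mollifier_kernel_bounded:
  assumes "mollifier_kernel \<eta>"
  shows "\<eta> \<in> borel_measurable borel" "\<exists>C. \<forall>x. \<bar>\<eta> x\<bar> \<le> C"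
proof -
  have "\<eta> \<in> test_functions UNIV" using assms by (simp add: mollifier_kernel_def)
  from test_function_bounded_measurable[OF this]
  show "\<eta> \<in> borel_measurable borel" "\<exists>C. \<forall>x. \<bar>\<eta> x\<bar> \<le> C" by auto
qed

lemma integrable_mollified:
  fixes G :: "real^2 \<Rightarrow> real^2^2"
  assumes \<eta>: "mollifier_kernel \<eta>" and G: "integrable (lebesgue_on \<Omega>) G"
  shows "integrable (lebesgue_on \<Omega>) (\<lambda>z. \<eta> (x - z) *\<^sub>R G z)"
proof -
  obtain C where C: "\<forall>x. \<bar>\<eta> x\<bar> \<le> C" using mollifier_kernel_bounded[OF \<eta>] by (elim exE)
  have \<eta>m: "(\<lambda>z. \<eta> (x - z)) \<in> borel_measurable (lebesgue_on \<Omega>)"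
    by (intro borel_measurable_lebesgue_onI measurable_compose[OF _ mollifier_kernel_bounded(1)[OF \<eta>]]) simp
  show ?thesis
  proof (rule Bochner_Integration.integrable_bound[of _ "\<lambda>z. C * norm (G z)"])
    show "integrable (lebesgue_on \<Omega>) (\<lambda>z. C * norm (G z))" using G by simp
    show "(\<lambda>z. \<eta> (x - z) *\<^sub>R G z) \<in> borel_measurable (lebesgue_on \<Omega>)"
      using G \<eta>m by (intro borel_measurable_scaleR) auto
    show "AE z in lebesgue_on \<Omega>. norm (\<eta> (x - z) *\<^sub>R G z) \<le> norm (C * norm (G z))"
    proof (rule AE_I2)
      fix z
      have "\<bar>\<eta> (x - z)\<bar> \<le> \<bar>C\<bar>" using C[rule_format, of "x - z"] by linarith
      then show "norm (\<eta> (x - z) *\<^sub>R G z) \<le> norm (C * norm (G z))"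
        by (simp add: abs_mult mult_right_mono)
    qed
  qed
qed

lemma weak_grad_integrable:
  assumes "open \<Omega>" "bounded \<Omega>" "v \<in> H1_space \<Omega>"
  shows "integrable (lebesgue_on \<Omega>) (weak_grad \<Omega> v)"
  by (rule L2_space_integrable[OF weak_grad_H1(1)[OF assms(3)] finite_measure_lebesgue_on_open_bounded(3)[OF assms(1,2)]])

text \<open>In contrast to \<open>weak_grad\<close>, this holds at every point \<open>x\<close>: the
  integral does not see the null set on which the gradients fail to be additive.\<close>

lemma mollified_grad_linear:
  assumes h: "smooth_step h" and \<Omega>: "open \<Omega>" "bounded \<Omega>" and \<eta>: "mollifier_kernel \<eta>"
    and vw: "v \<in> H1_space \<Omega>" "w \<in> H1_space \<Omega>"
  shows "mollified_grad \<Omega> \<eta> (\<lambda>x. a *\<^sub>R v x + b *\<^sub>R w x) x = a *\<^sub>R mollified_grad \<Omega> \<eta> v x + b *\<^sub>R mollified_grad \<Omega> \<eta> w x"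
proof -
  note i = integrable_mollified[OF \<eta> weak_grad_integrable[OF \<Omega>]]
  have "mollified_grad \<Omega> \<eta> (\<lambda>x. a *\<^sub>R v x + b *\<^sub>R w x) x
    = (\<integral>z. a *\<^sub>R (\<eta> (x - z) *\<^sub>R weak_grad \<Omega> v z) + b *\<^sub>R (\<eta> (x - z) *\<^sub>R weak_grad \<Omega> w z) \<partial>lebesgue_on \<Omega>)"
    unfolding mollified_grad_def
  proof (rule integral_cong_AE)
    show "(\<lambda>z. \<eta> (x - z) *\<^sub>R weak_grad \<Omega> (\<lambda>x. a *\<^sub>R v x + b *\<^sub>R w x) z) \<in> borel_measurable (lebesgue_on \<Omega>)"
      by (rule borel_measurable_integrable[OF i[OF H1_space_linear[OF \<Omega> vw]]])
    show "(\<lambda>z. a *\<^sub>R (\<eta> (x - z) *\<^sub>R weak_grad \<Omega> v z) + b *\<^sub>R (\<eta> (x - z) *\<^sub>R weak_grad \<Omega> w z)) \<in> borel_measurable (lebesgue_on \<Omega>)"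
      by (intro borel_measurable_add borel_measurable_scaleR borel_measurable_const
          borel_measurable_integrable[OF i[OF vw(1)]] borel_measurable_integrable[OF i[OF vw(2)]])
    show "AE z in lebesgue_on \<Omega>. \<eta> (x - z) *\<^sub>R weak_grad \<Omega> (\<lambda>x. a *\<^sub>R v x + b *\<^sub>R w x) z
        = a *\<^sub>R (\<eta> (x - z) *\<^sub>R weak_grad \<Omega> v z) + b *\<^sub>R (\<eta> (x - z) *\<^sub>R weak_grad \<Omega> w z)"
      using weak_grad_linear[OF h \<Omega> vw, of a b]
      by eventually_elim (simp add: scaleR_right_distrib mult.commute)
  qed
  also have "\<dots> = a *\<^sub>R mollified_grad \<Omega> \<eta> v x + b *\<^sub>R mollified_grad \<Omega> \<eta> w x"
    unfolding mollified_grad_def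
    by (subst Bochner_Integration.integral_add) (simp_all only: integrable_scaleR_right integral_scaleR_right i[OF vw(1)] i[OF vw(2)])
  finally show ?thesis .
qed

text \<open>The bound is the supremum of the kernel times the integral of the norm of the gradient,
  uniformly in \<open>x\<close>.\<close>

lemma mollified_grad_bounded:
  assumes \<Omega>: "open \<Omega>" "bounded \<Omega>" and \<eta>: "mollifier_kernel \<eta>" and v: "v \<in> H1_space \<Omega>"
  shows "\<exists>C. \<forall>x. norm (mollified_grad \<Omega> \<eta> v x) \<le> C"
proof -
  obtain C where C: "\<forall>x. \<bar>\<eta> x\<bar> \<le> C" using mollifier_kernel_bounded[OF \<eta>] by (elim exE)
  note gi = weak_grad_integrable[OF \<Omega> v]
  have "norm (mollified_grad \<Omega> \<eta> v x) \<le> (\<integral>z. C * norm (weak_grad \<Omega> v z) \<partial>lebesgue_on \<Omega>)" for x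
    unfolding mollified_grad_def
  proof (rule Bochner_Integration.integral_norm_bound_integral)
    show "integrable (lebesgue_on \<Omega>) (\<lambda>z. \<eta> (x - z) *\<^sub>R weak_grad \<Omega> v z)"
      by (rule integrable_mollified[OF \<eta> gi])
    show "integrable (lebesgue_on \<Omega>) (\<lambda>z. C * norm (weak_grad \<Omega> v z))" using gi by simp
    show "norm (\<eta> (x - z) *\<^sub>R weak_grad \<Omega> v z) \<le> C * norm (weak_grad \<Omega> v z)" for z
      using C by (simp add: mult_right_mono)
  qed
  then show ?thesis by blast
qed

text \<open>The integrand is jointly measurable in \<open>x\<close> and \<open>z\<close>, so its
  integral depends measurably on the parameter \<open>x\<close>.\<close>

lemma mollified_grad_measurable:
  assumes \<Omega>: "open \<Omega>" "bounded \<Omega>" and \<eta>: "mollifier_kernel \<eta>" and v: "v \<in> H1_space \<Omega>"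
  shows "mollified_grad \<Omega> \<eta> v \<in> borel_measurable borel"
proof -
  interpret finite_measure "lebesgue_on \<Omega>" by (rule finite_measure_lebesgue_on_open_bounded(3)[OF \<Omega>])
  have G[measurable]: "weak_grad \<Omega> v \<in> borel_measurable (lebesgue_on \<Omega>)"
    by (rule borel_measurable_integrable[OF weak_grad_integrable[OF \<Omega> v]])
  have id[measurable]: "(\<lambda>x. x) \<in> lebesgue_on \<Omega> \<rightarrow>\<^sub>M borel"
    by (rule borel_measurable_lebesgue_onI) simp
  note [measurable] = mollifier_kernel_bounded(1)[OF \<eta>]
  have "(\<lambda>p. \<eta> (fst p - snd p) *\<^sub>R weak_grad \<Omega> v (snd p)) \<in> borel_measurable (borel \<Otimes>\<^sub>M lebesgue_on \<Omega>)"
  proof (intro borel_measurable_scaleR measurable_compose[OF _ mollifier_kernel_bounded(1)[OF \<eta>]] borel_measurable_diff)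
    show "snd \<in> borel \<Otimes>\<^sub>M lebesgue_on \<Omega> \<rightarrow>\<^sub>M borel" by (rule measurable_compose[OF measurable_snd id])
    show "(\<lambda>p. weak_grad \<Omega> v (snd p)) \<in> borel_measurable (borel \<Otimes>\<^sub>M lebesgue_on \<Omega>)"
      by (rule measurable_compose[OF measurable_snd G])
  qed simp
  then show ?thesis unfolding mollified_grad_def[abs_def]
    by (intro borel_measurable_lebesgue_integral) (simp add: case_prod_beta')
qed

section \<open>The boundary of a Lipschitz domain has finite length\<close>

text \<open>Cutting the interval into \<open>n\<close> equal pieces gives sets of diameter at most
  \<open>L * (b - a) / n\<close>. This falls below \<open>\<delta>\<close> for large
  \<open>n\<close>, while the sum of the bounds stays \<open>L * (b - a)\<close>.\<close>

lemma hausdorff1_outer_lipschitz_image: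
  fixes F :: "real \<Rightarrow> 'a::metric_space"
  assumes F: "L-lipschitz_on {a..b} F" and ab: "a \<le> b"
  shows "hausdorff1_outer (F ` {a..b}) \<le> ennreal (L * (b - a))"
  unfolding hausdorff1_outer_def
proof (rule SUP_least)
  fix \<delta> :: real assume "\<delta> \<in> {0<..}"
  then have \<delta>: "0 < \<delta>" by simp
  have L: "0 \<le> L" using F by (rule lipschitz_on_nonneg)
  obtain n0 :: nat where n0: "L * (b - a) / \<delta> < real n0" using reals_Archimedean2 by blast
  define n where "n = Suc n0"
  have n: "L * (b - a) / real n \<le> \<delta>" "0 < n"
  proof -
    have "L * (b - a) \<le> real n0 * \<delta>" using n0 \<delta> by (simp add: divide_less_eq)
    also have "\<dots> \<le> \<delta> * real n" using \<delta> by (simp add: n_def algebra_simps)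
    finally show "L * (b - a) / real n \<le> \<delta>" by (simp add: n_def divide_le_eq)
  qed (simp add: n_def)
  define s where "s = (b - a) / real n"
  have s: "0 \<le> s" "real n * s = b - a" using ab n(2) by (auto simp: s_def)
  define U where "U i = (if i < n then F ` ({a + real i * s..a + real (Suc i) * s} \<inter> {a..b}) else {})" for i
  have dist: "dist x y \<le> L * s" if xy: "x \<in> U i" "y \<in> U i" for x y i
  proof -
    have "i < n" using xy(1) by (cases "i < n") (simp_all add: U_def)
    then have U: "U i = F ` ({a + real i * s..a + real (Suc i) * s} \<inter> {a..b})" by (simp add: U_def)
    obtain t where t: "x = F t" "a + real i * s \<le> t" "t \<le> a + real (Suc i) * s" "t \<in> {a..b}"
      using xy(1) unfolding U by (elim imageE IntE) simp
    obtain u where u: "y = F u" "a + real i * s \<le> u" "u \<le> a + real (Suc i) * s" "u \<in> {a..b}"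
      using xy(2) unfolding U by (elim imageE IntE) simp
    have "dist x y \<le> L * dist t u" using lipschitz_onD[OF F t(4) u(4)] t(1) u(1) by simp
    also have "\<dots> \<le> L * s"
      using t u L by (intro mult_left_mono) (auto simp: dist_real_def algebra_simps)
    finally show ?thesis .
  qed
  have dia: "diameter (U i) \<le> L * s" for i
    unfolding diameter_def using dist L s(1) by (auto intro!: cSUP_least)
  have bd: "bounded (U i)" for i
  proof (cases "U i = {}")
    case False
    then obtain x where "x \<in> U i" by blast
    then have "\<forall>y\<in>U i. dist x y \<le> L * s" using dist by blast
    then show ?thesis unfolding bounded_def by (intro exI)
  qed simp
  have cov: "F ` {a..b} \<subseteq> (\<Union>i. U i)"
  proof clarify
    fix t assume t: "t \<in> {a..b}"
    show "F t \<in> (\<Union>i. U i)"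
    \<comment> \<open>The floor below would assign the right end point the index \<open>n\<close>,
      one too many, and would divide by zero for a degenerate interval; both cases are put into the
      last piece, with index \<open>n - 1\<close>.\<close>
    proof (cases "t = b \<or> s = 0")
      case True
      define i where "i = n - 1"
      have i: "real (Suc i) = real n" "i < n" using n(2) by (auto simp: i_def)
      have "a + real (Suc i) * s = b" using i s by simp
      moreover have "real (Suc i) * s = real i * s + s" by (simp add: algebra_simps)
      ultimately have "a + real i * s \<le> t" "t \<le> a + real (Suc i) * s"
        using True t s(1) by (auto)
      then have "F t \<in> U i" using i(2) t by (auto simp: U_def)
      then show ?thesis by blast
    next
      case False
      then have s0: "0 < s" and tb: "t < b" using s(1) t by auto
      define i where "i = nat \<lfloor>(t - a) / s\<rfloor>"
      have "0 \<le> (t - a) / s" using t s0 by simp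
      then have i: "real i \<le> (t - a) / s" "(t - a) / s < real i + 1" unfolding i_def by linarith+
      have "a + real i * s \<le> t" using i(1) s0 by (simp add: le_divide_eq)
      moreover have "t < a + real (Suc i) * s" using i(2) s0 by (simp add: divide_less_eq algebra_simps)
      moreover have "i < n"
      proof -
        have "real i * s < real n * s" using calculation(1) tb s(2) by simp
        then show ?thesis using s0 by simp
      qed
      ultimately have "F t \<in> U i" using t by (auto simp: U_def)
      then show ?thesis by blast
    qed
  qed
  have "hausdorff1_pre \<delta> (F ` {a..b}) \<le> (\<Sum>i. ennreal (diameter (U i)))"
  proof (rule hausdorff1_pre_le[OF cov bd])
    show "diameter (U i) \<le> \<delta>" for i using dia[of i] n(1) by (simp add: s_def)
  qed
  also have "\<dots> = (\<Sum>i<n. ennreal (diameter (U i)))"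
    by (rule suminf_finite) (auto simp: U_def)
  also have "\<dots> \<le> (\<Sum>i<n. ennreal (L * s))"
    by (intro sum_mono ennreal_leI dia)
  also have "\<dots> = ennreal (L * (b - a))"
    using L s by (simp add: ennreal_of_nat_eq_real_of_nat ennreal_mult[symmetric] mult.left_commute)
  finally show "hausdorff1_pre \<delta> (F ` {a..b}) \<le> ennreal (L * (b - a))" .
qed

lemma hausdorff1_outer_singleton: "hausdorff1_outer {p :: 'a::metric_space} = 0"
proof -
  have "hausdorff1_outer ((\<lambda>_. p) ` {0..0::real}) \<le> ennreal (0 * (0 - 0))"
    by (rule hausdorff1_outer_lipschitz_image) (auto intro: lipschitz_onI)
  then show ?thesis by simp
qed

text \<open>The remainder \<open>y\<close> is orthogonal to both unit vectors. These two linear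
  equations have determinant \<open>D\<close> with \<open>D * D = 1\<close>, so \<open>y = 0\<close>
  by Cramer's rule.\<close>

lemma orthonormal_pair_expansion:
  fixes e1 e2 x :: "real^2"
  assumes "norm e1 = 1" "norm e2 = 1" "e1 \<bullet> e2 = 0"
  shows "x = (x \<bullet> e1) *\<^sub>R e1 + (x \<bullet> e2) *\<^sub>R e2"
proof -
  define y where "y = x - (x \<bullet> e1) *\<^sub>R e1 - (x \<bullet> e2) *\<^sub>R e2"
  have n: "e1 \<bullet> e1 = 1" "e2 \<bullet> e2 = 1" using assms by (simp_all add: dot_square_norm)
  have "y \<bullet> e1 = 0" "y \<bullet> e2 = 0"
    using assms(3) n by (simp_all add: y_def inner_diff_left inner_commute[of e2 e1])
  then have y: "y$1 * e1$1 + y$2 * e1$2 = 0" "y$1 * e2$1 + y$2 * e2$2 = 0"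
    by (auto simp: inner_vec_def sum_2)
  have e: "e1$1 * e1$1 + e1$2 * e1$2 = 1" "e2$1 * e2$1 + e2$2 * e2$2 = 1" "e1$1 * e2$1 + e1$2 * e2$2 = 0"
    using assms(3) n by (auto simp: inner_vec_def sum_2)
  define D where "D = e1$1 * e2$2 - e1$2 * e2$1"
  \<comment> \<open>Lagrange's identity for two plane vectors.\<close>
  have "D * D = (e1$1 * e1$1 + e1$2 * e1$2) * (e2$1 * e2$1 + e2$2 * e2$2) - (e1$1 * e2$1 + e1$2 * e2$2) * (e1$1 * e2$1 + e1$2 * e2$2)"
    by (simp add: D_def algebra_simps)
  then have D: "D \<noteq> 0" using e by auto
  have "y$1 * D = e2$2 * (y$1 * e1$1 + y$2 * e1$2) - e1$2 * (y$1 * e2$1 + y$2 * e2$2)"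
    "y$2 * D = e1$1 * (y$1 * e2$1 + y$2 * e2$2) - e2$1 * (y$1 * e1$1 + y$2 * e1$2)"
    by (simp_all add: D_def algebra_simps)
  then have "y = 0" using y D by (auto simp: vec_eq_iff forall_2)
  then show ?thesis by (simp add: y_def algebra_simps)
qed

text \<open>Near each of its points the frontier lies on the graph of a Lipschitz function.
  Restricting to a unit ball bounds the parameter interval, hence the length, and compactness leaves
  finitely many such pieces.\<close>

lemma hausdorff1_outer_frontier_finite:
  assumes "lipschitz_domain \<Omega>"
  shows "hausdorff1_outer (frontier \<Omega>) < top"
proof -
  have \<Omega>: "open \<Omega>" "bounded \<Omega>" using assms by (auto simp: lipschitz_domain_def)
  have loc: "\<exists>W. open W \<and> p \<in> W \<and> hausdorff1_outer (frontier \<Omega> \<inter> W) < top" if p: "p \<in> frontier \<Omega>" for p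
  proof -
    obtain U e1 e2 \<gamma> L where U: "open U" "p \<in> U" and e: "norm e1 = 1" "norm e2 = 1" "e1 \<bullet> e2 = 0"
      and \<gamma>: "L-lipschitz_on (UNIV :: real set) \<gamma>" and eq: "\<Omega> \<inter> U = {x \<in> U. \<gamma> (x \<bullet> e1) < x \<bullet> e2}"
    proof -
      have "\<exists>U e1 e2 \<gamma> L. open U \<and> p \<in> U \<and> norm e1 = 1 \<and> norm e2 = 1 \<and> e1 \<bullet> e2 = 0 \<and>
        L-lipschitz_on (UNIV :: real set) \<gamma> \<and> \<Omega> \<inter> U = {x \<in> U. \<gamma> (x \<bullet> e1) < x \<bullet> e2}"
        using assms p unfolding lipschitz_domain_def by simp
      then show ?thesis by (elim exE conjE) (rule that)
    qed
    have L: "0 \<le> L" using \<gamma> by (rule lipschitz_on_nonneg)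
    have gc: "continuous_on UNIV (\<lambda>x. \<gamma> (x \<bullet> e1))"
      by (rule continuous_on_compose2[OF lipschitz_on_continuous_on[OF \<gamma>]]) (auto intro!: continuous_intros)
    define F where "F s = s *\<^sub>R e1 + \<gamma> s *\<^sub>R e2" for s
    have F: "(1 + L)-lipschitz_on {a..b} F" for a b
    proof (rule lipschitz_onI)
      fix s t :: real
      have "dist (F s) (F t) = norm ((s - t) *\<^sub>R e1 + (\<gamma> s - \<gamma> t) *\<^sub>R e2)"
        by (simp add: F_def dist_norm algebra_simps)
      also have "\<dots> \<le> \<bar>s - t\<bar> + \<bar>\<gamma> s - \<gamma> t\<bar>"
        using norm_triangle_ineq[of "(s - t) *\<^sub>R e1" "(\<gamma> s - \<gamma> t) *\<^sub>R e2"] e by simp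
      also have "\<bar>\<gamma> s - \<gamma> t\<bar> \<le> L * \<bar>s - t\<bar>"
        using lipschitz_onD[OF \<gamma>, of s t] by (simp add: dist_real_def)
      finally show "dist (F s) (F t) \<le> (1 + L) * dist s t" by (simp add: dist_real_def algebra_simps)
    qed (use L in simp)
    \<comment> \<open>A frontier point in \<open>U\<close> is not above the graph, since it is not
      in the open set \<open>\<Omega>\<close>; it is not below it either, since the part of
      \<open>U\<close> below the graph is open and misses \<open>\<Omega>\<close>.\<close>
    have gr: "x = F (x \<bullet> e1)" if x: "x \<in> frontier \<Omega>" "x \<in> U" for x
    proof -
      have nx: "x \<notin> \<Omega>" and cx: "x \<in> closure \<Omega>"
        using x(1) \<Omega>(1) by (auto simp: frontier_def interior_open)
      have "\<not> \<gamma> (x \<bullet> e1) < x \<bullet> e2" using nx x(2) eq by blast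
      moreover have "\<not> x \<bullet> e2 < \<gamma> (x \<bullet> e1)"
      proof
        assume lt: "x \<bullet> e2 < \<gamma> (x \<bullet> e1)"
        have "open (U \<inter> {y. y \<bullet> e2 < \<gamma> (y \<bullet> e1)})"
          by (intro open_Int U open_Collect_less gc continuous_intros)
        moreover have "x \<in> U \<inter> {y. y \<bullet> e2 < \<gamma> (y \<bullet> e1)}" using lt x(2) by simp
        ultimately obtain y where "y \<in> \<Omega>" "y \<in> U" "y \<bullet> e2 < \<gamma> (y \<bullet> e1)"
          using cx unfolding closure_iff_nhds_not_empty by blast
        moreover have "y \<in> {x \<in> U. \<gamma> (x \<bullet> e1) < x \<bullet> e2}"
          unfolding eq[symmetric] using calculation by simp
        ultimately show False by simp
      qed
      ultimately have "x \<bullet> e2 = \<gamma> (x \<bullet> e1)" by simp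
      then show ?thesis using orthonormal_pair_expansion[OF e, of x] by (simp add: F_def)
    qed
    define W where "W = U \<inter> ball p 1"
    have "frontier \<Omega> \<inter> W \<subseteq> F ` {p \<bullet> e1 - 1..p \<bullet> e1 + 1}"
    proof
      fix x assume x: "x \<in> frontier \<Omega> \<inter> W"
      have "\<bar>(x - p) \<bullet> e1\<bar> \<le> norm (x - p) * norm e1" by (rule Cauchy_Schwarz_ineq2)
      also have "\<dots> \<le> 1" using x e(1) by (simp add: W_def dist_norm norm_minus_commute)
      finally have "x \<bullet> e1 \<in> {p \<bullet> e1 - 1..p \<bullet> e1 + 1}" by (simp add: inner_diff_left abs_le_iff)
      moreover have "x = F (x \<bullet> e1)" using gr x by (simp add: W_def)
      ultimately show "x \<in> F ` {p \<bullet> e1 - 1..p \<bullet> e1 + 1}" by (rule rev_image_eqI)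
    qed
    then have "hausdorff1_outer (frontier \<Omega> \<inter> W) \<le> ennreal ((1 + L) * (p \<bullet> e1 + 1 - (p \<bullet> e1 - 1)))"
      by (rule order_trans[OF hausdorff1_outer_mono hausdorff1_outer_lipschitz_image[OF F]]) simp
    also have "\<dots> < top" by simp
    finally have "hausdorff1_outer (frontier \<Omega> \<inter> W) < top" .
    then show ?thesis using U by (intro exI[of _ W]) (simp add: W_def open_Int)
  qed
  have "compact (frontier \<Omega>)" using \<Omega>(2) by (rule compact_frontier_bounded)
  then show ?thesis
  proof (rule compactE[of _ "{W. open W \<and> hausdorff1_outer (frontier \<Omega> \<inter> W) < top}"])
    show "frontier \<Omega> \<subseteq> \<Union>{W. open W \<and> hausdorff1_outer (frontier \<Omega> \<inter> W) < top}" using loc by blast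
    fix D assume D: "D \<subseteq> {W. open W \<and> hausdorff1_outer (frontier \<Omega> \<inter> W) < top}" "finite D" "frontier \<Omega> \<subseteq> \<Union>D"
    have "hausdorff1_outer (\<Union>W\<in>D. frontier \<Omega> \<inter> W) < top"
      using D(2,1)
    proof (induction D)
      case (insert W D)
      have "hausdorff1_outer (\<Union>W\<in>insert W D. frontier \<Omega> \<inter> W)
          \<le> hausdorff1_outer (frontier \<Omega> \<inter> W) + hausdorff1_outer (\<Union>W\<in>D. frontier \<Omega> \<inter> W)"
        using hausdorff1_outer_Un[of "frontier \<Omega> \<inter> W" "\<Union>W\<in>D. frontier \<Omega> \<inter> W"] by simp
      also have "\<dots> < top" using insert by simp
      finally show ?case .
    qed (simp add: hausdorff1_outer_empty)
    moreover have "(\<Union>W\<in>D. frontier \<Omega> \<inter> W) = frontier \<Omega>" using D(3) by auto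
    ultimately show ?thesis by simp
  qed simp
qed

section \<open>Finite-dimensional function spaces\<close>

definition function_subspace :: "('a \<Rightarrow> 'b::real_vector) set \<Rightarrow> bool" where
  "function_subspace V \<longleftrightarrow> (\<lambda>_. 0) \<in> V \<and> (\<forall>u\<in>V. \<forall>v\<in>V. (\<lambda>x. u x + v x) \<in> V) \<and>
     (\<forall>c. \<forall>u\<in>V. (\<lambda>x. c *\<^sub>R u x) \<in> V)"

definition linear_map_on :: "('a \<Rightarrow> 'b::real_vector) set \<Rightarrow> (('a \<Rightarrow> 'b) \<Rightarrow> 'c::real_vector) \<Rightarrow> bool" where
  "linear_map_on V l \<longleftrightarrow> (\<forall>u\<in>V. \<forall>v\<in>V. l (\<lambda>x. u x + v x) = l u + l v) \<and>
     (\<forall>c. \<forall>u\<in>V. l (\<lambda>x. c *\<^sub>R u x) = c *\<^sub>R l u)"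

text \<open>Linearity is asked in the first argument; symmetry supplies the second. Definiteness
  refers to equality of functions rather than of classes, which is appropriate for finite element
  fields, fixed as functions on the whole plane.\<close>

definition inner_form :: "('a \<Rightarrow> 'b::real_vector) set \<Rightarrow> (('a \<Rightarrow> 'b) \<Rightarrow> ('a \<Rightarrow> 'b) \<Rightarrow> real) \<Rightarrow> bool" where
  "inner_form V a \<longleftrightarrow> (\<forall>v\<in>V. linear_map_on V (\<lambda>u. a u v)) \<and> (\<forall>u\<in>V. \<forall>v\<in>V. a u v = a v u) \<and>
     (\<forall>u\<in>V. 0 \<le> a u u \<and> (a u u = 0 \<longrightarrow> u = (\<lambda>_. 0)))"

text \<open>A finite \<open>P\<close> encodes finite dimension without reference to a basis: a pair
  \<open>(x, b)\<close> stands for the nodal functional evaluating the component along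
  \<open>b\<close> at \<open>x\<close>, and these functionals separate the elements of
  \<open>V\<close>.\<close>

definition determined_by :: "('a \<Rightarrow> 'b::real_inner) set \<Rightarrow> ('a \<times> 'b) set \<Rightarrow> bool" where
  "determined_by V P \<longleftrightarrow> (\<forall>u\<in>V. (\<forall>(x, b)\<in>P. u x \<bullet> b = 0) \<longrightarrow> u = (\<lambda>_. 0))"

definition orthonormal_basis ::
    "('a \<Rightarrow> 'b::real_vector) set \<Rightarrow> (('a \<Rightarrow> 'b) \<Rightarrow> ('a \<Rightarrow> 'b) \<Rightarrow> real) \<Rightarrow> ('a \<Rightarrow> 'b) set \<Rightarrow> bool" where
  "orthonormal_basis V a B \<longleftrightarrow> finite B \<and> B \<subseteq> V \<and>
     (\<forall>e\<in>B. \<forall>e'\<in>B. a e e' = (if e = e' then 1 else 0)) \<and>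
     (\<forall>u\<in>V. u = (\<lambda>x. \<Sum>e\<in>B. a u e *\<^sub>R e x))"

lemma function_subspaceD:
  assumes "function_subspace V"
  shows function_subspace_zero: "(\<lambda>_. 0) \<in> V"
    and function_subspace_add: "u \<in> V \<Longrightarrow> v \<in> V \<Longrightarrow> (\<lambda>x. u x + v x) \<in> V"
    and function_subspace_scale: "u \<in> V \<Longrightarrow> (\<lambda>x. c *\<^sub>R u x) \<in> V"
  using assms by (auto simp: function_subspace_def)

lemma function_subspace_diff:
  assumes "function_subspace V" "u \<in> V" "v \<in> V"
  shows "(\<lambda>x. u x - v x) \<in> V"
  using function_subspace_add[OF assms(1,2) function_subspace_scale[OF assms(1,3), of "-1"]] by simp

lemma function_subspace_sum:
  assumes V: "function_subspace V" and "finite B" "\<And>e. e \<in> B \<Longrightarrow> w e \<in> V"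
  shows "(\<lambda>x. \<Sum>e\<in>B. c e *\<^sub>R w e x) \<in> V"
  using assms(2,3)
  by (induction B) (auto intro!: function_subspaceD[OF V])

lemma linear_map_on_add: "linear_map_on V l \<Longrightarrow> u \<in> V \<Longrightarrow> v \<in> V \<Longrightarrow> l (\<lambda>x. u x + v x) = l u + l v"
  and linear_map_on_scale: "linear_map_on V l \<Longrightarrow> u \<in> V \<Longrightarrow> l (\<lambda>x. c *\<^sub>R u x) = c *\<^sub>R l u"
  by (auto simp: linear_map_on_def)

lemma linear_map_on_diff:
  assumes "function_subspace V" "linear_map_on V l" "u \<in> V" "v \<in> V"
  shows "l (\<lambda>x. u x - v x) = l u - l v"
  using linear_map_on_add[OF assms(2,3) function_subspace_scale[OF assms(1,4), of "-1"]]
    linear_map_on_scale[OF assms(2,4), of "-1"] by simp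

lemma linear_map_on_zero:
  assumes "function_subspace V" "linear_map_on V l"
  shows "l (\<lambda>_. 0) = 0"
  using linear_map_on_scale[OF assms(2) function_subspace_zero[OF assms(1)], of 0] by simp

lemma linear_map_on_sum:
  assumes V: "function_subspace V" and l: "linear_map_on V l" and "finite B" "\<And>e. e \<in> B \<Longrightarrow> w e \<in> V"
  shows "l (\<lambda>x. \<Sum>e\<in>B. c e *\<^sub>R w e x) = (\<Sum>e\<in>B. c e *\<^sub>R l (w e))"
  using assms(3,4)
proof (induction B)
  case empty then show ?case using linear_map_on_zero[OF V l] by simp
next
  case (insert e B)
  then show ?case
    using linear_map_on_add[OF l function_subspace_scale[OF V, of "w e" "c e"] function_subspace_sum[OF V insert(1), of w c]]
      linear_map_on_scale[OF l, of "w e" "c e"] by simp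
qed

lemma inner_formD:
  assumes "inner_form V a"
  shows inner_form_linear: "v \<in> V \<Longrightarrow> linear_map_on V (\<lambda>u. a u v)"
    and inner_form_commute: "u \<in> V \<Longrightarrow> v \<in> V \<Longrightarrow> a u v = a v u"
    and inner_form_nonneg: "u \<in> V \<Longrightarrow> 0 \<le> a u u"
    and inner_form_definite: "u \<in> V \<Longrightarrow> a u u = 0 \<Longrightarrow> u = (\<lambda>_. 0)"
  using assms by (auto simp: inner_form_def)

lemma inner_form_linear_right:
  assumes "function_subspace V" "inner_form V a" "u \<in> V"
  shows "linear_map_on V (a u)"
proof -
  have "a u (\<lambda>x. v x + w x) = a u v + a u w" if "v \<in> V" "w \<in> V" for v w
    using that assms linear_map_on_add[OF inner_form_linear[OF assms(2,3)] that]
    by (simp add: inner_form_commute[OF assms(2,3)] function_subspaceD)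
  moreover have "a u (\<lambda>x. c *\<^sub>R v x) = c *\<^sub>R a u v" if "v \<in> V" for v c
    using that assms linear_map_on_scale[OF inner_form_linear[OF assms(2,3)] that]
    by (simp add: inner_form_commute[OF assms(2,3)] function_subspaceD)
  ultimately show ?thesis by (simp add: linear_map_on_def)
qed

text \<open>Gram--Schmidt, adding one nodal functional at a time.\<close>

lemma orthonormal_basis_exists:
  assumes "finite P" "function_subspace V" "inner_form V a" "determined_by V P"
  shows "\<exists>B. orthonormal_basis V a B"
  using assms
proof (induction P arbitrary: V rule: finite_induct)
  case empty
  then have "V = {\<lambda>_. 0}" by (auto simp: determined_by_def function_subspace_def)
  then show ?case by (intro exI[of _ "{}"]) (auto simp: orthonormal_basis_def)
next
  case (insert p P)
  obtain y b where p: "p = (y, b)" by force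
  note V = \<open>function_subspace V\<close> and a = \<open>inner_form V a\<close>
  \<comment> \<open>The kernel of the new functional has codimension at most 1 in \<open>V\<close>
    and is determined by the remaining functionals.\<close>
  define V' where "V' = {u\<in>V. u y \<bullet> b = 0}"
  have V'V: "V' \<subseteq> V" by (auto simp: V'_def)
  have V': "function_subspace V'"
    using V by (auto simp: V'_def function_subspace_def inner_add_left)
  have "inner_form V' a" using a V'V by (auto simp: inner_form_def linear_map_on_def subset_iff)
  moreover have "determined_by V' P"
    using insert.prems by (auto simp: determined_by_def V'_def p)
  ultimately obtain B where "orthonormal_basis V' a B"
    using insert.IH[OF V'] by blast
  then have B: "finite B" "B \<subseteq> V'" "\<And>e e'. e \<in> B \<Longrightarrow> e' \<in> B \<Longrightarrow> a e e' = (if e = e' then 1 else 0)"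
    "\<And>u. u \<in> V' \<Longrightarrow> u = (\<lambda>x. \<Sum>e\<in>B. a u e *\<^sub>R e x)"
    by (auto simp: orthonormal_basis_def)
  have BV: "B \<subseteq> V" using B(2) V'V by blast
  show ?case
  proof (cases "V' = V")
    case True
    with \<open>orthonormal_basis V' a B\<close> show ?thesis by auto
  next
    case False
    then obtain w where w: "w \<in> V" "w y \<bullet> b \<noteq> 0" by (auto simp: V'_def)
    define w' where "w' x = w x - (\<Sum>e\<in>B. a w e *\<^sub>R e x)" for x
    have w'V: "w' \<in> V"
      using function_subspace_diff[OF V w(1) function_subspace_sum[OF V B(1), of "\<lambda>e. e" "a w"]] BV
      unfolding w'_def by auto
    \<comment> \<open>The subtracted projection lies in the kernel \<open>V'\<close>, so the
      functional keeps its nonzero value at \<open>w'\<close>, which therefore is not the zero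
      function.\<close>
    have lw': "w' y \<bullet> b = w y \<bullet> b"
      using B(2) by (auto simp: w'_def inner_diff_left inner_sum_left V'_def intro!: sum.neutral)
    have orth: "a w' e = 0" if e: "e \<in> B" for e
    proof -
      have eV: "e \<in> V" using e BV by auto
      have "a (\<lambda>x. \<Sum>e'\<in>B. a w e' *\<^sub>R e' x) e = (\<Sum>e'\<in>B. a w e' *\<^sub>R a e' e)"
        using linear_map_on_sum[OF V inner_form_linear[OF a eV] B(1), of "\<lambda>e. e" "a w"] BV by auto
      also have "\<dots> = (\<Sum>e'\<in>B. if e' = e then a w e' else 0)"
        using B(3) e by (intro sum.cong) auto
      also have "\<dots> = a w e" using e B(1) by simp
      finally show ?thesis
        using linear_map_on_diff[OF V inner_form_linear[OF a eV] w(1) function_subspace_sum[OF V B(1), of "\<lambda>e. e" "a w"]] BV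
        unfolding w'_def by auto
    qed
    define n where "n = sqrt (a w' w')"
    have "w' \<noteq> (\<lambda>_. 0)" using w(2) lw' by auto
    then have "a w' w' > 0"
      using inner_form_nonneg[OF a w'V] inner_form_definite[OF a w'V] by fastforce
    then have n: "n > 0" "n * n = a w' w'" by (auto simp: n_def)
    define f where "f x = inverse n *\<^sub>R w' x" for x
    have fV: "f \<in> V" unfolding f_def by (rule function_subspace_scale[OF V w'V])
    have fe: "a f v = inverse n * a w' v" if "v \<in> V" for v
      unfolding f_def using linear_map_on_scale[OF inner_form_linear[OF a that] w'V] by simp
    have fe': "a v f = inverse n * a v w'" if "v \<in> V" for v
      using fe[OF that] inner_form_commute[OF a that] fV w'V by simp
    have ff: "a f f = 1"
    proof -
      have "a f f = inverse n * (inverse n * (n * n))" using fe[OF fV] fe'[OF w'V] n(2) by simp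
      then show ?thesis using n(1) by (simp add: mult.assoc[symmetric])
    qed
    have ly: "f y \<bullet> b \<noteq> 0" using n w(2) lw' by (simp add: f_def)
    have fB: "f \<notin> B" using ly B(2) by (auto simp: V'_def)
    have fe0: "a f e = 0" "a e f = 0" if "e \<in> B" for e
    proof -
      have "e \<in> V" using that BV by auto
      then show "a f e = 0" "a e f = 0"
        using fe orth[OF that] inner_form_commute[OF a fV] by auto
    qed
    have "u = (\<lambda>x. \<Sum>e\<in>insert f B. a u e *\<^sub>R e x)" if u: "u \<in> V" for u
    proof -
      \<comment> \<open>With this coefficient \<open>u - c f\<close> falls into the kernel
        \<open>V'\<close>, where the old basis expands it. Since \<open>f\<close> is orthogonal to
        the old basis, \<open>c\<close> is also the Fourier coefficient
        \<open>a u f\<close>.\<close>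
      define c where "c = u y \<bullet> b / (f y \<bullet> b)"
      define v where "v x = u x - c *\<^sub>R f x" for x
      have cfV: "(\<lambda>x. c *\<^sub>R f x) \<in> V" by (rule function_subspace_scale[OF V fV])
      have vV: "v \<in> V" unfolding v_def by (rule function_subspace_diff[OF V u cfV])
      have "v \<in> V'" using vV ly by (auto simp: V'_def v_def c_def inner_diff_left)
      note vB = B(4)[OF this]
      have uv: "u = (\<lambda>x. v x + c *\<^sub>R f x)" by (simp add: v_def)
      have au: "a u e = a v e + c * a f e" if "e \<in> V" for e
        using linear_map_on_add[OF inner_form_linear[OF a that] vV cfV]
          linear_map_on_scale[OF inner_form_linear[OF a that] fV, of c] uv by simp
      have "a v f = a (\<lambda>x. \<Sum>e\<in>B. a v e *\<^sub>R e x) f" by (rule arg_cong[OF vB])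
      also have "\<dots> = (\<Sum>e\<in>B. a v e *\<^sub>R a e f)"
        by (rule linear_map_on_sum[OF V inner_form_linear[OF a fV] B(1)]) (use BV in auto)
      also have "\<dots> = 0" using fe0 by simp
      finally have "a u f = c" using au[OF fV] ff by simp
      moreover have "a u e = a v e" if "e \<in> B" for e
        using au[of e] fe0[OF that] that BV by auto
      ultimately have "(\<Sum>e\<in>insert f B. a u e *\<^sub>R e x) = u x" for x
        using fB B(1) fun_cong[OF vB, of x] by (simp add: v_def algebra_simps)
      then show ?thesis by auto
    qed
    then have "orthonormal_basis V a (insert f B)"
      using B(1,3) BV fV ff fe0 fB by (auto simp: orthonormal_basis_def)
    then show ?thesis by blast
  qed
qed

text \<open>In an orthonormal basis the representing element is explicit, with coefficients
  \<open>l e\<close>; two solutions differ by an element of zero form value.\<close>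

lemma Riesz_exists_unique:
  assumes V: "function_subspace V" and a: "inner_form V a" and P: "finite P" "determined_by V P"
    and l: "linear_map_on V (l :: _ \<Rightarrow> real)"
  shows "\<exists>!u. u \<in> V \<and> (\<forall>v\<in>V. a u v = l v)"
proof (rule ex_ex1I)
  obtain B where "orthonormal_basis V a B" using orthonormal_basis_exists[OF P(1) V a P(2)] by blast
  then have B: "finite B" "B \<subseteq> V" "\<And>e e'. e \<in> B \<Longrightarrow> e' \<in> B \<Longrightarrow> a e e' = (if e = e' then 1 else 0)"
    "\<And>u. u \<in> V \<Longrightarrow> u = (\<lambda>x. \<Sum>e\<in>B. a u e *\<^sub>R e x)"
    by (auto simp: orthonormal_basis_def)
  define u where "u x = (\<Sum>e\<in>B. l e *\<^sub>R e x)" for x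
  have uV: "u \<in> V" unfolding u_def using B(2) by (intro function_subspace_sum[OF V B(1)]) auto
  have "a u v = l v" if v: "v \<in> V" for v
  proof -
    have "a u v = (\<Sum>e\<in>B. l e *\<^sub>R a e v)"
      unfolding u_def using linear_map_on_sum[OF V inner_form_linear[OF a v] B(1), of "\<lambda>e. e" l] B(2) by auto
    also have "\<dots> = (\<Sum>e\<in>B. a v e *\<^sub>R l e)"
      using inner_form_commute[OF a v] B(2) by (intro sum.cong) (auto simp: subset_iff)
    also have "\<dots> = l (\<lambda>x. \<Sum>e\<in>B. a v e *\<^sub>R e x)"
      by (rule linear_map_on_sum[OF V l B(1), symmetric]) (use B(2) in auto)
    also have "\<dots> = l v" by (rule arg_cong[OF B(4)[OF v], symmetric])
    finally show ?thesis .
  qed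
  with uV show "\<exists>u. u \<in> V \<and> (\<forall>v\<in>V. a u v = l v)" by blast
  fix u w assume u: "u \<in> V \<and> (\<forall>v\<in>V. a u v = l v)" and w: "w \<in> V \<and> (\<forall>v\<in>V. a w v = l v)"
  have d: "(\<lambda>x. u x - w x) \<in> V" using function_subspace_diff[OF V] u w by blast
  have "a (\<lambda>x. u x - w x) (\<lambda>x. u x - w x) = 0"
    using linear_map_on_diff[OF V inner_form_linear[OF a d]] u w d by simp
  then have "(\<lambda>x. u x - w x) = (\<lambda>_. 0)" by (rule inner_form_definite[OF a d])
  then show "u = w" by (auto simp: fun_eq_iff)
qed

section \<open>The finite element space\<close>

lemma lipschitz_domainD:
  assumes "lipschitz_domain \<Omega>"
  shows "open \<Omega>" "connected \<Omega>" "bounded \<Omega>" "\<Omega> \<noteq> {}"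
  using assms by (auto simp: lipschitz_domain_def)

lemma meshD:
  assumes "mesh \<Omega> h \<T>"
  shows "finite \<T>" "K \<in> \<T> \<Longrightarrow> 2 simplex K" "\<Union>\<T> = closure \<Omega>"
  using assms by (auto simp: mesh_def triangulation_def)

lemma P1_spaceD:
  assumes "v \<in> P1_space \<Omega> \<Gamma>\<^sub>0 \<T>"
  shows "v \<in> H1_space \<Omega>" "continuous_on (closure \<Omega>) v"
    "K \<in> \<T> \<Longrightarrow> \<exists>A b. \<forall>x\<in>K. v x = A *v x + b"
    "x \<in> \<Gamma>\<^sub>0 \<Longrightarrow> v x = 0" "x \<notin> closure \<Omega> \<Longrightarrow> v x = 0"
  using assms by (auto simp: P1_space_def)

lemma function_subspace_P1:
  assumes \<Omega>: "open \<Omega>" "bounded \<Omega>"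
  shows "function_subspace (P1_space \<Omega> \<Gamma>\<^sub>0 \<T>)"
proof -
  have zero: "(\<lambda>_. 0) \<in> P1_space \<Omega> \<Gamma>\<^sub>0 \<T>"
  proof -
    have "(\<lambda>_. 0) \<in> L2_space (lebesgue_on \<Omega>)" "is_weak_gradient \<Omega> (\<lambda>_. 0) (\<lambda>_. 0)"
      "(\<lambda>_. 0 :: real^2^2) \<in> L2_space (lebesgue_on \<Omega>)"
      by (auto simp: L2_space_def is_weak_gradient_def)
    then have "(\<lambda>_. 0) \<in> H1_space \<Omega>" unfolding H1_space_def by blast
    moreover have "\<exists>A b. \<forall>x\<in>K. (0::real^2) = A *v x + b" for K :: "(real^2) set"
      by (rule exI[of _ 0], rule exI[of _ 0]) simp
    ultimately show ?thesis by (simp add: P1_space_def)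
  qed
  have lin: "(\<lambda>x. a *\<^sub>R u x + b *\<^sub>R v x) \<in> P1_space \<Omega> \<Gamma>\<^sub>0 \<T>"
    if u: "u \<in> P1_space \<Omega> \<Gamma>\<^sub>0 \<T>" and v: "v \<in> P1_space \<Omega> \<Gamma>\<^sub>0 \<T>" for u v a b
  proof -
    note u' = P1_spaceD[OF u] and v' = P1_spaceD[OF v]
    have "\<exists>A c. \<forall>x\<in>K. a *\<^sub>R u x + b *\<^sub>R v x = A *v x + c" if K: "K \<in> \<T>" for K
    proof -
      obtain A c where A: "\<forall>x\<in>K. u x = A *v x + c" using u'(3)[OF K] by (elim exE)
      obtain B d where B: "\<forall>x\<in>K. v x = B *v x + d" using v'(3)[OF K] by (elim exE)
      have "\<forall>x\<in>K. a *\<^sub>R u x + b *\<^sub>R v x = (a *\<^sub>R A + b *\<^sub>R B) *v x + (a *\<^sub>R c + b *\<^sub>R d)"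
        using A B by (simp add: matrix_vector_mult_add_rdistrib scaleR_matrix_vector_assoc algebra_simps)
      then show ?thesis by (intro exI)
    qed
    moreover have "(\<lambda>x. a *\<^sub>R u x + b *\<^sub>R v x) \<in> H1_space \<Omega>" by (rule H1_space_linear[OF \<Omega> u'(1) v'(1)])
    moreover have "continuous_on (closure \<Omega>) (\<lambda>x. a *\<^sub>R u x + b *\<^sub>R v x)"
      by (intro continuous_intros u' v')
    ultimately show ?thesis using u'(4,5) v'(4,5) by (simp add: P1_space_def)
  qed
  show ?thesis
    unfolding function_subspace_def using zero lin[of _ _ 1 1] lin[of _ _ _ 0, OF _ zero] by simp
qed

lemma affine_zero_on_convex_hull:
  fixes A :: "real^'n^'m"
  assumes "\<And>x. x \<in> C \<Longrightarrow> A *v x + b = 0" "x \<in> convex hull C"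
  shows "A *v x + b = 0"
proof -
  have "convex {x. A *v x + b = 0}"
  proof (rule convexI, clarify)
    fix x y and s t :: real assume xy: "A *v x + b = 0" "A *v y + b = 0" and st: "0 \<le> s" "0 \<le> t" "s + t = 1"
    have "A *v (s *\<^sub>R x + t *\<^sub>R y) + b = s *\<^sub>R (A *v x) + t *\<^sub>R (A *v y) + (s + t) *\<^sub>R b"
      using st(3) by (simp add: matrix_vector_right_distrib matrix_vector_mult_scaleR)
    also have "\<dots> = s *\<^sub>R (A *v x + b) + t *\<^sub>R (A *v y + b)" by (simp add: algebra_simps)
    finally show "A *v (s *\<^sub>R x + t *\<^sub>R y) + b = 0" using xy by simp
  qed
  then have "convex hull C \<subseteq> {x. A *v x + b = 0}"
    using assms(1) by (intro hull_minimal) auto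
  then show ?thesis using assms(2) by auto
qed

text \<open>On each triangle the field is affine, hence zero as soon as it vanishes at the vertices.
  Outside the closed domain it is zero by convention, so the finitely many vertex values decide it
  on the whole plane.\<close>

lemma P1_determined_by_vertices:
  assumes mesh: "mesh \<Omega> h \<T>"
  shows "\<exists>P. finite P \<and> determined_by (P1_space \<Omega> \<Gamma>\<^sub>0 \<T>) P"
proof -
  note m = meshD[OF mesh]
  have "\<forall>K\<in>\<T>. \<exists>C. finite C \<and> K = convex hull C"
    using m(2) unfolding simplex by meson
  from bchoice[OF this] obtain C where C: "\<forall>K\<in>\<T>. finite (C K) \<and> K = convex hull (C K)" ..
  define P where "P = (\<Union>K\<in>\<T>. C K) \<times> (Basis :: (real^2) set)"
  have "finite P" using C m(1) by (auto simp: P_def)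
  moreover have "determined_by (P1_space \<Omega> \<Gamma>\<^sub>0 \<T>) P"
    unfolding determined_by_def
  proof (intro ballI impI ext)
    fix u x assume u: "u \<in> P1_space \<Omega> \<Gamma>\<^sub>0 \<T>" and z: "\<forall>(x, b)\<in>P. u x \<bullet> b = 0"
    have zC: "u y = 0" if "K \<in> \<T>" "y \<in> C K" for K y
    proof -
      have "u y \<bullet> b = 0" if "b \<in> Basis" for b
        using z \<open>K \<in> \<T>\<close> \<open>y \<in> C K\<close> that by (fastforce simp: P_def)
      then show ?thesis by (simp add: euclidean_eq_iff[of "u y"])
    qed
    show "u x = 0"
    proof (cases "x \<in> closure \<Omega>")
      case True
      then obtain K where K: "K \<in> \<T>" "x \<in> K" using m(3) by blast
      obtain A b where A: "\<forall>x\<in>K. u x = A *v x + b" using P1_spaceD(3)[OF u K(1)] by (elim exE)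
      have hull: "K = convex hull (C K)" using C K(1) by blast
      have sub: "C K \<subseteq> K" using hull_subset[of "C K" convex] unfolding hull[symmetric] .
      have "A *v x + b = 0"
      proof (rule affine_zero_on_convex_hull)
        show "x \<in> convex hull (C K)" using K(2) hull by simp
        show "A *v y + b = 0" if "y \<in> C K" for y
          using zC[OF K(1) that] A sub that by (metis subsetD)
      qed
      then show ?thesis using A K(2) by simp
    qed (rule P1_spaceD(5)[OF u])
  qed
  ultimately show ?thesis by blast
qed

lemma interior_2simplex:
  fixes K :: "(real^2) set"
  assumes "2 simplex K"
  shows "interior K \<noteq> {}"
proof -
  have c: "convex K" using assms by (rule convex_simplex)
  have d: "aff_dim K = 2" using assms by (rule aff_dim_simplex)
  then have ne: "K \<noteq> {}" by auto
  have "affine hull K = UNIV" using d by (simp add: aff_dim_eq_full[symmetric])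
  then have "rel_interior K = interior K" by (rule rel_interior_interior)
  then show ?thesis using rel_interior_eq_empty[OF c] ne by simp
qed

text \<open>The triangles fill the closure of \<open>\<Omega>\<close> only, but an open set that
  meets the closure meets \<open>\<Omega>\<close> itself.\<close>

lemma interior_triangle_meets_domain:
  assumes mesh: "mesh \<Omega> h \<T>" and K: "K \<in> \<T>"
  shows "interior K \<inter> \<Omega> \<noteq> {}"
proof -
  note m = meshD[OF mesh]
  obtain x where x: "x \<in> interior K" using interior_2simplex[OF m(2)[OF K]] by blast
  then have "x \<in> closure \<Omega>" using interior_subset[of K] m(3) K by blast
  then show ?thesis using x open_Int_closure_eq_empty[OF open_interior, of K \<Omega>] by auto
qed

section \<open>Finite element fields with vanishing strain\<close>

lemma skew_matrix_components:
  fixes A :: "real^2^2"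
  assumes "A + transpose A = 0"
  shows "A $ 1 $ 1 = 0" "A $ 2 $ 2 = 0" "A $ 2 $ 1 = - A $ 1 $ 2"
proof -
  have e: "A $ i $ j + A $ j $ i = 0" for i j
    using arg_cong[OF assms, of "\<lambda>B. B $ i $ j"] by (simp add: transpose_def)
  show "A $ 1 $ 1 = 0" "A $ 2 $ 2 = 0" "A $ 2 $ 1 = - A $ 1 $ 2"
    using e[of 1 1] e[of 2 2] e[of 2 1] by simp_all
qed

lemma skew_matrix_inner:
  fixes A :: "real^2^2"
  assumes "A + transpose A = 0"
  shows "(A *v z) \<bullet> z = 0"
  using skew_matrix_components[OF assms]
  by (simp add: inner_vec_def sum_2 matrix_vector_mult_def algebra_simps)

text \<open>On the interior of the triangle within \<open>\<Omega>\<close> the weak gradient is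
  \<open>A\<close> almost everywhere, and the strain is its symmetric part.\<close>

lemma P1_strain_zero_skew:
  assumes h: "smooth_step \<sigma>" and \<Omega>: "open \<Omega>" "bounded \<Omega>" and mesh: "mesh \<Omega> h \<T>"
    and u: "u \<in> P1_space \<Omega> \<Gamma>\<^sub>0 \<T>" and K: "K \<in> \<T>" and A: "\<forall>x\<in>K. u x = A *v x + b"
    and strain: "AE x in lebesgue_on \<Omega>. strain \<Omega> u x = 0"
  shows "A + transpose A = 0"
proof -
  define W where "W = interior K \<inter> \<Omega>"
  have W: "open W" "W \<subseteq> \<Omega>" "W \<subseteq> K" using \<Omega>(1) interior_subset[of K] by (auto simp: W_def)
  have "W \<noteq> {}" unfolding W_def by (rule interior_triangle_meets_domain[OF mesh K])
  note M = finite_measure_lebesgue_on_open_bounded[OF \<Omega>]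
  have Ws: "W \<in> sets lebesgue" using W(1) by auto
  have "AE x in lebesgue_on W. weak_grad \<Omega> u x = A"
    using A W(3) by (intro weak_grad_affine_on[OF h \<Omega> P1_spaceD(1)[OF u] W(1,2), of A b]) auto
  then have 1: "AE x in lebesgue. x \<in> W \<longrightarrow> weak_grad \<Omega> u x = A"
    using Ws by (simp add: AE_restrict_space_iff)
  have 2: "AE x in lebesgue. x \<in> \<Omega> \<longrightarrow> strain \<Omega> u x = 0"
    using strain M(1) by (simp add: AE_restrict_space_iff)
  \<comment> \<open>A nonempty open set is not null, so the two a.e. properties share a point in
    \<open>W\<close>.\<close>
  have "\<exists>x\<in>W. weak_grad \<Omega> u x = A \<and> strain \<Omega> u x = 0"
  proof (rule ccontr)
    assume n: "\<not> ?thesis"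
    from 1 2 have "AE x in lebesgue. x \<notin> W"
      by eventually_elim (use n W(2) in blast)
    then have "W \<in> null_sets lebesgue" using Ws by (subst AE_iff_null_sets) auto
    then have "negligible W" by (simp add: negligible_iff_null_sets)
    then show False using open_not_negligible[OF W(1) \<open>W \<noteq> {}\<close>] by simp
  qed
  then show ?thesis by (auto simp: strain_def)
qed

text \<open>Along the segment the component of \<open>v\<close> in the direction of the segment is
  constant on each triangle, because skew matrices have zero quadratic form. A continuous function
  on an interval with finitely many values is constant, so there is no need to follow how the
  segment crosses the mesh.\<close>

lemma skew_piecewise_affine_segment:
  fixes v :: "real^2 \<Rightarrow> real^2"
  assumes T: "finite \<T>" and c: "continuous_on (closed_segment y x) v" and sub: "closed_segment y x \<subseteq> \<Union>\<T>"
    and A: "\<forall>K\<in>\<T>. \<exists>A b. A + transpose A = 0 \<and> (\<forall>z\<in>K. v z = A *v z + b)"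
  shows "(v x - v y) \<bullet> (x - y) = 0"
proof -
  obtain A where "\<forall>K\<in>\<T>. \<exists>b. A K + transpose (A K) = 0 \<and> (\<forall>z\<in>K. v z = A K *v z + b)"
    using bchoice[OF A] ..
  from bchoice[OF this] obtain b where Ab: "\<forall>K\<in>\<T>. A K + transpose (A K) = 0 \<and> (\<forall>z\<in>K. v z = A K *v z + b K)" ..
  define d where "d = x - y"
  define H where "H t = v (y + t *\<^sub>R d) \<bullet> d" for t
  have seg: "y + t *\<^sub>R d \<in> closed_segment y x" if "t \<in> {0..1}" for t
    using that unfolding closed_segment_def by (auto intro!: exI[of _ t] simp: d_def algebra_simps)
  have "continuous_on {0..1} (\<lambda>t. v (y + t *\<^sub>R d))"
    by (rule continuous_on_compose2[OF c]) (use seg in \<open>auto intro!: continuous_intros\<close>)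
  then have Hc: "continuous_on {0..1} H" unfolding H_def by (intro continuous_intros)
  have "H ` {0..1} \<subseteq> (\<lambda>K. (A K *v y + b K) \<bullet> d) ` \<T>"
  proof
    fix s assume "s \<in> H ` {0..1}"
    then obtain t where t: "t \<in> {0..1}" "s = H t" by auto
    then obtain K where K: "K \<in> \<T>" "y + t *\<^sub>R d \<in> K" using seg sub by blast
    have sk: "A K + transpose (A K) = 0" and af: "v (y + t *\<^sub>R d) = A K *v (y + t *\<^sub>R d) + b K" using Ab K by auto
    have "H t = (A K *v y + b K) \<bullet> d + t * ((A K *v d) \<bullet> d)"
      by (simp add: H_def af matrix_vector_right_distrib matrix_vector_mult_scaleR inner_add_left)
    then have "s = (A K *v y + b K) \<bullet> d" using skew_matrix_inner[OF sk] t(2) by simp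
    then show "s \<in> (\<lambda>K. (A K *v y + b K) \<bullet> d) ` \<T>" using K(1) by (rule image_eqI)
  qed
  then have "finite (H ` {0..1})" using T by (rule finite_subset[OF _ finite_imageI])
  then have "H constant_on {0..1}"
    by (intro continuous_finite_range_constant Hc) auto
  then have "H 0 = H 1" unfolding constant_on_def by (metis atLeastAtMost_iff order_refl zero_le_one)
  then show ?thesis by (simp add: H_def d_def inner_diff_left)
qed

text \<open>A continuous field that is infinitesimally rigid on every triangle satisfies
  \<open>(v z - v w) \<bullet> (z - w) = 0\<close> along segments, which lets the zero set spread over \<open>\<Omega>\<close>.\<close>

lemma rigid_unique_continuation:
  fixes v :: "real^2 \<Rightarrow> real^2"
  assumes \<Omega>: "open \<Omega>" "connected \<Omega>" and c: "continuous_on (closure \<Omega>) v"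
    and T: "finite \<T>" "\<Union>\<T> = closure \<Omega>"
    and A: "\<forall>K\<in>\<T>. \<exists>A b. A + transpose A = 0 \<and> (\<forall>z\<in>K. v z = A *v z + b)"
    and W: "open W" "W \<noteq> {}" "W \<subseteq> \<Omega>" "\<And>x. x \<in> W \<Longrightarrow> v x = 0" and x: "x \<in> closure \<Omega>"
  shows "v x = 0"
proof -
  define U where "U = interior {x\<in>\<Omega>. v x = 0}"
  have U0: "x \<in> \<Omega>" "v x = 0" if "x \<in> U" for x
    using that interior_subset[of "{x\<in>\<Omega>. v x = 0}"] by (auto simp: U_def)
  \<comment> \<open>The interior \<open>U\<close> of the zero set is relatively closed in
    \<open>\<Omega>\<close>; connectedness then gives everything.\<close>
  have key: "x \<in> U" if x: "x \<in> \<Omega>" "x \<in> closure U" for x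
  proof -
    obtain r where r: "r > 0" "ball x r \<subseteq> \<Omega>" using \<Omega>(1) x(1) open_contains_ball by blast
    have "U \<inter> ball x r \<noteq> {}"
      using x(2) r(1) open_Int_closure_eq_empty[OF open_ball, of x r U] by (auto simp: inf_commute)
    then obtain y where y: "y \<in> U \<inter> ball x r" by blast
    have "open (U \<inter> ball x r)" by (simp add: U_def open_Int)
    then obtain e where e: "e > 0" "ball y e \<subseteq> U \<inter> ball x r" using y by (meson open_contains_ball)
    have "v z = 0" if z: "z \<in> ball x r" for z
    proof -
      have orth: "v z \<bullet> (z - w) = 0" if w: "w \<in> ball y e" for w
      proof -
        have wU: "w \<in> U" "w \<in> ball x r" using w e(2) by auto
        have "closed_segment w z \<subseteq> ball x r" using wU(2) z by (intro closed_segment_subset convex_ball)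
        then have seg: "closed_segment w z \<subseteq> closure \<Omega>" using r(2) closure_subset by blast
        have "(v z - v w) \<bullet> (z - w) = 0"
          using seg T(2) by (intro skew_piecewise_affine_segment[OF T(1) continuous_on_subset[OF c] _ A]) auto
        then show ?thesis using U0[OF wU(1)] by simp
      qed
      \<comment> \<open>Comparing orthogonality at \<open>w = y\<close> and at
        \<open>w = y + s *\<^sub>R v z\<close> leaves \<open>s * (v z \<bullet> v z) = 0\<close>.
        The summand 1 keeps the divisor positive, and \<open>s\<close> keeps the shifted point
        within \<open>e / 2\<close> of \<open>y\<close>.\<close>
      define N where "N = norm (v z) + 1"
      define s where "s = e / 2 / N"
      have n1: "0 < N" using norm_ge_zero[of "v z"] unfolding N_def by linarith
      have s: "s > 0" unfolding s_def using e(1) n1 by (intro divide_pos_pos) auto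
      have "norm (s *\<^sub>R v z) = s * norm (v z)" using s by simp
      also have "\<dots> \<le> s * N" using s by (simp add: N_def)
      also have "\<dots> = e / 2" using n1 by (simp add: s_def)
      finally have "y + s *\<^sub>R v z \<in> ball y e" using e(1) by (simp add: dist_norm)
      from orth[OF this] orth[of y] e(1) have "s * (v z \<bullet> v z) = 0"
        by (simp add: inner_diff_right inner_add_right)
      then show ?thesis using s by simp
    qed
    then have "ball x r \<subseteq> {x\<in>\<Omega>. v x = 0}" using r(2) by auto
    then show ?thesis unfolding U_def using r(1) by (intro interiorI[of "ball x r"]) auto
  qed
  have "U \<inter> \<Omega> = {} \<or> (- closure U) \<inter> \<Omega> = {}"
  proof (rule connectedD[OF \<Omega>(2)])
    show "open U" by (simp add: U_def)
    show "open (- closure U)" by (intro open_Compl closed_closure)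
    show "U \<inter> (- closure U) \<inter> \<Omega> = {}" using closure_subset[of U] by auto
    show "\<Omega> \<subseteq> U \<union> (- closure U)" using key by auto
  qed
  moreover have "W \<subseteq> U" unfolding U_def using W by (intro interior_maximal) auto
  ultimately have "\<Omega> \<subseteq> closure U" using W(2,3) by auto
  then have "v x = 0" if "x \<in> \<Omega>" for x using key[OF that] U0 that by auto
  moreover have "closure \<Omega> \<subseteq> {x \<in> closure \<Omega>. v x = 0}"
  proof (rule closure_minimal)
    show "\<Omega> \<subseteq> {x \<in> closure \<Omega>. v x = 0}" using calculation closure_subset by auto
    show "closed {x \<in> closure \<Omega>. v x = 0}"
      using continuous_closed_preimage_constant[OF c closed_closure] by simp
  qed
  ultimately show ?thesis using x by auto
qed

text \<open>A set with at most one point has length zero.\<close>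

lemma positive_length_two_points:
  assumes "0 < emeasure hausdorff1 \<Gamma>" "\<Gamma> \<in> sets borel"
  obtains p q where "p \<in> \<Gamma>" "q \<in> \<Gamma>" "p \<noteq> q"
proof -
  have pos: "0 < hausdorff1_outer \<Gamma>" using assms by (simp add: emeasure_hausdorff1)
  have "\<exists>p\<in>\<Gamma>. \<exists>q\<in>\<Gamma>. p \<noteq> q"
  proof (rule ccontr)
    assume n: "\<not> ?thesis"
    have "\<exists>p. \<Gamma> \<subseteq> {p}"
    proof (cases "\<Gamma> = {}")
      case False
      then obtain p where "p \<in> \<Gamma>" by blast
      then have "\<Gamma> \<subseteq> {p}" using n by blast
      then show ?thesis by blast
    qed simp
    then obtain p where "\<Gamma> \<subseteq> {p}" by blast
    then have "hausdorff1_outer \<Gamma> \<le> 0"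
      using hausdorff1_outer_mono hausdorff1_outer_singleton by metis
    then show False using pos by simp
  qed
  then show thesis using that by blast
qed

text \<open>Zero strain makes \<open>u\<close> a single infinitesimal rigid motion on the closed
  domain. It vanishes at two distinct points of \<open>\<Gamma>\<^sub>0\<close>, and a nonzero skew
  2x2 matrix is injective, so the motion is zero.\<close>

lemma P1_strain_definite:
  assumes h: "smooth_step \<sigma>" and dom: "lipschitz_domain \<Omega>" and mesh: "mesh \<Omega> h \<T>"
    and \<Gamma>: "\<Gamma>\<^sub>0 \<subseteq> frontier \<Omega>" "\<Gamma>\<^sub>0 \<in> sets borel" "0 < emeasure hausdorff1 \<Gamma>\<^sub>0"
    and u: "u \<in> P1_space \<Omega> \<Gamma>\<^sub>0 \<T>" and strain: "AE x in lebesgue_on \<Omega>. strain \<Omega> u x = 0"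
  shows "u = (\<lambda>_. 0)"
proof -
  note \<Omega> = lipschitz_domainD[OF dom] and m = meshD[OF mesh] and u' = P1_spaceD[OF u]
  have skew: "A + transpose A = 0" if "K \<in> \<T>" "\<forall>x\<in>K. u x = A *v x + b" for K A b
    by (rule P1_strain_zero_skew[OF h \<Omega>(1,3) mesh u that strain])
  obtain K0 where K0: "K0 \<in> \<T>" using m(3) \<Omega>(4) closure_subset[of \<Omega>] by fastforce
  obtain A0 b0 where A0: "\<forall>x\<in>K0. u x = A0 *v x + b0" using u'(3)[OF K0] by (elim exE)
  note sk0 = skew[OF K0 A0]
  \<comment> \<open>Subtracting the rigid motion of one triangle yields a field that is zero on an
    open set and still rigid on every triangle, as unique continuation requires.\<close>
  define v where "v x = u x - (A0 *v x + b0)" for x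
  define W where "W = interior K0 \<inter> \<Omega>"
  have "W \<noteq> {}" unfolding W_def by (rule interior_triangle_meets_domain[OF mesh K0])
  have v0: "v x = 0" if x: "x \<in> closure \<Omega>" for x
  proof (rule rigid_unique_continuation[OF \<Omega>(1,2) _ m(1,3) _ _ \<open>W \<noteq> {}\<close> _ _ x])
    show "continuous_on (closure \<Omega>) v" unfolding v_def
      by (intro continuous_intros u' linear_continuous_on matrix_vector_mul_bounded_linear)
    show "open W" using \<Omega>(1) by (simp add: W_def open_Int)
    show "W \<subseteq> \<Omega>" by (simp add: W_def)
    show "v y = 0" if "y \<in> W" for y
      using that A0 interior_subset[of K0] by (auto simp: W_def v_def)
    show "\<forall>K\<in>\<T>. \<exists>A b. A + transpose A = 0 \<and> (\<forall>z\<in>K. v z = A *v z + b)"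
    proof
      fix K assume K: "K \<in> \<T>"
      obtain A b where A: "\<forall>x\<in>K. u x = A *v x + b" using u'(3)[OF K] by (elim exE)
      have "(A - A0) + transpose (A - A0) = (A + transpose A) - (A0 + transpose A0)"
        by (simp add: transpose_def vec_eq_iff)
      then have "(A - A0) + transpose (A - A0) = 0" using skew[OF K A] sk0 by simp
      moreover have "\<forall>z\<in>K. v z = (A - A0) *v z + (b - b0)"
        using A by (simp add: v_def matrix_vector_mult_diff_rdistrib)
      ultimately show "\<exists>A b. A + transpose A = 0 \<and> (\<forall>z\<in>K. v z = A *v z + b)" by blast
    qed
  qed
  obtain p q where pq: "p \<in> \<Gamma>\<^sub>0" "q \<in> \<Gamma>\<^sub>0" "p \<noteq> q" by (rule positive_length_two_points[OF \<Gamma>(3,2)])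
  have cl: "p \<in> closure \<Omega>" "q \<in> closure \<Omega>" using pq(1,2) \<Gamma>(1) by (auto simp: frontier_def)
  have "A0 *v p + b0 = u p - v p" "A0 *v q + b0 = u q - v q"
    by (simp_all add: v_def)
  then have z: "A0 *v p + b0 = 0" "A0 *v q + b0 = 0"
    using v0[OF cl(1)] v0[OF cl(2)] u'(4)[OF pq(1)] u'(4)[OF pq(2)] by simp_all
  have "A0 *v (p - q) = (A0 *v p + b0) - (A0 *v q + b0)"
    by (simp add: matrix_vector_mult_diff_distrib)
  then have "A0 *v (p - q) = 0" unfolding z by simp
  then have "(A0 *v (p - q)) $ 1 = 0" "(A0 *v (p - q)) $ 2 = 0" by simp_all
  then have "A0 $ 1 $ 2 * (p - q) $ 2 = 0" "A0 $ 1 $ 2 * (p - q) $ 1 = 0"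
    using skew_matrix_components[OF sk0] by (simp_all add: matrix_vector_mult_def sum_2)
  moreover have "(p - q) $ 1 \<noteq> 0 \<or> (p - q) $ 2 \<noteq> 0"
    using pq(3) by (auto simp: vec_eq_iff forall_2)
  ultimately have "A0 $ 1 $ 2 = 0" by auto
  then have "A0 = 0" using skew_matrix_components[OF sk0] by (simp add: vec_eq_iff forall_2)
  then have "b0 = 0" using z(1) by simp
  show ?thesis
  proof
    fix x show "u x = 0"
      using v0[of x] u'(5)[of x] \<open>A0 = 0\<close> \<open>b0 = 0\<close> by (cases "x \<in> closure \<Omega>") (simp_all add: v_def)
  qed
qed

section \<open>Linearised elasticity\<close>

lemma L2_space_bounded_linear:
  assumes L: "bounded_linear L" and v: "v \<in> L2_space M"
  shows "(\<lambda>x. L (v x)) \<in> L2_space M"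
proof -
  obtain K where K: "\<And>x. norm (L x) \<le> norm x * K" using bounded_linear.bounded[OF L] by auto
  have m: "(\<lambda>x. L (v x)) \<in> borel_measurable M"
    by (rule measurable_compose[OF L2_space_measurable[OF v] borel_measurable_continuous_onI[OF linear_continuous_on[OF L]]])
  have "integrable M (\<lambda>x. (norm (L (v x)))\<^sup>2)"
  proof (rule Bochner_Integration.integrable_bound)
    show "integrable M (\<lambda>x. (norm (v x))\<^sup>2 * K\<^sup>2)" using L2_space_integrable_square[OF v] by simp
    show "(\<lambda>x. (norm (L (v x)))\<^sup>2) \<in> borel_measurable M" using m by measurable
    show "AE x in M. norm ((norm (L (v x)))\<^sup>2) \<le> norm ((norm (v x))\<^sup>2 * K\<^sup>2)"
    proof (rule AE_I2)
      fix x
      have "(norm (L (v x)))\<^sup>2 \<le> (norm (v x) * K)\<^sup>2" using K by (intro power_mono) auto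
      then show "norm ((norm (L (v x)))\<^sup>2) \<le> norm ((norm (v x))\<^sup>2 * K\<^sup>2)"
        by (simp add: power_mult_distrib)
    qed
  qed
  with m show ?thesis by (simp add: L2_space_def)
qed

lemma linear_sym_part: "linear (\<lambda>A :: real^2^2. (1/2) *\<^sub>R (A + transpose A))"
  by (rule linearI) (simp_all add: vec_eq_iff transpose_def algebra_simps)

lemma strain_L2:
  assumes "v \<in> H1_space \<Omega>"
  shows "strain \<Omega> v \<in> L2_space (lebesgue_on \<Omega>)"
  unfolding strain_def[abs_def]
  using linear_sym_part weak_grad_H1(1)[OF assms]
  by (intro L2_space_bounded_linear[of "\<lambda>A. (1/2) *\<^sub>R (A + transpose A)"]) (simp_all add: linear_conv_bounded_linear)

lemma strain_linear:
  assumes "smooth_step \<sigma>" "open \<Omega>" "bounded \<Omega>" "v \<in> H1_space \<Omega>" "w \<in> H1_space \<Omega>"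
  shows "AE x in lebesgue_on \<Omega>. strain \<Omega> (\<lambda>x. a *\<^sub>R v x + b *\<^sub>R w x) x = a *\<^sub>R strain \<Omega> v x + b *\<^sub>R strain \<Omega> w x"
  using weak_grad_linear[OF assms, of a b]
proof eventually_elim
  case (elim x)
  then show ?case unfolding strain_def by (simp add: vec_eq_iff transpose_def algebra_simps)
qed

section \<open>The weighted elastic energy as a symmetric bilinear form\<close>

lemma trace_eq_inner: "trace A = A \<bullet> mat 1" for A :: "real^'n^'n"
  by (simp add: trace_def inner_vec_def mat_def if_distrib[of "\<lambda>x. _ * x"] cong: if_cong)

lemma elasticity_inner:
  "elasticity lam mu x A \<bullet> B = lam x * ((A \<bullet> mat 1) \<bullet> (B \<bullet> mat 1)) + 2 * (mu x * (A \<bullet> B))"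
  by (simp add: elasticity_def trace_eq_inner inner_add_left inner_commute[of "mat 1" B])

lemma transpose_strain: "transpose (strain \<Omega> v x) = strain \<Omega> v x"
  by (simp add: strain_def vec_eq_iff transpose_def)

text \<open>The weight is kept general: besides \<open>1 - d\<close> it is also a difference of two
  such weights, when the stiffness at two times is compared.\<close>

definition energy ::
    "(real^2) set \<Rightarrow> (real^2 \<Rightarrow> real) \<Rightarrow> (real^2 \<Rightarrow> real) \<Rightarrow> (real^2 \<Rightarrow> real) \<Rightarrow> (real^2 \<Rightarrow> real^2) \<Rightarrow> (real^2 \<Rightarrow> real^2) \<Rightarrow> real" where
  "energy \<Omega> lam mu c u v = (\<integral>x. c x * (elasticity lam mu x (strain \<Omega> u x) \<bullet> strain \<Omega> v x) \<partial>lebesgue_on \<Omega>)"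

text \<open>The reference inner product on the finite element space, independent of damage and time;
  bases and coefficient norms refer to it.\<close>

definition strain_product :: "(real^2) set \<Rightarrow> (real^2 \<Rightarrow> real^2) \<Rightarrow> (real^2 \<Rightarrow> real^2) \<Rightarrow> real" where
  "strain_product \<Omega> u v = (\<integral>x. strain \<Omega> u x \<bullet> strain \<Omega> v x \<partial>lebesgue_on \<Omega>)"

lemma Linf_mult:
  assumes S: "S \<in> sets lebesgue" and "a \<in> Linf S" "b \<in> Linf S"
  shows "(\<lambda>x. a x * b x) \<in> Linf S"
proof -
  have ab: "a \<in> borel_measurable (lebesgue_on S)" "b \<in> borel_measurable (lebesgue_on S)"
    using assms by (auto simp: Linf_space_iff[OF S])
  obtain A where A: "AE x in lebesgue_on S. \<bar>a x\<bar> \<le> A" using assms by (auto simp: Linf_space_iff[OF S])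
  obtain B where B: "AE x in lebesgue_on S. \<bar>b x\<bar> \<le> B" using assms by (auto simp: Linf_space_iff[OF S])
  have "AE x in lebesgue_on S. \<bar>a x * b x\<bar> \<le> A * B"
    using A B by eventually_elim (auto simp: abs_mult intro: mult_mono order_trans[OF abs_ge_zero])
  then show ?thesis using ab by (auto simp: Linf_space_iff[OF S])
qed

lemma L2_space_integrable_inner_Linf:
  fixes v w :: "real^2 \<Rightarrow> 'b::euclidean_space"
  assumes "S \<in> sets lebesgue" "v \<in> L2_space (lebesgue_on S)" "w \<in> L2_space (lebesgue_on S)" "c \<in> Linf S"
  shows "integrable (lebesgue_on S) (\<lambda>x. c x * (v x \<bullet> w x))"
proof -
  obtain C where "AE x in lebesgue_on S. \<bar>c x\<bar> \<le> C" using assms(4) by (auto simp: Linf_space_iff[OF assms(1)])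
  then show ?thesis using assms by (intro L2_space_integrable_inner) (auto simp: Linf_space_iff[OF assms(1)])
qed

lemma energy_integrable:
  assumes S: "\<Omega> \<in> sets lebesgue" and c: "c \<in> Linf \<Omega>" and lm: "lam \<in> Linf \<Omega>" "mu \<in> Linf \<Omega>"
    and u: "u \<in> H1_space \<Omega>" and v: "v \<in> H1_space \<Omega>"
  shows "integrable (lebesgue_on \<Omega>) (\<lambda>x. c x * (elasticity lam mu x (strain \<Omega> u x) \<bullet> strain \<Omega> v x))"
proof -
  note su = strain_L2[OF u] and sv = strain_L2[OF v]
  have tr: "(\<lambda>x. strain \<Omega> w x \<bullet> mat 1) \<in> L2_space (lebesgue_on \<Omega>)" if "w \<in> H1_space \<Omega>" for w
    by (rule L2_space_bounded_linear[OF bounded_linear_inner_left strain_L2[OF that]])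
  have "integrable (lebesgue_on \<Omega>) (\<lambda>x. (c x * lam x) * ((strain \<Omega> u x \<bullet> mat 1) \<bullet> (strain \<Omega> v x \<bullet> mat 1))
      + 2 * ((c x * mu x) * (strain \<Omega> u x \<bullet> strain \<Omega> v x)))"
    by (intro Bochner_Integration.integrable_add integrable_mult_right L2_space_integrable_inner_Linf[OF S]
        tr u v su sv Linf_mult[OF S c] lm)
  then show ?thesis by (simp add: elasticity_inner algebra_simps)
qed

lemma energy_commute: "energy \<Omega> lam mu c u v = energy \<Omega> lam mu c v u"
proof -
  have "elasticity lam mu x A \<bullet> B = elasticity lam mu x B \<bullet> A" for x A B
    by (simp only: elasticity_inner inner_commute[of A B] inner_commute[of "A \<bullet> mat 1"])
  then show ?thesis unfolding energy_def by (simp only:)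
qed

lemma energy_linear:
  assumes h: "smooth_step \<sigma>" and \<Omega>: "open \<Omega>" "bounded \<Omega>" and c: "c \<in> Linf \<Omega>" and lm: "lam \<in> Linf \<Omega>" "mu \<in> Linf \<Omega>"
    and u: "u \<in> H1_space \<Omega>" and w: "w \<in> H1_space \<Omega>" and v: "v \<in> H1_space \<Omega>"
  shows "energy \<Omega> lam mu c (\<lambda>x. a *\<^sub>R u x + b *\<^sub>R w x) v = a * energy \<Omega> lam mu c u v + b * energy \<Omega> lam mu c w v"
proof -
  note S = finite_measure_lebesgue_on_open_bounded(1)[OF \<Omega>]
  note i = energy_integrable[OF S c lm _ v]
  have "energy \<Omega> lam mu c (\<lambda>x. a *\<^sub>R u x + b *\<^sub>R w x) v
    = (\<integral>x. a * (c x * (elasticity lam mu x (strain \<Omega> u x) \<bullet> strain \<Omega> v x))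
        + b * (c x * (elasticity lam mu x (strain \<Omega> w x) \<bullet> strain \<Omega> v x)) \<partial>lebesgue_on \<Omega>)"
    unfolding energy_def
  proof (rule integral_cong_AE)
    show "(\<lambda>x. c x * (elasticity lam mu x (strain \<Omega> (\<lambda>x. a *\<^sub>R u x + b *\<^sub>R w x) x) \<bullet> strain \<Omega> v x)) \<in> borel_measurable (lebesgue_on \<Omega>)"
      by (rule borel_measurable_integrable[OF i[OF H1_space_linear[OF \<Omega> u w]]])
    show "(\<lambda>x. a * (c x * (elasticity lam mu x (strain \<Omega> u x) \<bullet> strain \<Omega> v x))
        + b * (c x * (elasticity lam mu x (strain \<Omega> w x) \<bullet> strain \<Omega> v x))) \<in> borel_measurable (lebesgue_on \<Omega>)"
      by (intro borel_measurable_add borel_measurable_times borel_measurable_const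
          borel_measurable_integrable[OF i[OF u]] borel_measurable_integrable[OF i[OF w]])
    show "AE x in lebesgue_on \<Omega>. c x * (elasticity lam mu x (strain \<Omega> (\<lambda>x. a *\<^sub>R u x + b *\<^sub>R w x) x) \<bullet> strain \<Omega> v x)
      = a * (c x * (elasticity lam mu x (strain \<Omega> u x) \<bullet> strain \<Omega> v x))
        + b * (c x * (elasticity lam mu x (strain \<Omega> w x) \<bullet> strain \<Omega> v x))"
      using strain_linear[OF h \<Omega> u w, of a b]
      by eventually_elim (simp add: elasticity_inner inner_add_left algebra_simps)
  qed
  also have "\<dots> = a * energy \<Omega> lam mu c u v + b * energy \<Omega> lam mu c w v"
    unfolding energy_def
    by (subst Bochner_Integration.integral_add) (simp_all only: integrable_mult_right integral_mult_right_zero i[OF u] i[OF w])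
  finally show ?thesis .
qed

text \<open>Zero first and one half as second coefficient make the elasticity tensor the identity,
  so linearity and symmetry carry over from the energy.\<close>

lemma strain_product_eq_energy: "strain_product \<Omega> u v = energy \<Omega> (\<lambda>_. 0) (\<lambda>_. 1/2) (\<lambda>_. 1) u v"
  by (simp add: strain_product_def energy_def elasticity_inner)

lemma Linf_const: "S \<in> sets lebesgue \<Longrightarrow> (\<lambda>_. c) \<in> Linf S"
  by (subst Linf_space_iff) (auto intro!: exI[of _ "\<bar>c\<bar>"])

lemma Linf_linear:
  assumes S: "S \<in> sets lebesgue" and "u \<in> Linf S" "v \<in> Linf S"
  shows "(\<lambda>x. a * u x + b * v x) \<in> Linf S"
proof -
  have uv: "u \<in> borel_measurable (lebesgue_on S)" "v \<in> borel_measurable (lebesgue_on S)"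
    using assms by (auto simp: Linf_space_iff[OF S])
  obtain A where A: "AE x in lebesgue_on S. \<bar>u x\<bar> \<le> A" using assms by (auto simp: Linf_space_iff[OF S])
  obtain B where B: "AE x in lebesgue_on S. \<bar>v x\<bar> \<le> B" using assms by (auto simp: Linf_space_iff[OF S])
  have "AE x in lebesgue_on S. \<bar>a * u x + b * v x\<bar> \<le> \<bar>a\<bar> * A + \<bar>b\<bar> * B"
    using A B
  proof eventually_elim
    case (elim x)
    have "\<bar>a * u x + b * v x\<bar> \<le> \<bar>a\<bar> * \<bar>u x\<bar> + \<bar>b\<bar> * \<bar>v x\<bar>"
      using abs_triangle_ineq[of "a * u x" "b * v x"] by (simp add: abs_mult)
    also have "\<dots> \<le> \<bar>a\<bar> * A + \<bar>b\<bar> * B" using elim by (intro add_mono mult_left_mono) auto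
    finally show ?case .
  qed
  then show ?thesis using uv by (subst Linf_space_iff[OF S]) (auto intro!: exI[of _ "\<bar>a\<bar> * A + \<bar>b\<bar> * B"])
qed

lemma Linf_diff:
  assumes "S \<in> sets lebesgue" "u \<in> Linf S" "v \<in> Linf S"
  shows "(\<lambda>x. u x - v x) \<in> Linf S"
  using Linf_linear[OF assms, of 1 "-1"] by simp

lemma energy_weight_diff:
  assumes S: "\<Omega> \<in> sets lebesgue" and c: "c \<in> Linf \<Omega>" "c' \<in> Linf \<Omega>" and lm: "lam \<in> Linf \<Omega>" "mu \<in> Linf \<Omega>"
    and u: "u \<in> H1_space \<Omega>" and v: "v \<in> H1_space \<Omega>"
  shows "energy \<Omega> lam mu (\<lambda>x. c x - c' x) u v = energy \<Omega> lam mu c u v - energy \<Omega> lam mu c' u v"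
  unfolding energy_def left_diff_distrib
  by (intro Bochner_Integration.integral_diff energy_integrable[OF S _ lm u v] c)

lemma energy_bound:
  assumes S: "\<Omega> \<in> sets lebesgue" and c: "c \<in> Linf \<Omega>" and C: "AE x in lebesgue_on \<Omega>. \<bar>c x\<bar> \<le> C"
    and lm: "lam \<in> Linf \<Omega>" "mu \<in> Linf \<Omega>" and u: "u \<in> H1_space \<Omega>" and v: "v \<in> H1_space \<Omega>"
  shows "\<bar>energy \<Omega> lam mu c u v\<bar> \<le> C * (\<integral>x. \<bar>elasticity lam mu x (strain \<Omega> u x) \<bullet> strain \<Omega> v x\<bar> \<partial>lebesgue_on \<Omega>)"
proof -
  have "integrable (lebesgue_on \<Omega>) (\<lambda>x. 1 * (elasticity lam mu x (strain \<Omega> u x) \<bullet> strain \<Omega> v x))"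
    by (rule energy_integrable[OF S Linf_const[OF S] lm u v])
  then have i1: "integrable (lebesgue_on \<Omega>) (\<lambda>x. C * \<bar>elasticity lam mu x (strain \<Omega> u x) \<bullet> strain \<Omega> v x\<bar>)" by simp
  have "\<bar>energy \<Omega> lam mu c u v\<bar> \<le> (\<integral>x. \<bar>c x * (elasticity lam mu x (strain \<Omega> u x) \<bullet> strain \<Omega> v x)\<bar> \<partial>lebesgue_on \<Omega>)"
    unfolding energy_def by (rule integral_abs_bound)
  also have "\<dots> \<le> (\<integral>x. C * \<bar>elasticity lam mu x (strain \<Omega> u x) \<bullet> strain \<Omega> v x\<bar> \<partial>lebesgue_on \<Omega>)"
  proof (rule integral_mono_AE[OF _ i1])
    show "integrable (lebesgue_on \<Omega>) (\<lambda>x. \<bar>c x * (elasticity lam mu x (strain \<Omega> u x) \<bullet> strain \<Omega> v x)\<bar>)"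
      using energy_integrable[OF S c lm u v] by (rule integrable_abs)
    show "AE x in lebesgue_on \<Omega>. \<bar>c x * (elasticity lam mu x (strain \<Omega> u x) \<bullet> strain \<Omega> v x)\<bar>
        \<le> C * \<bar>elasticity lam mu x (strain \<Omega> u x) \<bullet> strain \<Omega> v x\<bar>"
      using C by eventually_elim (simp add: abs_mult mult_right_mono)
  qed
  also have "\<dots> = C * (\<integral>x. \<bar>elasticity lam mu x (strain \<Omega> u x) \<bullet> strain \<Omega> v x\<bar> \<partial>lebesgue_on \<Omega>)" by simp
  finally show ?thesis .
qed

text \<open>The lower bounds on the weight and on the elasticity tensor multiply; ellipticity is
  available because strains are symmetric.\<close>

lemma energy_coercive:
  assumes S: "\<Omega> \<in> sets lebesgue" and c: "c \<in> Linf \<Omega>" and k: "AE x in lebesgue_on \<Omega>. k \<le> c x" "0 \<le> k"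
    and lm: "lam \<in> Linf \<Omega>" "mu \<in> Linf \<Omega>"
    and ell: "AE x in lebesgue_on \<Omega>. \<forall>A. transpose A = A \<longrightarrow> e * (norm A)\<^sup>2 \<le> elasticity lam mu x A \<bullet> A" "0 \<le> e"
    and u: "u \<in> H1_space \<Omega>"
  shows "k * e * strain_product \<Omega> u u \<le> energy \<Omega> lam mu c u u"
proof -
  have "k * e * strain_product \<Omega> u u = (\<integral>x. k * e * (strain \<Omega> u x \<bullet> strain \<Omega> u x) \<partial>lebesgue_on \<Omega>)"
    by (simp add: strain_product_def)
  also have "\<dots> \<le> energy \<Omega> lam mu c u u"
    unfolding energy_def
  proof (rule integral_mono_AE)
    have "integrable (lebesgue_on \<Omega>) (\<lambda>x. 1 * (strain \<Omega> u x \<bullet> strain \<Omega> u x))"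
      by (intro L2_space_integrable_inner_Linf[OF S] strain_L2 u Linf_const[OF S])
    then show "integrable (lebesgue_on \<Omega>) (\<lambda>x. k * e * (strain \<Omega> u x \<bullet> strain \<Omega> u x))" by simp
    show "integrable (lebesgue_on \<Omega>) (\<lambda>x. c x * (elasticity lam mu x (strain \<Omega> u x) \<bullet> strain \<Omega> u x))"
      by (rule energy_integrable[OF S c lm u u])
    show "AE x in lebesgue_on \<Omega>. k * e * (strain \<Omega> u x \<bullet> strain \<Omega> u x) \<le> c x * (elasticity lam mu x (strain \<Omega> u x) \<bullet> strain \<Omega> u x)"
      using k(1) ell(1)
    proof eventually_elim
      case (elim x)
      have "e * (strain \<Omega> u x \<bullet> strain \<Omega> u x) \<le> elasticity lam mu x (strain \<Omega> u x) \<bullet> strain \<Omega> u x"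
        using elim(2)[rule_format, OF transpose_strain] by (simp add: power2_norm_eq_inner)
      moreover have "0 \<le> e * (strain \<Omega> u x \<bullet> strain \<Omega> u x)" using ell(2) by simp
      ultimately have "k * (e * (strain \<Omega> u x \<bullet> strain \<Omega> u x)) \<le> c x * (elasticity lam mu x (strain \<Omega> u x) \<bullet> strain \<Omega> u x)"
        using elim(1) k(2) by (intro mult_mono) auto
      then show ?case by (simp add: mult.assoc)
    qed
  qed
  finally show ?thesis .
qed

lemma energy_linear_map_on:
  assumes h: "smooth_step \<sigma>" and \<Omega>: "open \<Omega>" "bounded \<Omega>" and c: "c \<in> Linf \<Omega>" and lm: "lam \<in> Linf \<Omega>" "mu \<in> Linf \<Omega>"
    and V: "V \<subseteq> H1_space \<Omega>" and v: "v \<in> H1_space \<Omega>"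
  shows "linear_map_on V (\<lambda>u. energy \<Omega> lam mu c u v)"
  unfolding linear_map_on_def
proof (intro conjI allI ballI)
  note e = energy_linear[OF h \<Omega> c lm _ _ v]
  show "energy \<Omega> lam mu c (\<lambda>x. u x + w x) v = energy \<Omega> lam mu c u v + energy \<Omega> lam mu c w v"
    if "u \<in> V" "w \<in> V" for u w
    using e[of u w 1 1] that V by (simp add: subset_iff)
  show "energy \<Omega> lam mu c (\<lambda>x. a *\<^sub>R u x) v = a *\<^sub>R energy \<Omega> lam mu c u v" if "u \<in> V" for a u
    using e[of u u a 0] that V by (simp add: subset_iff)
qed

section \<open>Load functionals\<close>

text \<open>Young's inequality \<open>2 * \<delta> * norm (w x) \<le> (norm (w x))\<^sup>2 +
  \<delta> * \<delta>\<close> is integrated. With \<open>\<delta>\<close> the size of the time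
  increment, the squared norm is of order \<open>\<delta>\<close> squared, and the result is linear
  in \<open>\<delta>\<close>.\<close>

lemma integral_norm_le_L2:
  fixes w :: "'a \<Rightarrow> 'b::euclidean_space"
  assumes M: "finite_measure M" and w: "w \<in> L2_space M" and L: "L2_norm M w \<le> L * \<delta>" and \<delta>: "0 < \<delta>"
  shows "(\<integral>x. norm (w x) \<partial>M) \<le> (L\<^sup>2 + measure M (space M)) / 2 * \<delta>"
proof -
  interpret finite_measure M by fact
  have i2: "integrable M (\<lambda>x. (norm (w x))\<^sup>2)" using w by (rule L2_space_integrable_square)
  have "(\<integral>x. norm (w x) \<partial>M) \<le> (\<integral>x. (norm (w x))\<^sup>2 / (2 * \<delta>) + \<delta> / 2 \<partial>M)"
  proof (rule integral_mono)
    show "integrable M (\<lambda>x. norm (w x))" using L2_space_integrable[OF w M] by (rule integrable_norm)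
    show "integrable M (\<lambda>x. (norm (w x))\<^sup>2 / (2 * \<delta>) + \<delta> / 2)" using i2 by simp
    show "norm (w x) \<le> (norm (w x))\<^sup>2 / (2 * \<delta>) + \<delta> / 2" for x
    proof -
      have "0 \<le> (norm (w x) - \<delta>)\<^sup>2" by simp
      then have "2 * \<delta> * norm (w x) \<le> (norm (w x))\<^sup>2 + \<delta> * \<delta>" by (simp add: power2_eq_square algebra_simps)
      then have "norm (w x) \<le> ((norm (w x))\<^sup>2 + \<delta> * \<delta>) / (2 * \<delta>)" using \<delta> by (simp add: le_divide_eq mult.commute)
      also have "\<dots> = (norm (w x))\<^sup>2 / (2 * \<delta>) + \<delta> / 2" using \<delta> by (simp add: field_simps)
      finally show ?thesis .
    qed
  qed
  also have "\<dots> = (L2_norm M w)\<^sup>2 / (2 * \<delta>) + measure M (space M) * (\<delta> / 2)"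
    using i2 by (simp add: L2_norm_def)
  also have "\<dots> \<le> (L * \<delta>)\<^sup>2 / (2 * \<delta>) + measure M (space M) * (\<delta> / 2)"
  proof -
    have "(L2_norm M w)\<^sup>2 \<le> (L * \<delta>)\<^sup>2" using L by (intro power_mono) (simp_all add: L2_norm_def)
    then show ?thesis using \<delta> by (intro add_mono divide_right_mono) auto
  qed
  also have "\<dots> = (L\<^sup>2 + measure M (space M)) / 2 * \<delta>"
    using \<delta> by (simp add: power2_eq_square field_simps)
  finally show ?thesis .
qed

lemma integrable_inner_bounded:
  fixes w e :: "'a \<Rightarrow> 'b::euclidean_space"
  assumes M: "finite_measure M" and w: "w \<in> L2_space M" and e: "e \<in> borel_measurable M" "\<And>x. x \<in> space M \<Longrightarrow> norm (e x) \<le> C"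
  shows "integrable M (\<lambda>x. w x \<bullet> e x)"
proof -
  have "e \<in> L2_space M" by (rule L2_space_bounded[OF M e])
  then show ?thesis using L2_space_integrable_inner[OF w, of e "\<lambda>_. 1" 1] by simp
qed

text \<open>Tested against one bounded field, a load that is Lipschitz with values in square
  integrable functions becomes a real Lipschitz function of time. The case of equal times is
  separate because the preceding estimate needs a positive increment.\<close>

lemma L2_lipschitz_pairing:
  fixes w :: "real \<Rightarrow> 'a \<Rightarrow> 'b::euclidean_space" and e :: "'a \<Rightarrow> 'b"
  assumes M: "finite_measure M" and w: "w \<in> C01_space I (L2_space M) (L2_norm M)"
    and e: "e \<in> borel_measurable M" "\<And>x. x \<in> space M \<Longrightarrow> norm (e x) \<le> C"
  shows "\<exists>K. \<forall>s\<in>I. \<forall>t\<in>I. \<bar>(\<integral>x. w t x \<bullet> e x \<partial>M) - (\<integral>x. w s x \<bullet> e x \<partial>M)\<bar> \<le> K * \<bar>t - s\<bar>"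
proof -
  obtain L where L: "\<And>s t. s \<in> I \<Longrightarrow> t \<in> I \<Longrightarrow> L2_norm M (w s - w t) \<le> L * \<bar>s - t\<bar>"
    and wL: "\<And>t. t \<in> I \<Longrightarrow> w t \<in> L2_space M"
    using w by (auto simp: C01_space_def)
  define C' where "C' = max 0 C"
  have e': "norm (e x) \<le> C'" if "x \<in> space M" for x using e(2)[OF that] by (simp add: C'_def)
  have "\<bar>(\<integral>x. w t x \<bullet> e x \<partial>M) - (\<integral>x. w s x \<bullet> e x \<partial>M)\<bar> \<le> C' * ((L\<^sup>2 + measure M (space M)) / 2) * \<bar>t - s\<bar>"
    if st: "s \<in> I" "t \<in> I" for s t
  proof (cases "s = t")
    case False
    let ?d = "\<lambda>x. w t x - w s x"
    have d: "?d \<in> L2_space M" by (intro L2_space_diff wL st)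
    have di: "integrable M (\<lambda>x. norm (?d x))" using L2_space_integrable[OF d M] by (rule integrable_norm)
    have "(\<integral>x. w t x \<bullet> e x \<partial>M) - (\<integral>x. w s x \<bullet> e x \<partial>M) = (\<integral>x. ?d x \<bullet> e x \<partial>M)"
      unfolding inner_diff_left
      by (intro Bochner_Integration.integral_diff[symmetric] integrable_inner_bounded[OF M wL e] st)
    also have "\<bar>\<dots>\<bar> \<le> (\<integral>x. \<bar>?d x \<bullet> e x\<bar> \<partial>M)" by (rule integral_abs_bound)
    also have "\<dots> \<le> (\<integral>x. C' * norm (?d x) \<partial>M)"
    proof (rule integral_mono)
      show "integrable M (\<lambda>x. \<bar>?d x \<bullet> e x\<bar>)" by (rule integrable_abs[OF integrable_inner_bounded[OF M d e]])
      show "integrable M (\<lambda>x. C' * norm (?d x))" using di by simp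
      show "\<bar>?d x \<bullet> e x\<bar> \<le> C' * norm (?d x)" if "x \<in> space M" for x
      proof -
        have "\<bar>?d x \<bullet> e x\<bar> \<le> norm (?d x) * norm (e x)" by (rule Cauchy_Schwarz_ineq2)
        also have "\<dots> \<le> norm (?d x) * C'" by (intro mult_left_mono e' that) simp
        finally show ?thesis by (simp add: mult.commute)
      qed
    qed
    also have "\<dots> = C' * (\<integral>x. norm (?d x) \<partial>M)" by simp
    also have "\<dots> \<le> C' * ((L\<^sup>2 + measure M (space M)) / 2 * \<bar>t - s\<bar>)"
    proof (intro mult_left_mono integral_norm_le_L2[OF M d])
      show "L2_norm M ?d \<le> L * \<bar>t - s\<bar>" using L[OF st(2,1)] by (simp add: fun_diff_def)
    qed (use False in \<open>simp_all add: C'_def\<close>)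
    finally show ?thesis by (simp add: mult.assoc)
  qed simp
  then show ?thesis by blast
qed

section \<open>Lipschitz dependence of the discrete displacement\<close>

locale discrete_elasticity =
  fixes T \<omega>\<^sub>1 h :: real
    and \<Omega> \<Gamma>\<^sub>0 \<Gamma>\<^sub>2 :: "(real^2) set"
    and \<T> :: "(real^2) set set"
    and lam mu \<eta> :: "real^2 \<Rightarrow> real"
    and f q :: "real \<Rightarrow> real^2 \<Rightarrow> real^2"
  assumes T: "0 < T"
    and dom: "lipschitz_domain \<Omega>"
    and \<Gamma>\<^sub>0: "\<Gamma>\<^sub>0 \<subseteq> frontier \<Omega>" "\<Gamma>\<^sub>0 \<in> sets borel" "0 < emeasure hausdorff1 \<Gamma>\<^sub>0"
    and \<Gamma>\<^sub>2: "\<Gamma>\<^sub>2 \<subseteq> frontier \<Omega>" "\<Gamma>\<^sub>2 \<in> sets borel"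
    and lame: "lam \<in> Linf \<Omega>" "mu \<in> Linf \<Omega>" "uniformly_elliptic \<Omega> lam mu"
    and \<omega>\<^sub>1: "\<omega>\<^sub>1 < 1"
    and kernel: "mollifier_kernel \<eta>"
    and mesh: "mesh \<Omega> h \<T>"
    and f: "f \<in> C01_space {0..T} (L2_space (lebesgue_on \<Omega>)) (L2_norm (lebesgue_on \<Omega>))"
    and q: "q \<in> C01_space {0..T} (L2_space (restrict_space hausdorff1 \<Gamma>\<^sub>2))
                 (L2_norm (restrict_space hausdorff1 \<Gamma>\<^sub>2))"
begin

abbreviation "V \<equiv> P1_space \<Omega> \<Gamma>\<^sub>0 \<T>"

abbreviation "disp \<equiv> discrete_displacement \<Omega> \<Gamma>\<^sub>0 \<Gamma>\<^sub>2 \<T> lam mu f q"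

definition admissible :: "(real^2 \<Rightarrow> real) \<Rightarrow> bool" where
  "admissible d \<longleftrightarrow> d \<in> Linf \<Omega> \<and> (AE x in lebesgue_on \<Omega>. 0 \<le> d x \<and> d x \<le> \<omega>\<^sub>1)"

definition load :: "real \<Rightarrow> (real^2 \<Rightarrow> real^2) \<Rightarrow> real" where
  "load t \<phi> = (\<integral>x. f t x \<bullet> \<phi> x \<partial>lebesgue_on \<Omega>) + (\<integral>x. q t x \<bullet> \<phi> x \<partial>restrict_space hausdorff1 \<Gamma>\<^sub>2)"

lemmas \<Omega> = lipschitz_domainD(1,3)[OF dom]
lemmas M = finite_measure_lebesgue_on_open_bounded[OF \<Omega>]
lemmas V_space = function_subspace_P1[OF \<Omega>, of \<Gamma>\<^sub>0 \<T>]

lemma step: "smooth_step (SOME \<sigma>. smooth_step \<sigma>)"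
  by (rule someI_ex[OF smooth_step_exists[OF kernel]])

lemma V_H1: "V \<subseteq> H1_space \<Omega>"
  using P1_spaceD(1) by blast

lemma V_bounded:
  assumes "e \<in> V"
  shows "\<exists>C. \<forall>x. norm (e x) \<le> C"
proof -
  have "compact (closure \<Omega>)" using \<Omega>(2) by (simp add: compact_closure)
  then have "bounded (e ` closure \<Omega>)"
    by (intro compact_imp_bounded compact_continuous_image P1_spaceD(2)[OF assms])
  then obtain C where C: "\<forall>y\<in>e ` closure \<Omega>. norm y \<le> C" unfolding bounded_iff by (rule exE)
  have "norm (e x) \<le> max 0 C" for x
  proof (cases "x \<in> closure \<Omega>")
    case True
    then have "norm (e x) \<le> C" by (intro bspec[OF C] imageI)
    then show ?thesis by simp
  qed (simp add: P1_spaceD(5)[OF assms])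
  then show ?thesis by blast
qed

text \<open>The loaded part inherits finite length from the boundary; continuous fields are then
  square integrable on it, so no trace inequality is involved.\<close>

lemma \<Gamma>\<^sub>2_finite: "finite_measure (restrict_space hausdorff1 \<Gamma>\<^sub>2)"
proof
  have "emeasure (restrict_space hausdorff1 \<Gamma>\<^sub>2) (space (restrict_space hausdorff1 \<Gamma>\<^sub>2)) = hausdorff1_outer \<Gamma>\<^sub>2"
    using \<Gamma>\<^sub>2(2) by (simp add: emeasure_restrict_space emeasure_hausdorff1 space_restrict_space)
  also have "\<dots> < top"
    by (rule order_le_less_trans[OF hausdorff1_outer_mono[OF \<Gamma>\<^sub>2(1)] hausdorff1_outer_frontier_finite[OF dom]])
  finally show "emeasure (restrict_space hausdorff1 \<Gamma>\<^sub>2) (space (restrict_space hausdorff1 \<Gamma>\<^sub>2)) \<noteq> \<infinity>" by simp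
qed

lemma V_measurable:
  assumes e: "e \<in> V"
  shows "e \<in> borel_measurable (lebesgue_on \<Omega>)" "e \<in> borel_measurable (restrict_space hausdorff1 \<Gamma>\<^sub>2)"
proof -
  show "e \<in> borel_measurable (lebesgue_on \<Omega>)"
    by (rule L2_space_measurable[OF H1_space_L2[OF P1_spaceD(1)[OF e]]])
  have "\<Gamma>\<^sub>2 \<subseteq> closure \<Omega>" using \<Gamma>\<^sub>2(1) by (auto simp: frontier_def)
  then have "continuous_on \<Gamma>\<^sub>2 e" by (rule continuous_on_subset[OF P1_spaceD(2)[OF e]])
  then have "e \<in> borel_measurable (restrict_space borel \<Gamma>\<^sub>2)"
    by (rule borel_measurable_continuous_on_restrict)
  then show "e \<in> borel_measurable (restrict_space hausdorff1 \<Gamma>\<^sub>2)"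
    by (subst measurable_cong_sets[OF sets_restrict_space_cong[OF sets_hausdorff1] refl])
qed

lemma load_linear:
  assumes t: "t \<in> {0..T}"
  shows "linear_map_on V (load t)"
proof -
  have ft: "f t \<in> L2_space (lebesgue_on \<Omega>)" and qt: "q t \<in> L2_space (restrict_space hausdorff1 \<Gamma>\<^sub>2)"
    using f q t by (auto simp: C01_space_def)
  have i: "integrable (lebesgue_on \<Omega>) (\<lambda>x. f t x \<bullet> e x)" "integrable (restrict_space hausdorff1 \<Gamma>\<^sub>2) (\<lambda>x. q t x \<bullet> e x)"
    if e: "e \<in> V" for e
  proof -
    obtain C where C: "\<forall>x. norm (e x) \<le> C" using V_bounded[OF e] by (rule exE)
    show "integrable (lebesgue_on \<Omega>) (\<lambda>x. f t x \<bullet> e x)"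
      by (rule integrable_inner_bounded[OF M(3) ft V_measurable(1)[OF e], of C]) (use C in simp)
    show "integrable (restrict_space hausdorff1 \<Gamma>\<^sub>2) (\<lambda>x. q t x \<bullet> e x)"
      by (rule integrable_inner_bounded[OF \<Gamma>\<^sub>2_finite qt V_measurable(2)[OF e], of C]) (use C in simp)
  qed
  show ?thesis
    using i by (auto simp: linear_map_on_def load_def inner_add_right algebra_simps)
qed

lemma load_lipschitz:
  assumes e: "e \<in> V"
  shows "\<exists>K. \<forall>s\<in>{0..T}. \<forall>t\<in>{0..T}. \<bar>load t e - load s e\<bar> \<le> K * \<bar>t - s\<bar>"
proof -
  obtain C where C: "\<forall>x. norm (e x) \<le> C" using V_bounded[OF e] by (rule exE)
  obtain K1 where K1: "\<forall>s\<in>{0..T}. \<forall>t\<in>{0..T}.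
      \<bar>(\<integral>x. f t x \<bullet> e x \<partial>lebesgue_on \<Omega>) - (\<integral>x. f s x \<bullet> e x \<partial>lebesgue_on \<Omega>)\<bar> \<le> K1 * \<bar>t - s\<bar>"
    using L2_lipschitz_pairing[OF M(3) f V_measurable(1)[OF e], of C] C by auto
  obtain K2 where K2: "\<forall>s\<in>{0..T}. \<forall>t\<in>{0..T}.
      \<bar>(\<integral>x. q t x \<bullet> e x \<partial>restrict_space hausdorff1 \<Gamma>\<^sub>2) - (\<integral>x. q s x \<bullet> e x \<partial>restrict_space hausdorff1 \<Gamma>\<^sub>2)\<bar> \<le> K2 * \<bar>t - s\<bar>"
    using L2_lipschitz_pairing[OF \<Gamma>\<^sub>2_finite q V_measurable(2)[OF e], of C] C by auto
  have "\<bar>load t e - load s e\<bar> \<le> (K1 + K2) * \<bar>t - s\<bar>" if st: "s \<in> {0..T}" "t \<in> {0..T}" for s t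
    using bspec[OF bspec[OF K1 st(1)] st(2)] bspec[OF bspec[OF K2 st(1)] st(2)]
    unfolding load_def distrib_right by linarith
  then show ?thesis by blast
qed

lemma one_minus_admissible:
  assumes "admissible d"
  shows "(\<lambda>x. 1 - d x) \<in> Linf \<Omega>" "AE x in lebesgue_on \<Omega>. 1 - \<omega>\<^sub>1 \<le> 1 - d x"
proof -
  show "(\<lambda>x. 1 - d x) \<in> Linf \<Omega>"
    using assms by (intro Linf_diff[OF M(1)] Linf_const[OF M(1)]) (simp add: admissible_def)
  have "AE x in lebesgue_on \<Omega>. 0 \<le> d x \<and> d x \<le> \<omega>\<^sub>1" using assms by (simp add: admissible_def)
  then show "AE x in lebesgue_on \<Omega>. 1 - \<omega>\<^sub>1 \<le> 1 - d x" by eventually_elim simp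
qed

lemma strain_product_inner_form: "inner_form V (strain_product \<Omega>)"
  unfolding inner_form_def
proof (intro conjI ballI impI)
  show "linear_map_on V (\<lambda>u. strain_product \<Omega> u v)" if "v \<in> V" for v
    unfolding strain_product_eq_energy
    using that V_H1 by (intro energy_linear_map_on[OF step \<Omega>] Linf_const[OF M(1)]) auto
  show "strain_product \<Omega> u v = strain_product \<Omega> v u" for u v
    unfolding strain_product_eq_energy by (rule energy_commute)
  fix u assume u: "u \<in> V"
  show "0 \<le> strain_product \<Omega> u u" unfolding strain_product_def by (rule integral_nonneg_AE) simp
  assume z: "strain_product \<Omega> u u = 0"
  have "integrable (lebesgue_on \<Omega>) (\<lambda>x. 1 * (strain \<Omega> u x \<bullet> strain \<Omega> u x))"
    by (intro L2_space_integrable_inner_Linf[OF M(1)] strain_L2 P1_spaceD(1)[OF u] Linf_const[OF M(1)])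
  then have "AE x in lebesgue_on \<Omega>. strain \<Omega> u x \<bullet> strain \<Omega> u x = 0"
    using z integral_nonneg_eq_0_iff_AE[of "lebesgue_on \<Omega>" "\<lambda>x. strain \<Omega> u x \<bullet> strain \<Omega> u x"]
    by (simp add: strain_product_def)
  then have "AE x in lebesgue_on \<Omega>. strain \<Omega> u x = 0" by eventually_elim simp
  then show "u = (\<lambda>_. 0)" by (rule P1_strain_definite[OF step dom mesh \<Gamma>\<^sub>0 u])
qed

text \<open>The quantifier order matters: \<open>\<kappa> = (1 - \<omega>\<^sub>1) * c\<close>, with
  the ellipticity constant \<open>c\<close>, serves all admissible damages and hence all
  times.\<close>

lemma energy_coercive_admissible:
  "\<exists>\<kappa>>0. \<forall>d u. admissible d \<longrightarrow> u \<in> V \<longrightarrow>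
    \<kappa> * strain_product \<Omega> u u \<le> energy \<Omega> lam mu (\<lambda>x. 1 - d x) u u"
proof -
  obtain c where c: "c > 0"
    "AE x in lebesgue_on \<Omega>. \<forall>A. transpose A = A \<longrightarrow> c * (norm A)\<^sup>2 \<le> elasticity lam mu x A \<bullet> A"
    using lame(3) unfolding uniformly_elliptic_def by (elim exE conjE)
  show ?thesis
  proof (intro exI[of _ "(1 - \<omega>\<^sub>1) * c"] conjI allI impI)
    show "0 < (1 - \<omega>\<^sub>1) * c" using c \<omega>\<^sub>1 by simp
    show "(1 - \<omega>\<^sub>1) * c * strain_product \<Omega> u u \<le> energy \<Omega> lam mu (\<lambda>x. 1 - d x) u u"
      if d: "admissible d" and u: "u \<in> V" for d u
      by (rule energy_coercive[OF M(1) one_minus_admissible[OF d] _ lame(1,2) c(2) _ P1_spaceD(1)[OF u]])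
         (use \<omega>\<^sub>1 c in auto)
  qed
qed

lemma energy_inner_form:
  assumes d: "admissible d"
  shows "inner_form V (energy \<Omega> lam mu (\<lambda>x. 1 - d x))"
proof -
  obtain \<kappa> where \<kappa>: "0 < \<kappa>"
    "\<And>d u. admissible d \<Longrightarrow> u \<in> V \<Longrightarrow> \<kappa> * strain_product \<Omega> u u \<le> energy \<Omega> lam mu (\<lambda>x. 1 - d x) u u"
    using energy_coercive_admissible by auto
  show ?thesis
    unfolding inner_form_def
  proof (intro conjI ballI impI)
    show "linear_map_on V (\<lambda>u. energy \<Omega> lam mu (\<lambda>x. 1 - d x) u v)" if "v \<in> V" for v
      using that V_H1 by (intro energy_linear_map_on[OF step \<Omega> one_minus_admissible(1)[OF d] lame(1,2)]) auto
    show "energy \<Omega> lam mu (\<lambda>x. 1 - d x) u v = energy \<Omega> lam mu (\<lambda>x. 1 - d x) v u" for u v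
      by (rule energy_commute)
    fix u assume u: "u \<in> V"
    have n: "0 \<le> strain_product \<Omega> u u" by (rule inner_form_nonneg[OF strain_product_inner_form u])
    then have "0 \<le> \<kappa> * strain_product \<Omega> u u" using \<kappa>(1) by simp
    then show "0 \<le> energy \<Omega> lam mu (\<lambda>x. 1 - d x) u u" using \<kappa>(2)[OF d u] by simp
    assume "energy \<Omega> lam mu (\<lambda>x. 1 - d x) u u = 0"
    then have "\<kappa> * strain_product \<Omega> u u \<le> 0" using \<kappa>(2)[OF d u] by simp
    then have "strain_product \<Omega> u u \<le> 0" using \<kappa>(1) by (simp add: mult_le_0_iff)
    then show "u = (\<lambda>_. 0)" using n by (intro inner_form_definite[OF strain_product_inner_form u]) simp
  qed
qed

text \<open>Existence and uniqueness by the Riesz lemma justify the definite description in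
  \<open>discrete_displacement\<close>.\<close>

lemma displacement_solves:
  assumes t: "t \<in> {0..T}" and d: "admissible d"
  shows "disp t d \<in> V" "\<phi> \<in> V \<Longrightarrow> energy \<Omega> lam mu (\<lambda>x. 1 - d x) (disp t d) \<phi> = load t \<phi>"
proof -
  obtain P where P: "finite P" "determined_by V P" using P1_determined_by_vertices[OF mesh, of \<Gamma>\<^sub>0] by (elim exE conjE)
  have "\<exists>!u. u \<in> V \<and> (\<forall>\<phi>\<in>V. energy \<Omega> lam mu (\<lambda>x. 1 - d x) u \<phi> = load t \<phi>)"
    by (rule Riesz_exists_unique[OF V_space energy_inner_form[OF d] P load_linear[OF t]])
  from theI'[OF this]
  have "disp t d \<in> V \<and> (\<forall>\<phi>\<in>V. energy \<Omega> lam mu (\<lambda>x. 1 - d x) (disp t d) \<phi> = load t \<phi>)"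
    unfolding discrete_displacement_def energy_def load_def .
  then show "disp t d \<in> V" "\<phi> \<in> V \<Longrightarrow> energy \<Omega> lam mu (\<lambda>x. 1 - d x) (disp t d) \<phi> = load t \<phi>" by auto
qed

lemma mollified_displacement_measurable:
  assumes t: "t \<in> {0..T}" and d: "admissible d"
  shows "mollified_grad \<Omega> \<eta> (disp t d) \<in> borel_measurable borel"
  by (rule mollified_grad_measurable[OF \<Omega> kernel P1_spaceD(1)[OF displacement_solves(1)[OF t d]]])

text \<open>The difference of two displacements solves the problem at time \<open>t\<close>, with
  the change of the load plus the change of stiffness acting on the earlier displacement as
  right-hand side. Both are of order \<open>\<bar>t - s\<bar>\<close> on basis fields, and
  coercivity bounds the coefficients of the difference. Mollified gradients are linear and bounded
  on the basis.\<close>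

lemma mollified_displacement_lipschitz:
  assumes d: "\<And>t. t \<in> {0..T} \<Longrightarrow> admissible (d t)"
    and dL: "\<And>s t. s \<in> {0..T} \<Longrightarrow> t \<in> {0..T} \<Longrightarrow> AE x in lebesgue_on \<Omega>. \<bar>d t x - d s x\<bar> \<le> L * \<bar>t - s\<bar>"
    and L: "0 \<le> L"
  shows "\<exists>K. \<forall>s\<in>{0..T}. \<forall>t\<in>{0..T}. \<forall>x.
    norm (mollified_grad \<Omega> \<eta> (disp t (d t)) x - mollified_grad \<Omega> \<eta> (disp s (d s)) x) \<le> K * \<bar>t - s\<bar>"
proof -
  let ?S = "strain_product \<Omega>"
  define a where "a t = energy \<Omega> lam mu (\<lambda>x. 1 - d t x)" for t
  define u where "u t = disp t (d t)" for t
  have uV: "u t \<in> V" and ua: "\<phi> \<in> V \<Longrightarrow> a t (u t) \<phi> = load t \<phi>" if "t \<in> {0..T}" for t \<phi>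
    using displacement_solves[OF that d[OF that]] by (auto simp: u_def a_def)
  obtain P where P: "finite P" "determined_by V P" using P1_determined_by_vertices[OF mesh, of \<Gamma>\<^sub>0] by (elim exE conjE)
  obtain B where "orthonormal_basis V ?S B"
    using orthonormal_basis_exists[OF P(1) V_space strain_product_inner_form P(2)] by (rule exE)
  then have B: "finite B" "B \<subseteq> V" and expand: "\<And>w. w \<in> V \<Longrightarrow> w = (\<lambda>x. \<Sum>e\<in>B. ?S w e *\<^sub>R e x)"
    by (auto simp: orthonormal_basis_def)
  have lin: "l w = (\<Sum>e\<in>B. ?S w e *\<^sub>R l e)" if "linear_map_on V l" "w \<in> V" for l :: "_ \<Rightarrow> 'c::real_vector" and w
  proof -
    have "l w = l (\<lambda>x. \<Sum>e\<in>B. ?S w e *\<^sub>R e x)" by (rule arg_cong[OF expand[OF that(2)]])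
    also have "\<dots> = (\<Sum>e\<in>B. ?S w e *\<^sub>R l e)"
      by (rule linear_map_on_sum[OF V_space that(1) B(1)]) (use B(2) in auto)
    finally show ?thesis .
  qed
  obtain \<kappa> where \<kappa>: "0 < \<kappa>"
    "\<And>d u. admissible d \<Longrightarrow> u \<in> V \<Longrightarrow> \<kappa> * ?S u u \<le> energy \<Omega> lam mu (\<lambda>x. 1 - d x) u u"
    using energy_coercive_admissible by auto
  \<comment> \<open>The \<open>l1\<close> norm of the coefficients is dual to the maximum of a
    functional over the basis, which is all that is known about loads; see
    \<open>n_load\<close>.\<close>
  define n where "n w = (\<Sum>e\<in>B. \<bar>?S w e\<bar>)" for w
  have n0: "0 \<le> n w" for w by (simp add: n_def sum_nonneg)
  \<comment> \<open>By orthonormality \<open>?S w w\<close> is the sum of the squared coefficients;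
    the factor \<open>card B\<close> comes from comparing it with the square of their
    \<open>l1\<close> norm.\<close>
  have coercive: "\<kappa> * (n w)\<^sup>2 \<le> real (card B) * a t w w" if t: "t \<in> {0..T}" and w: "w \<in> V" for t w
  proof -
    have "?S w w = (\<Sum>e\<in>B. ?S w e *\<^sub>R ?S w e)"
      by (rule lin[OF inner_form_linear_right[OF V_space strain_product_inner_form w] w])
    then have "(n w)\<^sup>2 \<le> ?S w w * card B"
      using sum_squared_le_sum_of_squares[of "\<lambda>e. \<bar>?S w e\<bar>" B] by (simp add: n_def power2_eq_square)
    then have "\<kappa> * (n w)\<^sup>2 \<le> \<kappa> * (?S w w * card B)" using \<kappa>(1) by (intro mult_left_mono) auto
    also have "\<dots> = real (card B) * (\<kappa> * ?S w w)" by simp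
    also have "\<dots> \<le> real (card B) * a t w w"
      unfolding a_def by (intro mult_left_mono \<kappa>(2) d t w) simp
    finally show ?thesis .
  qed
  \<comment> \<open>The energy estimate: coercivity is quadratic in \<open>n w\<close>, the
    right-hand side linear, and one factor \<open>n w\<close> cancels unless it is zero.\<close>
  have solve: "n w \<le> real (card B) * X / \<kappa>" if t: "t \<in> {0..T}" and w: "w \<in> V" and X: "a t w w \<le> n w * X" "0 \<le> X" for t w X
  proof (cases "n w = 0")
    case True
    then show ?thesis using X(2) \<kappa>(1) by simp
  next
    case False
    then have p: "0 < n w" using n0[of w] by simp
    have "\<kappa> * (n w)\<^sup>2 \<le> real (card B) * (n w * X)"
      by (rule order_trans[OF coercive[OF t w]]) (intro mult_left_mono X(1), simp)
    then have "n w * (\<kappa> * n w) \<le> n w * (real (card B) * X)" by (simp add: power2_eq_square algebra_simps)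
    then have "\<kappa> * n w \<le> real (card B) * X" using p by (rule mult_left_le_imp_le)
    then show ?thesis using \<kappa>(1) by (simp add: le_divide_eq mult.commute)
  qed
  have "\<forall>e\<in>B. \<exists>K. \<forall>s\<in>{0..T}. \<forall>t\<in>{0..T}. \<bar>load t e - load s e\<bar> \<le> K * \<bar>t - s\<bar>"
    using load_lipschitz B(2) by blast
  from bchoice[OF this] obtain K where
    K: "\<forall>e\<in>B. \<forall>s\<in>{0..T}. \<forall>t\<in>{0..T}. \<bar>load t e - load s e\<bar> \<le> K e * \<bar>t - s\<bar>" ..
  define K1 where "K1 = (\<Sum>e\<in>B. \<bar>K e\<bar>)"
  have K1: "\<bar>load t e - load s e\<bar> \<le> K1 * \<bar>t - s\<bar>" if "e \<in> B" "s \<in> {0..T}" "t \<in> {0..T}" for e s t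
  proof -
    have "\<bar>load t e - load s e\<bar> \<le> K e * \<bar>t - s\<bar>" using K that by blast
    also have "\<dots> \<le> K1 * \<bar>t - s\<bar>"
    proof (rule mult_right_mono)
      show "K e \<le> K1"
        using member_le_sum[of e B "\<lambda>e. \<bar>K e\<bar>"] that(1) B(1) unfolding K1_def by force
    qed simp
    finally show ?thesis .
  qed
  have K1n: "0 \<le> K1" by (simp add: K1_def sum_nonneg)
  \<comment> \<open>A bound for the loads over the whole time interval: the values at time 0 plus
    the Lipschitz drift over length \<open>T\<close>.\<close>
  define K0 where "K0 = (\<Sum>e\<in>B. \<bar>load 0 e\<bar>) + K1 * T"
  have K0: "\<bar>load t e\<bar> \<le> K0" if e: "e \<in> B" and t: "t \<in> {0..T}" for e t
  proof -
    have "\<bar>load t e - load 0 e\<bar> \<le> K1 * \<bar>t - 0\<bar>" using T by (intro K1 e t) auto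
    also have "\<dots> \<le> K1 * T" using t K1n by (intro mult_left_mono) auto
    finally have "\<bar>load t e - load 0 e\<bar> \<le> K1 * T" .
    moreover have "\<bar>load 0 e\<bar> \<le> (\<Sum>e\<in>B. \<bar>load 0 e\<bar>)"
      by (rule member_le_sum[OF e _ B(1)]) simp
    ultimately show ?thesis unfolding K0_def by linarith
  qed
  have K0n: "0 \<le> K0" using K1n T by (simp add: K0_def sum_nonneg)
  have n_load: "l w \<le> n w * X" if l: "linear_map_on V l" and w: "w \<in> V" and X: "\<And>e. e \<in> B \<Longrightarrow> \<bar>l e\<bar> \<le> X" for l w X
  proof -
    have "l w = (\<Sum>e\<in>B. ?S w e * l e)" using lin[OF l w] by simp
    also have "\<dots> \<le> (\<Sum>e\<in>B. \<bar>?S w e\<bar> * X)"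
    proof (rule sum_mono)
      fix e assume "e \<in> B"
      then have "\<bar>?S w e * l e\<bar> \<le> \<bar>?S w e\<bar> * X" unfolding abs_mult by (intro mult_left_mono X) auto
      then show "?S w e * l e \<le> \<bar>?S w e\<bar> * X" by linarith
    qed
    finally show ?thesis by (simp add: n_def sum_distrib_right)
  qed
  define N where "N = real (card B) * K0 / \<kappa>"
  \<comment> \<open>A priori bound uniform in time, obtained by testing the equation for
    \<open>u t\<close> with \<open>u t\<close> itself.\<close>
  have N: "n (u t) \<le> N" if t: "t \<in> {0..T}" for t
    unfolding N_def
  proof (rule solve[OF t uV[OF t] _ K0n])
    show "a t (u t) (u t) \<le> n (u t) * K0"
      unfolding ua[OF t uV[OF t]] by (intro n_load load_linear[OF t] uV[OF t] K0 t)
  qed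
  have Nn: "0 \<le> N" using K0n \<kappa>(1) by (simp add: N_def)
  define J where "J e e' = (\<integral>x. \<bar>elasticity lam mu x (strain \<Omega> e x) \<bullet> strain \<Omega> e' x\<bar> \<partial>lebesgue_on \<Omega>)" for e e'
  have Jn: "0 \<le> J e e'" for e e' unfolding J_def by (rule integral_nonneg_AE) simp
  define J1 where "J1 = (\<Sum>e\<in>B. \<Sum>e'\<in>B. J e e')"
  have J1n: "0 \<le> J1" by (simp add: J1_def sum_nonneg Jn)
  have J1: "J e e' \<le> J1" if "e \<in> B" "e' \<in> B" for e e'
  proof -
    have "J e e' \<le> (\<Sum>e'\<in>B. J e e')" by (rule member_le_sum[OF that(2) _ B(1)]) (rule Jn)
    also have "\<dots> \<le> J1" unfolding J1_def
      by (rule member_le_sum[OF that(1) _ B(1), of "\<lambda>e. \<Sum>e'\<in>B. J e e'"]) (intro sum_nonneg Jn)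
    finally show ?thesis .
  qed
  \<comment> \<open>\<open>K1\<close> measures the change of the load, and
    \<open>N * (L * J1)\<close> the change of the stiffness acting on a displacement of size at most
    \<open>N\<close>.\<close>
  define X where "X = K1 + N * (L * J1)"
  have Xn: "0 \<le> X" using K1n Nn L J1n by (simp add: X_def)
  have main: "n (\<lambda>x. u t x - u s x) \<le> real (card B) * (X * \<bar>t - s\<bar>) / \<kappa>"
    if s: "s \<in> {0..T}" and t: "t \<in> {0..T}" for s t
  proof (rule solve[OF t])
    let ?\<delta> = "\<lambda>x. u t x - u s x"
    show \<delta>V: "?\<delta> \<in> V" by (rule function_subspace_diff[OF V_space uV[OF t] uV[OF s]])
    have aV: "inner_form V (a r)" if "r \<in> {0..T}" for r
      unfolding a_def by (rule energy_inner_form[OF d[OF that]])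
    have dL': "(\<lambda>x. 1 - d r x) \<in> Linf \<Omega>" if "r \<in> {0..T}" for r by (rule one_minus_admissible(1)[OF d[OF that]])
    \<comment> \<open>Equal to \<open>d t x - d s x\<close>: the loss of stiffness from time
      \<open>s\<close> to time \<open>t\<close>.\<close>
    define c where "c x = (1 - d s x) - (1 - d t x)" for x
    have c: "c \<in> Linf \<Omega>" unfolding c_def by (rule Linf_diff[OF M(1) dL'[OF s] dL'[OF t]])
    have cb: "AE x in lebesgue_on \<Omega>. \<bar>c x\<bar> \<le> L * \<bar>t - s\<bar>"
      using dL[OF s t] by eventually_elim (simp add: c_def)
    \<comment> \<open>The residual functional: the old displacement \<open>u s\<close> satisfies the
      equation at time \<open>t\<close> up to \<open>l\<close>.\<close>
    define l where "l w = load t w - load s w + energy \<Omega> lam mu c (u s) w" for w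
    have eV: "linear_map_on V (energy \<Omega> lam mu c w)" if "w \<in> V" for w
      using energy_linear_map_on[OF step \<Omega> c lame(1,2) V_H1, of w] V_H1 that
      by (subst energy_commute[abs_def]) auto
    have l: "linear_map_on V l"
      using load_linear[OF t] load_linear[OF s] eV[OF uV[OF s]]
      unfolding l_def linear_map_on_def by (simp add: algebra_simps)
    have "a t ?\<delta> ?\<delta> = a t (u t) ?\<delta> - a t (u s) ?\<delta>"
      by (rule linear_map_on_diff[OF V_space inner_form_linear[OF aV[OF t] \<delta>V] uV[OF t] uV[OF s]])
    also have "a t (u s) ?\<delta> = a s (u s) ?\<delta> - energy \<Omega> lam mu c (u s) ?\<delta>"
      using energy_weight_diff[OF M(1) dL'[OF s] dL'[OF t] lame(1,2) subsetD[OF V_H1 uV[OF s]] subsetD[OF V_H1 \<delta>V]]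
      unfolding a_def c_def by linarith
    finally have "a t ?\<delta> ?\<delta> = l ?\<delta>"
      using ua[OF t \<delta>V] ua[OF s \<delta>V] by (simp add: l_def)
    also have "\<dots> \<le> n ?\<delta> * (X * \<bar>t - s\<bar>)"
    proof (rule n_load[OF l \<delta>V])
      fix e assume e: "e \<in> B"
      then have eV': "e \<in> V" using B(2) by auto
      have "\<bar>energy \<Omega> lam mu c e' e\<bar> \<le> L * \<bar>t - s\<bar> * J1" if e': "e' \<in> B" for e'
      proof -
        have "\<bar>energy \<Omega> lam mu c e' e\<bar> \<le> L * \<bar>t - s\<bar> * J e' e"
          unfolding J_def using e' B(2) V_H1 eV' by (intro energy_bound[OF M(1) c cb lame(1,2)]) auto
        also have "\<dots> \<le> L * \<bar>t - s\<bar> * J1" using L by (intro mult_left_mono J1 e' e) auto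
        finally show ?thesis .
      qed
      moreover have le: "linear_map_on V (\<lambda>w. energy \<Omega> lam mu c w e)"
        using energy_linear_map_on[OF step \<Omega> c lame(1,2) V_H1, of e] V_H1 eV' by auto
      ultimately have 1: "energy \<Omega> lam mu c (u s) e \<le> n (u s) * (L * \<bar>t - s\<bar> * J1)"
        by (intro n_load[OF le uV[OF s]])
      \<comment> \<open>\<open>n_load\<close> bounds a functional from above only, so the opposite
        sign is treated separately.\<close>
      have "linear_map_on V (\<lambda>w. - energy \<Omega> lam mu c w e)"
        using le by (simp add: linear_map_on_def)
      from n_load[OF this uV[OF s], of "L * \<bar>t - s\<bar> * J1"]
      have 2: "- energy \<Omega> lam mu c (u s) e \<le> n (u s) * (L * \<bar>t - s\<bar> * J1)"
        using \<open>\<And>e'. e' \<in> B \<Longrightarrow> \<bar>energy \<Omega> lam mu c e' e\<bar> \<le> L * \<bar>t - s\<bar> * J1\<close> by simp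
      have "n (u s) * (L * \<bar>t - s\<bar> * J1) \<le> N * (L * \<bar>t - s\<bar> * J1)"
        using L J1n by (intro mult_right_mono N s) auto
      then have "\<bar>energy \<Omega> lam mu c (u s) e\<bar> \<le> N * (L * J1) * \<bar>t - s\<bar>"
        using 1 2 by (simp add: ac_simps)
      then show "\<bar>l e\<bar> \<le> X * \<bar>t - s\<bar>"
        using K1[OF e s t] unfolding l_def X_def distrib_right by linarith
    qed
    finally show "a t ?\<delta> ?\<delta> \<le> n ?\<delta> * (X * \<bar>t - s\<bar>)" .
    show "0 \<le> X * \<bar>t - s\<bar>" using Xn by simp
  qed
  have "\<forall>e\<in>B. \<exists>C. \<forall>x. norm (mollified_grad \<Omega> \<eta> e x) \<le> C"
    using mollified_grad_bounded[OF \<Omega> kernel] B(2) V_H1 by blast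
  from bchoice[OF this] obtain C where C: "\<forall>e\<in>B. \<forall>x. norm (mollified_grad \<Omega> \<eta> e x) \<le> C e" ..
  define C1 where "C1 = (\<Sum>e\<in>B. \<bar>C e\<bar>)"
  have C1n: "0 \<le> C1" by (simp add: C1_def sum_nonneg)
  have C1: "norm (mollified_grad \<Omega> \<eta> e x) \<le> C1" if "e \<in> B" for e x
  proof -
    have "norm (mollified_grad \<Omega> \<eta> e x) \<le> \<bar>C e\<bar>" using C that by (meson abs_ge_self order_trans)
    also have "\<dots> \<le> C1" unfolding C1_def by (rule member_le_sum[OF that _ B(1)]) simp
    finally show ?thesis .
  qed
  have ml: "linear_map_on V (\<lambda>v. mollified_grad \<Omega> \<eta> v x)" for x
    unfolding linear_map_on_def
  proof (intro conjI ballI allI)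
    note m = mollified_grad_linear[OF step \<Omega> kernel]
    show "mollified_grad \<Omega> \<eta> (\<lambda>x. v x + w x) x = mollified_grad \<Omega> \<eta> v x + mollified_grad \<Omega> \<eta> w x"
      if "v \<in> V" "w \<in> V" for v w using m[of v w 1 1 x] that V_H1 by auto
    show "mollified_grad \<Omega> \<eta> (\<lambda>x. r *\<^sub>R v x) x = r *\<^sub>R mollified_grad \<Omega> \<eta> v x"
      if "v \<in> V" for v r using m[of v v r 0 x] that V_H1 by auto
  qed
  have "norm (mollified_grad \<Omega> \<eta> (u t) x - mollified_grad \<Omega> \<eta> (u s) x) \<le> (C1 * (real (card B) * X / \<kappa>)) * \<bar>t - s\<bar>"
    if s: "s \<in> {0..T}" and t: "t \<in> {0..T}" for s t x
  proof -
    let ?\<delta> = "\<lambda>x. u t x - u s x"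
    have \<delta>V: "?\<delta> \<in> V" by (rule function_subspace_diff[OF V_space uV[OF t] uV[OF s]])
    have "mollified_grad \<Omega> \<eta> (u t) x - mollified_grad \<Omega> \<eta> (u s) x = mollified_grad \<Omega> \<eta> ?\<delta> x"
      by (rule linear_map_on_diff[OF V_space ml uV[OF t] uV[OF s], symmetric])
    also have "\<dots> = (\<Sum>e\<in>B. ?S ?\<delta> e *\<^sub>R mollified_grad \<Omega> \<eta> e x)" by (rule lin[OF ml \<delta>V])
    also have "norm \<dots> \<le> (\<Sum>e\<in>B. \<bar>?S ?\<delta> e\<bar> * C1)"
      by (rule sum_norm_le) (simp add: mult_left_mono C1)
    also have "\<dots> = C1 * n ?\<delta>" by (simp add: n_def sum_distrib_left mult.commute)
    also have "\<dots> \<le> C1 * (real (card B) * (X * \<bar>t - s\<bar>) / \<kappa>)"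
      by (intro mult_left_mono main s t C1n)
    finally show ?thesis by (simp add: mult.assoc)
  qed
  then show ?thesis unfolding u_def by blast
qed

end

section \<open>Functions with Lipschitz gradient on a convex body\<close>

text \<open>Segments from \<open>x\<close> into \<open>Y\<close> stay in \<open>Y\<close>, so
  one-sided derivatives determine the derivative on all vectors \<open>y - x\<close>. As
  \<open>Y\<close> contains a ball, differences of such vectors fill every direction; this also
  covers boundary points \<open>x\<close>.\<close>

lemma has_derivative_within_unique_convex:
  fixes f :: "'a::euclidean_space \<Rightarrow> 'b::real_normed_vector"
  assumes Y: "convex Y" "interior Y \<noteq> {}" and x: "x \<in> Y"
    and f: "(f has_derivative f') (at x within Y)" "(f has_derivative f'') (at x within Y)"
  shows "f' = f''"
proof
  have l: "linear f'" "linear f''" using f by (auto intro: has_derivative_linear)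
  have eq: "f' (y - x) = f'' (y - x)" if y: "y \<in> Y" for y
  proof -
    define p where "p t = x + t *\<^sub>R (y - x)" for t
    have pY: "p ` {0..1} \<subseteq> Y"
    proof clarify
      fix t :: real assume "t \<in> {0..1}"
      then have "(1 - t) *\<^sub>R x + t *\<^sub>R y \<in> Y" using x y by (intro convexD[OF Y(1)]) auto
      then show "p t \<in> Y" by (simp add: p_def algebra_simps)
    qed
    have p: "(p has_derivative (\<lambda>h. h *\<^sub>R (y - x))) (at 0 within {0..1})"
      unfolding p_def by (auto intro!: derivative_eq_intros)
    have vd: "((f \<circ> p) has_vector_derivative g (y - x)) (at 0 within {0..1})"
      if g: "(f has_derivative g) (at x within Y)" for g
    proof -
      have "p 0 = x" by (simp add: p_def)
      then have "(f has_derivative g) (at (p 0) within p ` {0..1})"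
        using has_derivative_subset[OF g pY] by simp
      from diff_chain_within[OF p this]
      have "((f \<circ> p) has_derivative (g \<circ> (\<lambda>h. h *\<^sub>R (y - x)))) (at 0 within {0..1})" .
      moreover have "g \<circ> (\<lambda>h. h *\<^sub>R (y - x)) = (\<lambda>h. h *\<^sub>R g (y - x))"
        using has_derivative_linear[OF g] by (auto simp: linear_scale)
      ultimately show ?thesis by (simp add: has_vector_derivative_def)
    qed
    show ?thesis
      by (rule vector_derivative_unique_within_closed_interval[of 0 1 0 "f \<circ> p"])
         (use vd[OF f(1)] vd[OF f(2)] in auto)
  qed
  fix w :: 'a
  obtain z where "z \<in> interior Y" using Y(2) by blast
  then obtain e where e: "e > 0" "ball z e \<subseteq> Y" by (auto simp: mem_interior)
  define N where "N = norm w + 1"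
  have N: "N > 0" using norm_ge_zero[of w] unfolding N_def by linarith
  \<comment> \<open>A small multiple of the given direction \<open>w\<close> becomes the difference
    of two points of the ball around \<open>z\<close>.\<close>
  define s where "s = e / 2 / N"
  have s: "s > 0" unfolding s_def using e(1) N by simp
  have "norm (s *\<^sub>R w) = s * norm w" using s by simp
  also have "\<dots> \<le> s * N" using s by (simp add: N_def)
  also have "\<dots> = e / 2" using N by (simp add: s_def)
  finally have "z + s *\<^sub>R w \<in> ball z e" using e(1) by (simp add: dist_norm)
  then have "f' (z + s *\<^sub>R w - x) = f'' (z + s *\<^sub>R w - x)" "f' (z - x) = f'' (z - x)"
    using e by (auto intro!: eq)
  then have "f' (z + s *\<^sub>R w - x) - f' (z - x) = f'' (z + s *\<^sub>R w - x) - f'' (z - x)" by simp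
  then have "f' (s *\<^sub>R w) = f'' (s *\<^sub>R w)"
    using linear_diff[OF l(1), of "z + s *\<^sub>R w - x" "z - x"] linear_diff[OF l(2), of "z + s *\<^sub>R w - x" "z - x"] by simp
  then show "f' w = f'' w" using s by (simp add: linear_scale[OF l(1)] linear_scale[OF l(2)])
qed

lemma grad_within_has_derivative:
  fixes k :: "'a::euclidean_space \<Rightarrow> real"
  assumes "k differentiable (at y within Y)"
  shows "(k has_derivative (\<lambda>v. grad_within Y k y \<bullet> v)) (at y within Y)"
proof -
  let ?F = "frechet_derivative k (at y within Y)"
  have F: "(k has_derivative ?F) (at y within Y)" using assms by (rule frechet_derivative_works[THEN iffD1])
  have l: "linear ?F" using F by (rule has_derivative_linear)
  have "?F v = grad_within Y k y \<bullet> v" for v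
  proof -
    have "?F v = ?F (\<Sum>b\<in>Basis. (v \<bullet> b) *\<^sub>R b)" by (simp add: euclidean_representation)
    also have "\<dots> = (\<Sum>b\<in>Basis. (v \<bullet> b) * ?F b)" using l by (simp add: linear_sum linear_scale)
    also have "\<dots> = grad_within Y k y \<bullet> v"
      by (simp add: grad_within_def inner_sum_left inner_commute[of v] mult.commute)
    finally show ?thesis .
  qed
  then have "?F = (\<lambda>v. grad_within Y k y \<bullet> v)" by (rule ext)
  then show ?thesis using F by simp
qed

lemma grad_within_eqI:
  fixes k :: "'a::euclidean_space \<Rightarrow> real"
  assumes Y: "convex Y" "interior Y \<noteq> {}" "y \<in> Y" and k: "(k has_derivative (\<lambda>v. w \<bullet> v)) (at y within Y)"
  shows "grad_within Y k y = w"
proof -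
  have "k differentiable (at y within Y)" using k by (auto simp: differentiable_def)
  from has_derivative_within_unique_convex[OF Y grad_within_has_derivative[OF this] k]
  have "grad_within Y k y \<bullet> v = w \<bullet> v" for v by (rule fun_cong)
  then have "(grad_within Y k y - w) \<bullet> (grad_within Y k y - w) = 0" by (simp add: inner_diff_left)
  then show ?thesis by simp
qed

locale convex_body =
  fixes Y :: "'a::euclidean_space set"
  assumes Y: "convex Y" "compact Y" "interior Y \<noteq> {}"
begin

lemma Y_nonempty: "Y \<noteq> {}"
  using Y(3) by auto

lemma C11_differentiable: "k \<in> C11_space Y \<Longrightarrow> y \<in> Y \<Longrightarrow> k differentiable (at y within Y)"
  by (simp add: C11_space_def differentiable_on_def)

lemma C11_continuous: "k \<in> C11_space Y \<Longrightarrow> continuous_on Y k"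
  by (simp add: C11_space_def differentiable_imp_continuous_on)

lemma C11_lipschitz_constants:
  assumes "k \<in> C11_space Y"
  shows "{L. L-lipschitz_on Y (grad_within Y k)} \<noteq> {}" "bdd_below {L. L-lipschitz_on Y (grad_within Y k)}"
    "0 \<le> Inf {L. L-lipschitz_on Y (grad_within Y k)}"
proof -
  show 1: "{L. L-lipschitz_on Y (grad_within Y k)} \<noteq> {}" using assms by (auto simp: C11_space_def)
  show "bdd_below {L. L-lipschitz_on Y (grad_within Y k)}"
    by (rule bdd_belowI[of _ 0]) (auto dest: lipschitz_on_nonneg)
  show "0 \<le> Inf {L. L-lipschitz_on Y (grad_within Y k)}"
    by (rule cInf_greatest[OF 1]) (auto dest: lipschitz_on_nonneg)
qed

lemma C11_bounded:
  assumes k: "k \<in> C11_space Y"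
  shows "bdd_above ((\<lambda>y. \<bar>k y\<bar>) ` Y)" "bdd_above ((\<lambda>y. norm (grad_within Y k y)) ` Y)"
proof -
  obtain L where L: "L-lipschitz_on Y (grad_within Y k)" using k by (auto simp: C11_space_def)
  have "continuous_on Y (\<lambda>y. \<bar>k y\<bar>)" by (intro continuous_intros C11_continuous k)
  then show "bdd_above ((\<lambda>y. \<bar>k y\<bar>) ` Y)"
    by (intro bounded_imp_bdd_above compact_imp_bounded compact_continuous_image Y)
  have "continuous_on Y (\<lambda>y. norm (grad_within Y k y))"
    by (intro continuous_intros lipschitz_on_continuous_on[OF L])
  then show "bdd_above ((\<lambda>y. norm (grad_within Y k y)) ` Y)"
    by (intro bounded_imp_bdd_above compact_imp_bounded compact_continuous_image Y)
qed

lemma SUP_nonneg: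
  fixes F :: "'a \<Rightarrow> real"
  assumes "bdd_above (F ` Y)" "\<And>y. y \<in> Y \<Longrightarrow> 0 \<le> F y"
  shows "0 \<le> (SUP y\<in>Y. F y)"
proof -
  obtain y where y: "y \<in> Y" using Y_nonempty by blast
  show ?thesis by (rule order_trans[OF assms(2)[OF y] cSUP_upper[OF y assms(1)]])
qed

lemma C11_norm_bounds:
  assumes k: "k \<in> C11_space Y" and y: "y \<in> Y"
  shows "\<bar>k y\<bar> \<le> C11_norm Y k" "norm (grad_within Y k y) \<le> C11_norm Y k"
proof -
  have "0 \<le> (SUP y\<in>Y. \<bar>k y\<bar>)" "0 \<le> (SUP y\<in>Y. norm (grad_within Y k y))"
    by (intro SUP_nonneg C11_bounded[OF k]; simp)+
  moreover have "\<bar>k y\<bar> \<le> (SUP y\<in>Y. \<bar>k y\<bar>)" "norm (grad_within Y k y) \<le> (SUP y\<in>Y. norm (grad_within Y k y))"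
    by (rule cSUP_upper[OF y], rule C11_bounded[OF k])+
  ultimately show "\<bar>k y\<bar> \<le> C11_norm Y k" "norm (grad_within Y k y) \<le> C11_norm Y k"
    using C11_lipschitz_constants(3)[OF k] unfolding C11_norm_def by linarith+
qed

text \<open>Mean value inequality on the convex set \<open>Y\<close>; the gradient part of the norm
  bounds the derivative.\<close>

lemma C11_norm_lipschitz:
  assumes k: "k \<in> C11_space Y" and "y \<in> Y" "z \<in> Y"
  shows "\<bar>k y - k z\<bar> \<le> C11_norm Y k * norm (y - z)"
proof -
  have "norm (k y - k z) \<le> C11_norm Y k * norm (y - z)"
  proof (rule differentiable_bound[OF Y(1)])
    show "(k has_derivative (\<lambda>v. grad_within Y k x \<bullet> v)) (at x within Y)" if "x \<in> Y" for x
      by (rule grad_within_has_derivative[OF C11_differentiable[OF k that]])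
    show "onorm (\<lambda>v. grad_within Y k x \<bullet> v) \<le> C11_norm Y k" if "x \<in> Y" for x
    proof (rule onorm_le)
      fix v
      have "norm (grad_within Y k x \<bullet> v) \<le> norm (grad_within Y k x) * norm v"
        using Cauchy_Schwarz_ineq2 by simp
      also have "\<dots> \<le> C11_norm Y k * norm v" by (intro mult_right_mono C11_norm_bounds(2)[OF k that]) simp
      finally show "norm (grad_within Y k x \<bullet> v) \<le> C11_norm Y k * norm v" .
    qed
  qed (use assms in auto)
  then show ?thesis by simp
qed

text \<open>Uniqueness of the derivative within \<open>Y\<close> makes \<open>grad_within\<close>
  additive, and the three parts of the norm are then subadditive one by one.\<close>

lemma C11_norm_add_scale:
  assumes k: "k \<in> C11_space Y" and l: "l \<in> C11_space Y"
  shows "(\<lambda>y. k y + c * l y) \<in> C11_space Y"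
    "C11_norm Y (\<lambda>y. k y + c * l y) \<le> C11_norm Y k + \<bar>c\<bar> * C11_norm Y l"
proof -
  let ?m = "\<lambda>y. k y + c * l y"
  have grad: "grad_within Y ?m y = grad_within Y k y + c *\<^sub>R grad_within Y l y" if y: "y \<in> Y" for y
  proof (rule grad_within_eqI[OF Y(1,3) y])
    show "(?m has_derivative (\<lambda>v. (grad_within Y k y + c *\<^sub>R grad_within Y l y) \<bullet> v)) (at y within Y)"
      using grad_within_has_derivative[OF C11_differentiable[OF k y]] grad_within_has_derivative[OF C11_differentiable[OF l y]]
      unfolding inner_add_left inner_scaleR_left
      by (intro has_derivative_add has_derivative_mult_right)
  qed
  have lip: "(L + \<bar>c\<bar> * L')-lipschitz_on Y (grad_within Y ?m)"
    if L: "L-lipschitz_on Y (grad_within Y k)" "L'-lipschitz_on Y (grad_within Y l)" for L L'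
  proof (rule lipschitz_onI)
    fix y z assume yz: "y \<in> Y" "z \<in> Y"
    have "dist (grad_within Y ?m y) (grad_within Y ?m z)
      = norm ((grad_within Y k y - grad_within Y k z) + c *\<^sub>R (grad_within Y l y - grad_within Y l z))"
      by (simp add: grad yz dist_norm algebra_simps)
    also have "\<dots> \<le> norm (grad_within Y k y - grad_within Y k z) + norm (c *\<^sub>R (grad_within Y l y - grad_within Y l z))"
      by (rule norm_triangle_ineq)
    also have "\<dots> \<le> L * dist y z + \<bar>c\<bar> * (L' * dist y z)"
      using lipschitz_onD[OF L(1) yz] lipschitz_onD[OF L(2) yz] by (simp add: dist_norm add_mono mult_left_mono)
    finally show "dist (grad_within Y ?m y) (grad_within Y ?m z) \<le> (L + \<bar>c\<bar> * L') * dist y z"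
      by (simp add: algebra_simps)
  next
    show "0 \<le> L + \<bar>c\<bar> * L'" using lipschitz_on_nonneg[OF L(1)] lipschitz_on_nonneg[OF L(2)] by simp
  qed
  have diff: "?m differentiable_on Y"
    using k l by (auto simp: C11_space_def intro!: derivative_intros)
  show m: "?m \<in> C11_space Y"
    using k l lip diff by (auto simp: C11_space_def)
  let ?A = "\<lambda>k. {L. L-lipschitz_on Y (grad_within Y k)}"
  have 1: "(SUP y\<in>Y. \<bar>?m y\<bar>) \<le> (SUP y\<in>Y. \<bar>k y\<bar>) + \<bar>c\<bar> * (SUP y\<in>Y. \<bar>l y\<bar>)"
  proof (rule cSUP_least[OF Y_nonempty])
    fix y assume y: "y \<in> Y"
    have "\<bar>?m y\<bar> \<le> \<bar>k y\<bar> + \<bar>c\<bar> * \<bar>l y\<bar>" using abs_triangle_ineq[of "k y" "c * l y"] by (simp add: abs_mult)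
    also have "\<dots> \<le> (SUP y\<in>Y. \<bar>k y\<bar>) + \<bar>c\<bar> * (SUP y\<in>Y. \<bar>l y\<bar>)"
      by (intro add_mono mult_left_mono cSUP_upper[OF y] C11_bounded k l) simp
    finally show "\<bar>?m y\<bar> \<le> (SUP y\<in>Y. \<bar>k y\<bar>) + \<bar>c\<bar> * (SUP y\<in>Y. \<bar>l y\<bar>)" .
  qed
  have 2: "(SUP y\<in>Y. norm (grad_within Y ?m y)) \<le> (SUP y\<in>Y. norm (grad_within Y k y)) + \<bar>c\<bar> * (SUP y\<in>Y. norm (grad_within Y l y))"
  proof (rule cSUP_least[OF Y_nonempty])
    fix y assume y: "y \<in> Y"
    have "norm (grad_within Y ?m y) \<le> norm (grad_within Y k y) + \<bar>c\<bar> * norm (grad_within Y l y)"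
      using norm_triangle_ineq[of "grad_within Y k y" "c *\<^sub>R grad_within Y l y"] by (simp add: grad[OF y])
    also have "\<dots> \<le> (SUP y\<in>Y. norm (grad_within Y k y)) + \<bar>c\<bar> * (SUP y\<in>Y. norm (grad_within Y l y))"
      by (intro add_mono mult_left_mono cSUP_upper[OF y] C11_bounded k l) simp
    finally show "norm (grad_within Y ?m y) \<le> (SUP y\<in>Y. norm (grad_within Y k y)) + \<bar>c\<bar> * (SUP y\<in>Y. norm (grad_within Y l y))" .
  qed
  \<comment> \<open>Infima are taken over the two Lipschitz constants in turn, so no optimal
    constant is assumed. The second one requires division by the absolute value of \<open>c\<close>,
    hence the split at zero.\<close>
  have 3: "Inf (?A ?m) \<le> Inf (?A k) + \<bar>c\<bar> * Inf (?A l)"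
  proof -
    have le: "Inf (?A ?m) \<le> L + \<bar>c\<bar> * L'" if "L \<in> ?A k" "L' \<in> ?A l" for L L'
      using that by (intro cInf_lower C11_lipschitz_constants(2)[OF m]) (auto intro: lip)
    have "Inf (?A ?m) - \<bar>c\<bar> * L' \<le> Inf (?A k)" if "L' \<in> ?A l" for L'
      by (rule cInf_greatest[OF C11_lipschitz_constants(1)[OF k]]) (use le[OF _ that] in \<open>simp add: diff_le_eq\<close>)
    then have le2: "Inf (?A ?m) - Inf (?A k) \<le> \<bar>c\<bar> * L'" if "L' \<in> ?A l" for L' using that by (simp add: diff_le_eq add.commute)
    show ?thesis
    proof (cases "c = 0")
      case True
      obtain L' where "L' \<in> ?A l" using C11_lipschitz_constants(1)[OF l] by auto
      from le2[OF this] show ?thesis using True by simp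
    next
      case False
      have "(Inf (?A ?m) - Inf (?A k)) / \<bar>c\<bar> \<le> Inf (?A l)"
        by (rule cInf_greatest[OF C11_lipschitz_constants(1)[OF l]])
           (use le2 False in \<open>simp add: divide_le_eq mult.commute\<close>)
      then show ?thesis using False by (simp add: divide_le_eq mult.commute)
    qed
  qed
  show "C11_norm Y ?m \<le> C11_norm Y k + \<bar>c\<bar> * C11_norm Y l"
    unfolding C11_norm_def using 1 2 3 by (simp add: algebra_simps)
qed

lemma C11_norm_diff:
  assumes "k \<in> C11_space Y" "l \<in> C11_space Y"
  shows "k - l \<in> C11_space Y" "C11_norm Y (k - l) \<le> C11_norm Y k + C11_norm Y l"
    "C11_norm Y k \<le> C11_norm Y (k - l) + C11_norm Y l"
proof -
  have eq: "k - l = (\<lambda>y. k y + (- 1) * l y)" "k = (\<lambda>y. (k - l) y + 1 * l y)" by auto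
  show d: "k - l \<in> C11_space Y" unfolding eq(1) by (rule C11_norm_add_scale(1)[OF assms])
  show "C11_norm Y (k - l) \<le> C11_norm Y k + C11_norm Y l"
    using C11_norm_add_scale(2)[OF assms, of "-1"] eq(1) by simp
  show "C11_norm Y k \<le> C11_norm Y (k - l) + C11_norm Y l"
    using C11_norm_add_scale(2)[OF d assms(2), of 1] by simp
qed

lemma Linf_C11_diff_AE:
  assumes k: "k \<in> Linf_space M (C11_space Y) (C11_norm Y)" and l: "l \<in> Linf_space M (C11_space Y) (C11_norm Y)"
  shows "AE x in M. C11_norm Y (k x - l x) \<le> Linf_norm M (C11_norm Y) (k - l)"
proof -
  obtain A where A: "AE x in M. C11_norm Y (k x) \<le> A" using k by (auto simp: Linf_space_def)
  obtain B where B: "AE x in M. C11_norm Y (l x) \<le> B" using l by (auto simp: Linf_space_def)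
  have "AE x in M. k x \<in> C11_space Y" "AE x in M. l x \<in> C11_space Y"
    using k l by (auto simp: Linf_space_def strongly_measurable_def)
  then have "AE x in M. C11_norm Y ((k - l) x) \<le> A + B"
    using A B by eventually_elim (use C11_norm_diff(2) in fastforce)
  from AE_le_Linf_norm[where N="C11_norm Y" and v="k - l", OF this] show ?thesis by simp
qed

text \<open>Replacing \<open>k\<close> by simple functions with values in the class leaves finitely
  many functions of \<open>m x\<close> on measurable pieces. Evaluation at a point of
  \<open>Y\<close> is controlled by the norm, so these compositions converge almost
  everywhere.\<close>

lemma superposition_measurable:
  fixes m :: "'b::euclidean_space \<Rightarrow> 'a"
  assumes S: "S \<in> sets lebesgue" and k: "k \<in> Linf_space (lebesgue_on S) (C11_space Y) (C11_norm Y)"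
    and m: "m \<in> borel_measurable (lebesgue_on S)" "AE x in lebesgue_on S. m x \<in> Y"
  shows "(\<lambda>x. k x (m x)) \<in> borel_measurable (lebesgue_on S)"
proof -
  let ?M = "lebesgue_on S"
  have kC: "AE x in ?M. k x \<in> C11_space Y" using k by (auto simp: Linf_space_def strongly_measurable_def)
  obtain s where s: "\<And>n::nat. simple_function ?M (s n)" "\<And>n. s n ` space ?M \<subseteq> C11_space Y"
    "AE x in ?M. (\<lambda>n. C11_norm Y (s n x - k x)) \<longlonglongrightarrow> 0"
  proof -
    have "\<exists>s. (\<forall>n::nat. simple_function ?M (s n) \<and> s n ` space ?M \<subseteq> C11_space Y) \<and>
      (AE x in ?M. (\<lambda>n. C11_norm Y (s n x - k x)) \<longlonglongrightarrow> 0)"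
      using k by (simp add: Linf_space_def strongly_measurable_def)
    then show thesis using that by blast
  qed
  have Yb: "Y \<in> sets borel" using Y(2) by (intro borel_closed compact_imp_closed)
  \<comment> \<open>Members of the class are continuous on \<open>Y\<close> only and arbitrary
    elsewhere; the indicator of \<open>Y\<close> makes each summand Borel in \<open>m x\<close> and
    changes it only on a null set.\<close>
  define F where "F n x = (\<Sum>v\<in>s n ` space ?M. indicator (s n -` {v} \<inter> space ?M) x * (indicator Y (m x) *\<^sub>R v (m x)))" for n x
  show ?thesis
  proof (rule borel_measurable_lebesgue_on_AE_LIMSEQ[OF S])
    show "F n \<in> borel_measurable ?M" for n
      unfolding F_def
    proof (intro borel_measurable_sum borel_measurable_times)
      fix v assume v: "v \<in> s n ` space ?M"
      have "s n -` {v} \<inter> space ?M \<in> sets ?M" by (rule simple_functionD(2)[OF s(1)])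
      then show "indicator (s n -` {v} \<inter> space ?M) \<in> borel_measurable ?M" by (rule borel_measurable_indicator)
      have "continuous_on Y v" using v s(2) by (intro C11_continuous) blast
      then have "(\<lambda>y. indicator Y y *\<^sub>R v y) \<in> borel_measurable borel"
        using Yb by (intro borel_measurable_continuous_on_indicator) auto
      then show "(\<lambda>x. indicator Y (m x) *\<^sub>R v (m x)) \<in> borel_measurable ?M"
        by (rule measurable_compose[OF m(1)])
    qed
    show "AE x in ?M. (\<lambda>n. F n x) \<longlonglongrightarrow> k x (m x)"
      using m(2) kC s(3) AE_space
    proof eventually_elim
      case (elim x)
      have Fx: "F n x = s n x (m x)" for n
      proof -
        have "F n x = (\<Sum>v\<in>s n ` space ?M. if v = s n x then s n x (m x) else 0)"
          unfolding F_def using elim(1,4) by (intro sum.cong) (auto simp: indicator_def)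
        also have "\<dots> = s n x (m x)"
          using elim(4) simple_functionD(1)[OF s(1)] by simp
        finally show ?thesis .
      qed
      have "\<bar>F n x - k x (m x)\<bar> \<le> C11_norm Y (s n x - k x)" for n
      proof -
        have "s n x \<in> C11_space Y" using s(2)[of n] elim(4) by blast
        from C11_norm_bounds(1)[OF C11_norm_diff(1)[OF this elim(2)] elim(1)]
        show ?thesis by (simp add: Fx)
      qed
      then have "(\<lambda>n. F n x - k x (m x)) \<longlonglongrightarrow> 0"
        by (intro Lim_null_comparison[OF _ elim(3)]) (simp add: eventually_sequentially)
      then show ?case by (simp add: LIM_zero_iff)
    qed
  qed
qed

end

section \<open>Weak time derivatives of functions with values in an essentially bounded class\<close>

text \<open>The integral is not divided by the measure of \<open>B\<close>, so null sets cause no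
  trouble and bounds carry the factor \<open>measure (lebesgue_on \<Omega>) B\<close>.\<close>

definition mean_on :: "(real^2) set \<Rightarrow> (real^2) set \<Rightarrow> (real^2 \<Rightarrow> real) \<Rightarrow> real" where
  "mean_on \<Omega> B v = (\<integral>x. indicator B x * v x \<partial>lebesgue_on \<Omega>)"

locale bounded_domain =
  fixes \<Omega> :: "(real^2) set"
  assumes \<Omega>: "open \<Omega>" "bounded \<Omega>"
begin

lemmas M = finite_measure_lebesgue_on_open_bounded[OF \<Omega>]

lemma Linf_AE_norm:
  assumes "v \<in> Linf \<Omega>"
  shows "AE x in lebesgue_on \<Omega>. \<bar>v x\<bar> \<le> normLinf \<Omega> v"
proof -
  obtain C where "AE x in lebesgue_on \<Omega>. \<bar>v x\<bar> \<le> C" using assms by (auto simp: Linf_space_iff[OF M(1)])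
  then show ?thesis by (rule AE_le_Linf_norm)
qed

lemma Linf_integrable_indicator:
  assumes v: "v \<in> Linf \<Omega>" and B: "B \<in> sets (lebesgue_on \<Omega>)"
  shows "integrable (lebesgue_on \<Omega>) (\<lambda>x. indicator B x * v x)"
proof -
  interpret finite_measure "lebesgue_on \<Omega>" by (rule M)
  have vm: "v \<in> borel_measurable (lebesgue_on \<Omega>)" using v by (simp add: Linf_space_iff[OF M(1)])
  show ?thesis
  proof (rule integrable_const_bound)
    show "AE x in lebesgue_on \<Omega>. norm (indicator B x * v x) \<le> normLinf \<Omega> v"
      using Linf_AE_norm[OF v]
    proof eventually_elim
      case (elim x)
      have "norm (indicator B x * v x) \<le> \<bar>v x\<bar>" by (simp add: indicator_def)
      then show ?case using elim by simp
    qed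
    show "(\<lambda>x. indicator B x * v x) \<in> borel_measurable (lebesgue_on \<Omega>)"
      using vm B by (intro borel_measurable_times borel_measurable_indicator)
  qed
qed

lemma mean_on_linear:
  assumes v: "v \<in> Linf \<Omega>" and w: "w \<in> Linf \<Omega>" and B: "B \<in> sets (lebesgue_on \<Omega>)"
  shows "mean_on \<Omega> B (\<lambda>x. a * v x + b * w x) = a * mean_on \<Omega> B v + b * mean_on \<Omega> B w"
proof -
  have "mean_on \<Omega> B (\<lambda>x. a * v x + b * w x)
    = (\<integral>x. a * (indicator B x * v x) + b * (indicator B x * w x) \<partial>lebesgue_on \<Omega>)"
    unfolding mean_on_def by (intro Bochner_Integration.integral_cong) (auto simp: algebra_simps)
  also have "\<dots> = a * mean_on \<Omega> B v + b * mean_on \<Omega> B w"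
    unfolding mean_on_def using Linf_integrable_indicator[OF v B] Linf_integrable_indicator[OF w B]
    by (subst Bochner_Integration.integral_add) (simp_all only: integrable_mult_right integral_mult_right_zero)
  finally show ?thesis .
qed

lemma mean_on_scale: "mean_on \<Omega> B (\<lambda>x. c * v x) = c * mean_on \<Omega> B v"
  by (simp add: mean_on_def mult.left_commute)

lemma mean_on_diff:
  assumes "v \<in> Linf \<Omega>" "w \<in> Linf \<Omega>" "B \<in> sets (lebesgue_on \<Omega>)"
  shows "mean_on \<Omega> B (\<lambda>x. v x - w x) = mean_on \<Omega> B v - mean_on \<Omega> B w"
  using mean_on_linear[OF assms, of 1 "-1"] by simp

lemma mean_on_bound:
  assumes v: "v \<in> Linf \<Omega>" and B: "B \<in> sets (lebesgue_on \<Omega>)" and C: "AE x in lebesgue_on \<Omega>. \<bar>v x\<bar> \<le> C"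
  shows "\<bar>mean_on \<Omega> B v\<bar> \<le> C * measure (lebesgue_on \<Omega>) B"
proof -
  interpret finite_measure "lebesgue_on \<Omega>" by (rule M)
  have "\<bar>mean_on \<Omega> B v\<bar> \<le> (\<integral>x. \<bar>indicator B x * v x\<bar> \<partial>lebesgue_on \<Omega>)"
    unfolding mean_on_def by (rule integral_abs_bound)
  also have "\<dots> \<le> (\<integral>x. C * indicator B x \<partial>lebesgue_on \<Omega>)"
  proof (rule integral_mono_AE)
    show "integrable (lebesgue_on \<Omega>) (\<lambda>x. \<bar>indicator B x * v x\<bar>)"
      by (rule integrable_abs[OF Linf_integrable_indicator[OF v B]])
    show "integrable (lebesgue_on \<Omega>) (\<lambda>x. C * indicator B x)"
      using B by (intro integrable_mult_right integrable_real_indicator) (auto simp: emeasure_eq_measure)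
    show "AE x in lebesgue_on \<Omega>. \<bar>indicator B x * v x\<bar> \<le> C * indicator B x"
      using C by eventually_elim (simp add: indicator_def)
  qed
  also have "\<dots> = C * measure (lebesgue_on \<Omega>) B"
    using sets.sets_into_space[OF B] by (simp add: Int_absorb2)
  finally show ?thesis .
qed

lemma mean_on_norm_bound:
  assumes v: "v \<in> Linf \<Omega>" and B: "B \<in> sets (lebesgue_on \<Omega>)"
  shows "\<bar>mean_on \<Omega> B v\<bar> \<le> (measure (lebesgue_on \<Omega>) B + 1) * normLinf \<Omega> v"
proof -
  have n: "0 \<le> normLinf \<Omega> v" by (rule Linf_norm_nonneg[where N=abs, OF Linf_AE_norm[OF v]])
  have "\<bar>mean_on \<Omega> B v\<bar> \<le> normLinf \<Omega> v * measure (lebesgue_on \<Omega>) B"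
    by (rule mean_on_bound[OF v B Linf_AE_norm[OF v]])
  then show ?thesis using n by (simp add: algebra_simps)
qed

text \<open>The functional is Lipschitz for the essential norm, so it maps approximating simple
  functions to real simple functions converging almost everywhere.\<close>

lemma mean_on_strongly_measurable:
  fixes I :: "real set"
  assumes I: "I \<in> sets lebesgue" and B: "B \<in> sets (lebesgue_on \<Omega>)"
    and u: "strongly_measurable (lebesgue_on I) (Linf \<Omega>) (normLinf \<Omega>) u"
  shows "(\<lambda>t. mean_on \<Omega> B (u t)) \<in> borel_measurable (lebesgue_on I)"
proof -
  have "\<exists>s. (\<forall>n::nat. simple_function (lebesgue_on I) (s n) \<and> s n ` space (lebesgue_on I) \<subseteq> Linf \<Omega>) \<and>
      (AE t in lebesgue_on I. (\<lambda>n. normLinf \<Omega> (s n t - u t)) \<longlonglongrightarrow> 0)"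
    and uL: "AE t in lebesgue_on I. u t \<in> Linf \<Omega>"
    using u by (auto simp: strongly_measurable_def)
  then obtain s where s: "\<And>n::nat. simple_function (lebesgue_on I) (s n)" "\<And>n. s n ` space (lebesgue_on I) \<subseteq> Linf \<Omega>"
      "AE t in lebesgue_on I. (\<lambda>n. normLinf \<Omega> (s n t - u t)) \<longlonglongrightarrow> 0"
    by blast
  show ?thesis
  proof (rule borel_measurable_lebesgue_on_AE_LIMSEQ[OF I])
    show "(\<lambda>t. mean_on \<Omega> B (s n t)) \<in> borel_measurable (lebesgue_on I)" for n
      using simple_function_compose[OF s(1), of "mean_on \<Omega> B"]
      by (intro borel_measurable_simple_function) (simp add: o_def)
    show "AE t in lebesgue_on I. (\<lambda>n. mean_on \<Omega> B (s n t)) \<longlonglongrightarrow> mean_on \<Omega> B (u t)"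
      using uL s(3) AE_space
    proof eventually_elim
      case (elim t)
      have sL: "s n t \<in> Linf \<Omega>" for n using s(2)[of n] elim(3) by blast
      have "\<bar>mean_on \<Omega> B (s n t) - mean_on \<Omega> B (u t)\<bar> \<le> normLinf \<Omega> (s n t - u t) * (measure (lebesgue_on \<Omega>) B + 1)" for n
        using mean_on_norm_bound[OF Linf_diff[OF M(1) sL elim(1)] B, of n] mean_on_diff[OF sL elim(1) B, of n]
        by (simp add: fun_diff_def mult.commute)
      moreover have "(\<lambda>n. normLinf \<Omega> (s n t - u t) * (measure (lebesgue_on \<Omega>) B + 1)) \<longlonglongrightarrow> 0"
        using elim(2) by (rule tendsto_mult_left_zero)
      ultimately have "(\<lambda>n. mean_on \<Omega> B (s n t) - mean_on \<Omega> B (u t)) \<longlonglongrightarrow> 0"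
        by (intro Lim_null_comparison[OF always_eventually, of "\<lambda>n. mean_on \<Omega> B (s n t) - mean_on \<Omega> B (u t)"]) simp_all
      then show ?case by (simp add: LIM_zero_iff)
    qed
  qed
qed

lemma mean_on_sum:
  assumes "finite A" "\<And>v. v \<in> A \<Longrightarrow> v \<in> Linf \<Omega>" and B: "B \<in> sets (lebesgue_on \<Omega>)"
  shows "(\<lambda>x. \<Sum>v\<in>A. c v * v x) \<in> Linf \<Omega>"
    "mean_on \<Omega> B (\<lambda>x. \<Sum>v\<in>A. c v * v x) = (\<Sum>v\<in>A. c v * mean_on \<Omega> B v)"
  using assms(1,2)
proof (induction A)
  case empty
  { case 1 show ?case by (simp add: Linf_const[OF M(1)]) }
  { case 2 show ?case by (simp add: mean_on_def) }
next
  case (insert v A)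
  { case 1
    show ?case
      using Linf_linear[OF M(1), of v "\<lambda>x. \<Sum>v\<in>A. c v * v x" "c v" 1] insert 1 by simp }
  { case 2
    show ?case
      using mean_on_linear[of v "\<lambda>x. \<Sum>v\<in>A. c v * v x" B "c v" 1] insert 2 B by simp }
qed

text \<open>A bounded functional commutes with the Bochner integral: it does so on simple functions
  by linearity, and both approximations in the definition of the integral survive its
  application.\<close>

lemma mean_on_bochner_integral:
  fixes I :: "real set"
  assumes I: "I \<in> lmeasurable" and B: "B \<in> sets (lebesgue_on \<Omega>)"
    and u: "has_bochner_integral_in (lebesgue_on I) (Linf \<Omega>) (normLinf \<Omega>) u J"
  shows "integrable (lebesgue_on I) (\<lambda>t. mean_on \<Omega> B (u t))"
    "(\<integral>t. mean_on \<Omega> B (u t) \<partial>lebesgue_on I) = mean_on \<Omega> B J"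
proof -
  let ?I = "lebesgue_on I" and ?F = "mean_on \<Omega> B"
  interpret I: finite_measure ?I by (rule finite_measure_lebesgue_on[OF I])
  have Is: "I \<in> sets lebesgue" using I by auto
  have sm: "strongly_measurable ?I (Linf \<Omega>) (normLinf \<Omega>) u" and J: "J \<in> Linf \<Omega>"
    using u by (auto simp: has_bochner_integral_in_def)
  have uL: "AE t in ?I. u t \<in> Linf \<Omega>" using sm by (simp add: strongly_measurable_def)
  have "\<exists>s. (\<forall>n::nat. simple_function ?I (s n) \<and> s n ` space ?I \<subseteq> Linf \<Omega>) \<and>
          (\<lambda>n. \<integral>\<^sup>+ t. ennreal (normLinf \<Omega> (s n t - u t)) \<partial>?I) \<longlonglongrightarrow> 0 \<and>
          (\<lambda>n. normLinf \<Omega> (simple_integral_fun ?I (s n) - J)) \<longlonglongrightarrow> 0"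
    using u by (simp add: has_bochner_integral_in_def)
  then obtain s where s: "\<And>n::nat. simple_function ?I (s n)" "\<And>n. s n ` space ?I \<subseteq> Linf \<Omega>"
      "(\<lambda>n. \<integral>\<^sup>+ t. ennreal (normLinf \<Omega> (s n t - u t)) \<partial>?I) \<longlonglongrightarrow> 0"
      "(\<lambda>n. normLinf \<Omega> (simple_integral_fun ?I (s n) - J)) \<longlonglongrightarrow> 0"
    by blast
  \<comment> \<open>A bound for the functional; the added 1 keeps it positive when \<open>B\<close>
    is null, and dividing by \<open>C\<close> makes the functional nonexpansive.\<close>
  define C where "C = measure (lebesgue_on \<Omega>) B + 1"
  have C: "C > 0" unfolding C_def using measure_nonneg[of "lebesgue_on \<Omega>" B] by linarith
  have um: "(\<lambda>t. ?F (u t)) \<in> borel_measurable ?I" by (rule mean_on_strongly_measurable[OF Is B sm])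
  have sf: "simple_function ?I (\<lambda>t. ?F (s n t))" for n
    using simple_function_compose[OF s(1), of ?F] by (simp add: o_def)
  have sm: "(\<lambda>t. ?F (s n t)) \<in> borel_measurable ?I" for n
    by (rule borel_measurable_simple_function[OF sf])
  have sint: "has_bochner_integral ?I (\<lambda>t. ?F (s n t)) (?F (simple_integral_fun ?I (s n)))" for n
  proof -
    let ?A = "s n ` space ?I"
    have fin: "finite ?A" by (rule simple_functionD(1)[OF s(1)])
    have "has_bochner_integral ?I (\<lambda>t. \<Sum>v\<in>?A. indicator (s n -` {v} \<inter> space ?I) t * ?F v)
        (\<Sum>v\<in>?A. measure ?I (s n -` {v} \<inter> space ?I) * ?F v)"
    proof (intro has_bochner_integral_sum has_bochner_integral_mult_left has_bochner_integral_real_indicator)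
      fix v assume "v \<in> ?A"
      show "s n -` {v} \<inter> space ?I \<in> sets ?I" by (rule simple_functionD(2)[OF s(1)])
      show "emeasure ?I (s n -` {v} \<inter> space ?I) < \<infinity>" by (simp add: I.emeasure_eq_measure)
    qed
    note sum1 = this
    have sum2: "(\<Sum>v\<in>?A. measure ?I (s n -` {v} \<inter> space ?I) * ?F v) = ?F (simple_integral_fun ?I (s n))"
      unfolding simple_integral_fun_def
      by (rule mean_on_sum(2)[symmetric, OF fin _ B]) (use s(2) in blast)
    have sum3: "(\<Sum>v\<in>?A. indicator (s n -` {v} \<inter> space ?I) t * ?F v) = ?F (s n t)" if "t \<in> space ?I" for t
    proof -
      have "(\<Sum>v\<in>?A. indicator (s n -` {v} \<inter> space ?I) t * ?F v) = (\<Sum>v\<in>?A. if v = s n t then ?F v else 0)"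
        using that by (intro sum.cong) (auto simp: indicator_def)
      also have "\<dots> = ?F (s n t)" using that fin by simp
      finally show ?thesis .
    qed
    show ?thesis
      by (rule has_bochner_integral_cong[THEN iffD1, OF refl _ sum2 sum1]) (rule sum3)
  qed
  have le: "(\<integral>\<^sup>+ t. ennreal (norm (?F (s n t) / C - ?F (u t) / C)) \<partial>?I)
      \<le> (\<integral>\<^sup>+ t. ennreal (normLinf \<Omega> (s n t - u t)) \<partial>?I)" for n
  proof (rule nn_integral_mono_AE)
    show "AE t in ?I. ennreal (norm (?F (s n t) / C - ?F (u t) / C)) \<le> ennreal (normLinf \<Omega> (s n t - u t))"
      using uL AE_space
    proof eventually_elim
      case (elim t)
      have sL: "s n t \<in> Linf \<Omega>" using s(2)[of n] elim(2) by blast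
      have "\<bar>?F (s n t) - ?F (u t)\<bar> \<le> C * normLinf \<Omega> (s n t - u t)"
        using mean_on_norm_bound[OF Linf_diff[OF M(1) sL elim(1)] B] mean_on_diff[OF sL elim(1) B]
        by (simp add: fun_diff_def C_def)
      then have "\<bar>?F (s n t) / C - ?F (u t) / C\<bar> \<le> normLinf \<Omega> (s n t - u t)"
        using C by (simp add: diff_divide_distrib[symmetric] abs_divide divide_le_eq mult.commute)
      then show ?case by (intro ennreal_leI) simp
    qed
  qed
  have lim: "(\<lambda>n. \<integral>\<^sup>+ t. ennreal (norm (?F (s n t) / C - ?F (u t) / C)) \<partial>?I) \<longlonglongrightarrow> 0"
    by (rule tendsto_sandwich[OF always_eventually always_eventually tendsto_const s(3)]) (intro allI zero_le, intro allI le)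
  have si: "integrable ?I (\<lambda>t. ?F (s n t) / C)" for n
    using sint[of n] by (auto simp: has_bochner_integral_iff)
  have ui: "integrable ?I (\<lambda>t. ?F (u t) / C)"
  proof -
    \<comment> \<open>Integrability of the limit needs just one integrable approximant at finite
      distance.\<close>
    have "\<forall>\<^sub>F n in sequentially. (\<integral>\<^sup>+ t. ennreal (norm (?F (s n t) / C - ?F (u t) / C)) \<partial>?I) < 1"
      using lim by (rule order_tendstoD) simp
    then obtain n where n: "(\<integral>\<^sup>+ t. ennreal (norm (?F (s n t) / C - ?F (u t) / C)) \<partial>?I) < 1"
      by (auto simp: eventually_sequentially)
    have "integrable ?I (\<lambda>t. ?F (s n t) / C - ?F (u t) / C)"
    proof (rule integrableI_bounded)
      show "(\<lambda>t. ?F (s n t) / C - ?F (u t) / C) \<in> borel_measurable ?I"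
        by (intro borel_measurable_diff borel_measurable_divide borel_measurable_const sm um)
      show "(\<integral>\<^sup>+ t. ennreal (norm (?F (s n t) / C - ?F (u t) / C)) \<partial>?I) < \<infinity>"
        using n by (rule order_less_trans) simp
    qed
    from Bochner_Integration.integrable_diff[OF si[of n] this] show ?thesis by simp
  qed
  have "integrable ?I (\<lambda>t. C * (?F (u t) / C))" using ui by (rule integrable_mult_right)
  then show "integrable ?I (\<lambda>t. ?F (u t))" using C by simp
  have "(\<lambda>n. \<integral>t. ?F (s n t) / C \<partial>?I) \<longlonglongrightarrow> (\<integral>t. ?F (u t) / C \<partial>?I)"
    by (rule tendsto_L1_int[OF si ui lim])
  moreover have "(\<integral>t. ?F (s n t) / C \<partial>?I) = ?F (simple_integral_fun ?I (s n)) / C" for n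
    using sint[of n] by (simp add: has_bochner_integral_iff)
  moreover have "(\<integral>t. ?F (u t) / C \<partial>?I) = (\<integral>t. ?F (u t) \<partial>?I) / C" by simp
  ultimately have 1: "(\<lambda>n. ?F (simple_integral_fun ?I (s n)) / C) \<longlonglongrightarrow> (\<integral>t. ?F (u t) \<partial>?I) / C"
    by (simp only:)
  have "(\<lambda>n. ?F (simple_integral_fun ?I (s n)) / C - ?F J / C) \<longlonglongrightarrow> 0"
  proof (rule Lim_null_comparison[OF always_eventually s(4)], rule allI)
    fix n
    have "simple_integral_fun ?I (s n) \<in> Linf \<Omega>"
      unfolding simple_integral_fun_def
      by (rule mean_on_sum(1)[OF simple_functionD(1)[OF s(1)] _ B]) (use s(2) in blast)
    then have "\<bar>?F (simple_integral_fun ?I (s n)) - ?F J\<bar> \<le> C * normLinf \<Omega> (simple_integral_fun ?I (s n) - J)"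
      using mean_on_norm_bound[OF Linf_diff[OF M(1) _ J] B] mean_on_diff[OF _ J B]
      by (simp add: fun_diff_def C_def)
    then show "norm (?F (simple_integral_fun ?I (s n)) / C - ?F J / C) \<le> normLinf \<Omega> (simple_integral_fun ?I (s n) - J)"
      using C by (simp add: diff_divide_distrib[symmetric] abs_divide divide_le_eq mult.commute)
  qed
  then have "(\<lambda>n. ?F (simple_integral_fun ?I (s n)) / C) \<longlonglongrightarrow> ?F J / C" by (simp add: LIM_zero_iff)
  from LIMSEQ_unique[OF 1 this] show "(\<integral>t. ?F (u t) \<partial>?I) = ?F J" using C by simp
qed

end

section \<open>The fundamental theorem for weak derivatives on an interval\<close>

text \<open>The derivative of \<open>A\<close> is a probability density concentrated on
  \<open>{\<alpha>..\<beta>}\<close>, so the integral is an average of values of \<open>U\<close>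
  within \<open>\<epsilon>\<close> of \<open>c\<close>.\<close>

lemma smooth_monotone_average:
  fixes A U :: "real \<Rightarrow> real"
  assumes A: "smooth A" "mono A" "\<And>t. t \<le> \<alpha> \<Longrightarrow> A t = 0" "\<And>t. \<beta> \<le> t \<Longrightarrow> A t = 1"
    and ab: "\<alpha> < \<beta>" "0 < \<alpha>" "\<beta> < T"
    and U: "U \<in> borel_measurable (lebesgue_on {0<..<T})" "\<And>t. t \<in> {0<..<T} \<Longrightarrow> \<bar>U t\<bar> \<le> K"
    and e: "\<And>t. t \<in> {\<alpha>..\<beta>} \<Longrightarrow> \<bar>U t - c\<bar> \<le> \<epsilon>"
  shows "integrable (lebesgue_on {0<..<T}) (\<lambda>t. deriv A t * U t)"
    "\<bar>(\<integral>t. deriv A t * U t \<partial>lebesgue_on {0<..<T}) - c\<bar> \<le> \<epsilon>"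
proof -
  let ?I = "lebesgue_on {0<..<T}"
  note d = smooth_DERIV[OF A(1)]
  have A'b: "deriv A \<in> borel_measurable borel"
    by (intro borel_measurable_continuous_onI smooth_continuous smooth_deriv A)
  have A'0: "0 \<le> deriv A t" for t
    by (rule mono_on_imp_deriv_nonneg[OF _ d, of UNIV]) (use A(2) in auto)
  have A'z: "deriv A t = 0" if t: "t \<notin> {\<alpha>..\<beta>}" for t
  proof (cases "t < \<alpha>")
    case True
    show ?thesis
    proof (rule DERIV_local_const[OF d[of t]])
      show "0 < \<alpha> - t" using True by simp
      show "\<forall>y. \<bar>t - y\<bar> < \<alpha> - t \<longrightarrow> A t = A y" using True by (auto simp: A(3))
    qed
  next
    case False
    then have t: "\<beta> < t" using t by simp
    show ?thesis
    proof (rule DERIV_local_const[OF d[of t]])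
      show "0 < t - \<beta>" using t by simp
      show "\<forall>y. \<bar>t - y\<bar> < t - \<beta> \<longrightarrow> A t = A y" using t by (auto simp: A(4))
    qed
  qed
  have "has_bochner_integral lborel (\<lambda>t. deriv A t * indicator {\<alpha>..\<beta>} t) (A \<beta> - A \<alpha>)"
    by (rule has_bochner_integral_FTC_Icc_nonneg) (use A'b A'0 d ab in auto)
  moreover have "(\<lambda>t. deriv A t * indicator {\<alpha>..\<beta>} t) = deriv A"
    using A'z by (auto simp: indicator_def fun_eq_iff)
  ultimately have hb: "has_bochner_integral lborel (deriv A) 1" using A(3)[of \<alpha>] A(4)[of \<beta>] by simp
  have A'I: "(\<integral>t. deriv A t \<partial>?I) = 1"
  proof -
    have "deriv A t = 0" if "t \<notin> {0<..<T}" for t using that ab by (intro A'z) auto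
    then have "(\<integral>t. deriv A t \<partial>?I) = (\<integral>t. deriv A t \<partial>lborel)"
      by (intro integral_lebesgue_on_eq_lborel[OF A'b]) auto
    then show ?thesis using hb by (simp add: has_bochner_integral_iff)
  qed
  have A'i: "integrable ?I (deriv A)"
  proof -
    have "integrable lebesgue (deriv A)"
      using hb A'b by (simp add: has_bochner_integral_iff integrable_completion)
    moreover have "(\<lambda>t. indicator {0<..<T} t *\<^sub>R deriv A t) = deriv A"
    proof
      fix t show "indicator {0<..<T} t *\<^sub>R deriv A t = deriv A t"
        using A'z[of t] ab by (cases "t \<in> {\<alpha>..\<beta>}") (auto simp: indicator_def)
    qed
    ultimately show ?thesis by (simp add: integrable_restrict_space)
  qed
  have A'm: "deriv A \<in> borel_measurable ?I" by (rule borel_measurable_lebesgue_onI[OF A'b])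
  show int: "integrable ?I (\<lambda>t. deriv A t * U t)"
  proof (rule Bochner_Integration.integrable_bound)
    show "integrable ?I (\<lambda>t. \<bar>K\<bar> * deriv A t)" using A'i by simp
    show "(\<lambda>t. deriv A t * U t) \<in> borel_measurable ?I" using A'm U(1) by (rule borel_measurable_times)
    show "AE t in ?I. norm (deriv A t * U t) \<le> norm (\<bar>K\<bar> * deriv A t)"
    proof (rule AE_I2)
      fix t assume "t \<in> space ?I"
      then have "\<bar>U t\<bar> \<le> \<bar>K\<bar>" using U(2)[of t] by simp
      then have "\<bar>U t\<bar> * deriv A t \<le> \<bar>K\<bar> * deriv A t" using A'0 by (rule mult_right_mono)
      then show "norm (deriv A t * U t) \<le> norm (\<bar>K\<bar> * deriv A t)" using A'0[of t] by (simp add: abs_mult mult.commute)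
    qed
  qed
  have "(\<integral>t. deriv A t * U t \<partial>?I) - c = (\<integral>t. deriv A t * U t \<partial>?I) - (\<integral>t. deriv A t * c \<partial>?I)"
    using A'I by simp
  also have "\<dots> = (\<integral>t. deriv A t * U t - deriv A t * c \<partial>?I)"
    by (rule Bochner_Integration.integral_diff[symmetric, OF int]) (use A'i in simp)
  also have "\<bar>\<dots>\<bar> \<le> (\<integral>t. \<bar>deriv A t * U t - deriv A t * c\<bar> \<partial>?I)" by (rule integral_abs_bound)
  also have "\<dots> \<le> (\<integral>t. deriv A t * \<epsilon> \<partial>?I)"
  proof (rule integral_mono)
    show "integrable ?I (\<lambda>t. \<bar>deriv A t * U t - deriv A t * c\<bar>)"
      by (intro integrable_abs Bochner_Integration.integrable_diff int integrable_mult_left A'i)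
    show "integrable ?I (\<lambda>t. deriv A t * \<epsilon>)" using A'i by simp
    fix t
    show "\<bar>deriv A t * U t - deriv A t * c\<bar> \<le> deriv A t * \<epsilon>"
    proof (cases "t \<in> {\<alpha>..\<beta>}")
      case True
      have "\<bar>deriv A t * U t - deriv A t * c\<bar> = deriv A t * \<bar>U t - c\<bar>"
        using A'0[of t] by (simp add: right_diff_distrib[symmetric] abs_mult)
      also have "\<dots> \<le> deriv A t * \<epsilon>" by (intro mult_left_mono e[OF True] A'0)
      finally show ?thesis .
    qed (simp add: A'z)
  qed
  also have "\<dots> = \<epsilon>" using A'I by simp
  finally show "\<bar>(\<integral>t. deriv A t * U t \<partial>?I) - c\<bar> \<le> \<epsilon>" .
qed

lemma cutoff_test_function:
  assumes h: "smooth_step h" and ab: "0 \<le> a" "a < b" "b \<le> T"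
  shows "cutoff h a b n \<in> test_functions {0<..<T}"
proof (rule test_functionsI[OF smooth_cutoff[OF h]])
  define e where "e = (b - a) / (real n + 4)"
  have e: "0 < e" using cutoff_values(1)[OF h ab(2)] by (simp add: e_def)
  show "compact {a + e..b - e}" by simp
  show "{a + e..b - e} \<subseteq> {0<..<T}" using e ab by auto
  show "cutoff h a b n t = 0" if "t \<notin> {a + e..b - e}" for t
    using that by (intro cutoff_eq_0[OF h ab(2)]) (auto simp: e_def)
qed

text \<open>The test functions are the cut-offs of \<open>(a, b)\<close>. Their supports stay inside
  \<open>(0, T)\<close> even for \<open>a = 0\<close> and \<open>b = T\<close>, and continuity of
  \<open>U\<close> on the closed interval then gives the end point values.\<close>

lemma weak_derivative_integral:
  fixes U W :: "real \<Rightarrow> real"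
  assumes h: "smooth_step h" and U: "continuous_on {0..T} U" and W: "integrable (lebesgue_on {0<..<T}) W"
    and weak: "\<And>\<phi>. \<phi> \<in> test_functions {0<..<T} \<Longrightarrow>
      (\<integral>t. deriv \<phi> t * U t \<partial>lebesgue_on {0<..<T}) = - (\<integral>t. \<phi> t * W t \<partial>lebesgue_on {0<..<T})"
    and ab: "0 \<le> a" "a < b" "b \<le> T"
  shows "U b - U a = (\<integral>t. indicator {a<..<b} t * W t \<partial>lebesgue_on {0<..<T})"
proof -
  let ?I = "lebesgue_on {0<..<T}"
  define e where "e n = (b - a) / (real n + 4)" for n :: nat
  have e: "0 < e n" "a + 2 * e n \<le> b - 2 * e n" for n
    using cutoff_values(1,2)[OF h ab(2), of n] by (auto simp: e_def)
  have e0: "e \<longlonglongrightarrow> 0" unfolding e_def by real_asymp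
  define A where "A n t = h ((t - a) / e n - 1)" for n t
  define B where "B n t = h ((t - b) / e n + 2)" for n t
  note hD = smooth_stepD[OF h]
  have sA: "smooth (A n)" and sB: "smooth (B n)" for n
  proof -
    have "A n = (\<lambda>t. h ((- a / e n - 1) + inverse (e n) * t))" "B n = (\<lambda>t. h ((- b / e n + 2) + inverse (e n) * t))"
      unfolding A_def B_def
      by (rule ext, rule arg_cong[where f=h], simp add: divide_inverse algebra_simps)+
    then show "smooth (A n)" "smooth (B n)" using smooth_affine_real[OF hD(1)] by auto
  qed
  have mA: "mono (A n)" and mB: "mono (B n)" for n
    unfolding A_def B_def using e(1)[of n] by (auto intro!: monoI hD(2) simp: divide_right_mono)
  have A0: "A n t = 0" if "t \<le> a + e n" for n t
    unfolding A_def using e(1)[of n] that by (intro hD(3)) (simp add: divide_le_eq)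
  have A1: "A n t = 1" if "a + 2 * e n \<le> t" for n t
    unfolding A_def using e(1)[of n] that by (intro hD(4)) (simp add: le_divide_eq)
  have B0: "B n t = 0" if "t \<le> b - 2 * e n" for n t
  proof -
    have "(t - b) / e n \<le> - 2" using e(1)[of n] that by (simp add: divide_le_eq)
    then show ?thesis unfolding B_def by (intro hD(3)) simp
  qed
  have B1: "B n t = 1" if "b - e n \<le> t" for n t
  proof -
    have "- 1 \<le> (t - b) / e n" using e(1)[of n] that by (simp add: le_divide_eq)
    then show ?thesis unfolding B_def by (intro hD(4)) simp
  qed
  have cut: "cutoff h a b n = (\<lambda>t. A n t - B n t)" for n
    by (simp add: fun_eq_iff cutoff_def A_def B_def e_def Let_def)
  have dcut: "deriv (cutoff h a b n) t = deriv (A n) t - deriv (B n) t" for n t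
    unfolding cut by (intro DERIV_imp_deriv DERIV_diff smooth_DERIV sA sB)
  have "bounded (U ` {0..T})" by (intro compact_imp_bounded compact_continuous_image U) simp
  then obtain K where K: "\<forall>y\<in>U ` {0..T}. norm y \<le> K" unfolding bounded_iff by (rule exE)
  have UK: "\<bar>U t\<bar> \<le> K" if "t \<in> {0<..<T}" for t using K that by auto
  have Um: "U \<in> borel_measurable ?I"
    by (intro continuous_imp_measurable_on_sets_lebesgue continuous_on_subset[OF U]) auto
  have near: "\<forall>\<^sub>F n in sequentially. \<forall>t\<in>{0..T}. \<bar>t - p\<bar> \<le> 2 * e n \<longrightarrow> \<bar>U t - U p\<bar> \<le> \<epsilon>"
    if p: "p \<in> {0..T}" and \<epsilon>: "0 < \<epsilon>" for p \<epsilon>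
  proof -
    obtain \<delta> where \<delta>: "\<delta> > 0" "\<forall>t\<in>{0..T}. dist t p < \<delta> \<longrightarrow> dist (U t) (U p) < \<epsilon>"
      using U p \<epsilon> unfolding continuous_on_iff by blast
    have "(\<lambda>n. 2 * e n) \<longlonglongrightarrow> 0" using tendsto_mult_left[OF e0, of 2] by simp
    then have "\<forall>\<^sub>F n in sequentially. 2 * e n < \<delta>" by (rule order_tendstoD) (rule \<delta>)
    then show ?thesis
    proof eventually_elim
      case (elim n)
      show ?case
      proof (intro ballI impI)
        fix t assume t: "t \<in> {0..T}" "\<bar>t - p\<bar> \<le> 2 * e n"
        then have "dist t p < \<delta>" using elim by (simp add: dist_real_def)
        then have "dist (U t) (U p) < \<epsilon>" using \<delta>(2) t(1) by blast
        then show "\<bar>U t - U p\<bar> \<le> \<epsilon>" by (simp add: dist_real_def)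
      qed
    qed
  qed
  \<comment> \<open>The derivative of the cut-off is a unit mass on
    \<open>[a + e n, a + 2 * e n]\<close> minus a unit mass on
    \<open>[b - 2 * e n, b - e n]\<close>; both windows shrink to the end points.\<close>
  have "(\<lambda>n. \<integral>t. deriv (cutoff h a b n) t * U t \<partial>?I) \<longlonglongrightarrow> U a - U b"
  proof (rule tendstoI)
    fix \<epsilon> :: real assume "0 < \<epsilon>"
    then have \<epsilon>: "0 < \<epsilon> / 4" by simp
    have a: "a \<in> {0..T}" and b: "b \<in> {0..T}" using ab by auto
    show "\<forall>\<^sub>F n in sequentially. dist (\<integral>t. deriv (cutoff h a b n) t * U t \<partial>?I) (U a - U b) < \<epsilon>"
      using near[OF a \<epsilon>] near[OF b \<epsilon>]
    proof eventually_elim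
      case (elim n)
      have 1: "\<bar>U t - U a\<bar> \<le> \<epsilon> / 4" if "t \<in> {a + e n..a + 2 * e n}" for t
      proof -
        have "t \<in> {0..T}" "\<bar>t - a\<bar> \<le> 2 * e n" using that e[of n] ab by auto
        then show ?thesis using elim(1) by blast
      qed
      have 2: "\<bar>U t - U b\<bar> \<le> \<epsilon> / 4" if "t \<in> {b - 2 * e n..b - e n}" for t
      proof -
        have "t \<in> {0..T}" "\<bar>t - b\<bar> \<le> 2 * e n" using that e[of n] ab by auto
        then show ?thesis using elim(2) by blast
      qed
      have iA: "integrable ?I (\<lambda>t. deriv (A n) t * U t)" and vA: "\<bar>(\<integral>t. deriv (A n) t * U t \<partial>?I) - U a\<bar> \<le> \<epsilon> / 4"
        by (rule smooth_monotone_average[OF sA mA A0 A1 _ _ _ Um UK 1]; use e[of n] ab in simp)+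
      have iB: "integrable ?I (\<lambda>t. deriv (B n) t * U t)" and vB: "\<bar>(\<integral>t. deriv (B n) t * U t \<partial>?I) - U b\<bar> \<le> \<epsilon> / 4"
        by (rule smooth_monotone_average[OF sB mB B0 B1 _ _ _ Um UK 2]; use e[of n] ab in simp)+
      have "(\<integral>t. deriv (cutoff h a b n) t * U t \<partial>?I) = (\<integral>t. deriv (A n) t * U t \<partial>?I) - (\<integral>t. deriv (B n) t * U t \<partial>?I)"
        unfolding dcut left_diff_distrib by (rule Bochner_Integration.integral_diff[OF iA iB])
      then show ?case using vA vB \<epsilon> unfolding dist_real_def by linarith
    qed
  qed
  moreover have "(\<lambda>n. \<integral>t. deriv (cutoff h a b n) t * U t \<partial>?I) \<longlonglongrightarrow> - (\<integral>t. indicator {a<..<b} t * W t \<partial>?I)"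
  proof -
    have "(\<lambda>n. \<integral>t. cutoff h a b n t * W t \<partial>?I) \<longlonglongrightarrow> (\<integral>t. indicator {a<..<b} t * W t \<partial>?I)"
    proof (rule integral_dominated_convergence[where w="\<lambda>t. \<bar>W t\<bar>"])
      have Wm: "W \<in> borel_measurable ?I" using W by (rule borel_measurable_integrable)
      show "(\<lambda>t. indicator {a<..<b} t * W t) \<in> borel_measurable ?I"
        by (intro borel_measurable_times borel_measurable_lebesgue_onI Wm borel_measurable_indicator) simp
      show "(\<lambda>t. cutoff h a b n t * W t) \<in> borel_measurable ?I" for n
        by (intro borel_measurable_times borel_measurable_lebesgue_onI Wm borel_measurable_continuous_onI
            smooth_continuous smooth_cutoff[OF h])
      show "integrable ?I (\<lambda>t. \<bar>W t\<bar>)" using W by (rule integrable_abs)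
      show "AE t in ?I. (\<lambda>n. cutoff h a b n t * W t) \<longlonglongrightarrow> indicator {a<..<b} t * W t"
        by (intro AE_I2 tendsto_mult_right cutoff_tendsto[OF h ab(2)])
      show "AE t in ?I. norm (cutoff h a b n t * W t) \<le> \<bar>W t\<bar>" for n
        using cutoff_nonneg[OF h ab(2), of n] cutoff_le_1[OF h ab(2), of n]
        by (intro AE_I2) (simp add: abs_mult mult_left_le_one_le)
    qed
    then show ?thesis
      unfolding weak[OF cutoff_test_function[OF h ab]] by (rule tendsto_minus)
  qed
  ultimately have "U a - U b = - (\<integral>t. indicator {a<..<b} t * W t \<partial>?I)" by (rule LIMSEQ_unique)
  then show ?thesis by simp
qed

section \<open>Increments of Lipschitz curves in the essentially bounded class\<close>

context bounded_domain
begin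

text \<open>The hypothesis is applied to the set where \<open>v\<close> exceeds \<open>c\<close>;
  there \<open>v - c\<close> is positive with nonpositive integral, so the set is null.\<close>

lemma AE_bound_of_means:
  assumes v: "v \<in> Linf \<Omega>"
    and B: "\<And>B. B \<in> sets (lebesgue_on \<Omega>) \<Longrightarrow> mean_on \<Omega> B v \<le> c * measure (lebesgue_on \<Omega>) B"
  shows "AE x in lebesgue_on \<Omega>. v x \<le> c"
proof -
  interpret finite_measure "lebesgue_on \<Omega>" by (rule M)
  have vm: "v \<in> borel_measurable (lebesgue_on \<Omega>)" using v by (simp add: Linf_space_iff[OF M(1)])
  define A where "A = {x \<in> space (lebesgue_on \<Omega>). c < v x}"
  have A: "A \<in> sets (lebesgue_on \<Omega>)" unfolding A_def using vm by measurable
  have iA: "integrable (lebesgue_on \<Omega>) (\<lambda>x. indicator A x * v x)" by (rule Linf_integrable_indicator[OF v A])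
  have ic: "integrable (lebesgue_on \<Omega>) (\<lambda>x. indicator A x * c)"
    by (rule Linf_integrable_indicator[OF Linf_const[OF M(1)] A])
  have i: "integrable (lebesgue_on \<Omega>) (\<lambda>x. indicator A x * (v x - c))"
    unfolding right_diff_distrib by (rule Bochner_Integration.integrable_diff[OF iA ic])
  have nn: "0 \<le> indicator A x * (v x - c)" for x by (simp add: indicator_def A_def)
  have "(\<integral>x. indicator A x * (v x - c) \<partial>lebesgue_on \<Omega>) = mean_on \<Omega> A v - (\<integral>x. indicator A x * c \<partial>lebesgue_on \<Omega>)"
    unfolding right_diff_distrib mean_on_def by (rule Bochner_Integration.integral_diff[OF iA ic])
  also have "(\<integral>x. indicator A x * c \<partial>lebesgue_on \<Omega>) = c * measure (lebesgue_on \<Omega>) A"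
    using sets.sets_into_space[OF A] by (simp add: Int_absorb2)
  also have "mean_on \<Omega> A v - c * measure (lebesgue_on \<Omega>) A \<le> 0" using B[OF A] by simp
  finally have "(\<integral>x. indicator A x * (v x - c) \<partial>lebesgue_on \<Omega>) \<le> 0" .
  moreover have "0 \<le> (\<integral>x. indicator A x * (v x - c) \<partial>lebesgue_on \<Omega>)"
    by (rule integral_nonneg_AE) (simp add: nn)
  ultimately have "(\<integral>x. indicator A x * (v x - c) \<partial>lebesgue_on \<Omega>) = 0" by simp
  then have "AE x in lebesgue_on \<Omega>. indicator A x * (v x - c) = 0"
    using integral_nonneg_eq_0_iff_AE[OF i] nn by simp
  then show ?thesis using AE_space
  proof eventually_elim
    case (elim x)
    then show ?case by (cases "x \<in> A") (auto simp: A_def)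
  qed
qed

lemma AE_abs_bound_of_means:
  assumes v: "v \<in> Linf \<Omega>"
    and B: "\<And>B. B \<in> sets (lebesgue_on \<Omega>) \<Longrightarrow> \<bar>mean_on \<Omega> B v\<bar> \<le> c * measure (lebesgue_on \<Omega>) B"
  shows "AE x in lebesgue_on \<Omega>. \<bar>v x\<bar> \<le> c"
proof -
  have "(\<lambda>x. (-1) * v x) \<in> Linf \<Omega>" using Linf_linear[OF M(1) v v, of "-1" 0] by simp
  then have "AE x in lebesgue_on \<Omega>. (-1) * v x \<le> c"
  proof (rule AE_bound_of_means)
    fix B assume "B \<in> sets (lebesgue_on \<Omega>)"
    from B[OF this] show "mean_on \<Omega> B (\<lambda>x. (-1) * v x) \<le> c * measure (lebesgue_on \<Omega>) B"
      unfolding mean_on_scale by linarith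
  qed
  moreover have "AE x in lebesgue_on \<Omega>. v x \<le> c"
  proof (rule AE_bound_of_means[OF v])
    fix B assume "B \<in> sets (lebesgue_on \<Omega>)"
    from B[OF this] show "mean_on \<Omega> B v \<le> c * measure (lebesgue_on \<Omega>) B" by linarith
  qed
  ultimately show ?thesis by eventually_elim simp
qed

text \<open>Testing with the functionals \<open>v \<mapsto> \<integral>\<^bsub>B\<^esub> v\<close> reduces the vector-valued mean value
  inequality to the scalar one.\<close>

lemma weak_derivative_increment_bound:
  assumes h: "smooth_step h" and T: "0 < T"
    and u: "u \<in> C_space {0..T} (Linf \<Omega>) (normLinf \<Omega>)"
    and w: "w \<in> Linf_space (lebesgue_on {0<..<T}) (Linf \<Omega>) (normLinf \<Omega>)"
    and weak: "weak_time_derivative T \<Omega> u w"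
    and ab: "0 \<le> a" "a < b" "b \<le> T" and z: "z \<in> Linf \<Omega>"
    and \<kappa>: "AE t in lebesgue_on {0<..<T}. t \<in> {a<..<b} \<longrightarrow> (AE x in lebesgue_on \<Omega>. \<bar>w t x - z x\<bar> \<le> \<kappa>)"
  shows "AE x in lebesgue_on \<Omega>. \<bar>u b x - u a x - (b - a) * z x\<bar> \<le> \<kappa> * (b - a)"
proof -
  let ?I = "lebesgue_on {0<..<T}"
  have Il: "{0<..<T} \<in> lmeasurable" by simp
  have Is: "{0<..<T} \<in> sets lebesgue" by simp
  interpret I: finite_measure ?I by (rule finite_measure_lebesgue_on[OF Il])
  have uL: "u t \<in> Linf \<Omega>" if "t \<in> {0..T}" for t using u that by (auto simp: C_space_def)
  have wm: "strongly_measurable ?I (Linf \<Omega>) (normLinf \<Omega>) w" using w by (simp add: Linf_space_def)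
  then have wL: "AE t in ?I. w t \<in> Linf \<Omega>" by (simp add: strongly_measurable_def)
  obtain Cw where Cw: "AE t in ?I. normLinf \<Omega> (w t) \<le> Cw" using w by (auto simp: Linf_space_def)
  have uab: "u a \<in> Linf \<Omega>" "u b \<in> Linf \<Omega>" using ab by (auto intro: uL)
  have d: "(\<lambda>x. u b x - u a x) \<in> Linf \<Omega>" by (rule Linf_diff[OF M(1) uab(2,1)])
  \<comment> \<open>The constant curve \<open>z\<close> has integral \<open>(b - a) * z\<close> over
    the interval, so this is the integral of \<open>w - z\<close>.\<close>
  have \<psi>: "(\<lambda>x. u b x - u a x - (b - a) * z x) \<in> Linf \<Omega>"
    using Linf_linear[OF M(1) d z, of 1 "- (b - a)"] by (simp add: algebra_simps)
  have Iab: "(\<integral>t. indicator {a<..<b} t * c \<partial>?I) = (b - a) * c" and iab: "integrable ?I (\<lambda>t. indicator {a<..<b} t * c)" for c :: real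
  proof -
    have sub: "{a<..<b} \<subseteq> {0<..<T}" using ab by auto
    have m: "{a<..<b} \<in> sets ?I" using sub by (simp add: sets_restrict_space_iff)
    have "has_bochner_integral ?I (indicator {a<..<b}) (measure ?I {a<..<b})"
      using m by (intro has_bochner_integral_real_indicator) (auto simp: I.emeasure_eq_measure)
    also have "measure ?I {a<..<b} = b - a"
      using sub ab by (subst measure_restrict_space) auto
    finally have hb: "has_bochner_integral ?I (indicator {a<..<b}) (b - a)" .
    from has_bochner_integral_mult_left[OF hb, of c]
    show "(\<integral>t. indicator {a<..<b} t * c \<partial>?I) = (b - a) * c" "integrable ?I (\<lambda>t. indicator {a<..<b} t * c)"
      by (auto simp: has_bochner_integral_iff)
  qed
  show ?thesis
  proof (rule AE_abs_bound_of_means[OF \<psi>])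
    fix B assume B: "B \<in> sets (lebesgue_on \<Omega>)"
    let ?F = "mean_on \<Omega> B" and ?m = "measure (lebesgue_on \<Omega>) B"
    have Wi: "integrable ?I (\<lambda>t. ?F (w t))"
    proof (rule I.integrable_const_bound)
      show "(\<lambda>t. ?F (w t)) \<in> borel_measurable ?I" by (rule mean_on_strongly_measurable[OF Is B wm])
      show "AE t in ?I. norm (?F (w t)) \<le> (?m + 1) * Cw"
        using wL Cw
      proof eventually_elim
        case (elim t)
        have "norm (?F (w t)) \<le> (?m + 1) * normLinf \<Omega> (w t)" using mean_on_norm_bound[OF elim(1) B] by simp
        also have "\<dots> \<le> (?m + 1) * Cw" using elim(2) measure_nonneg[of "lebesgue_on \<Omega>" B] by (intro mult_left_mono) auto
        finally show ?case .
      qed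
    qed
    have wi: "integrable ?I (\<lambda>t. indicator {a<..<b} t * ?F (w t))"
    proof -
      have "{a<..<b} \<subseteq> {0<..<T}" using ab by auto
      then have "{a<..<b} \<in> sets ?I" by (simp add: sets_restrict_space_iff)
      from integrable_mult_indicator[OF this Wi] show ?thesis by simp
    qed
    \<comment> \<open>Norm continuity up to both ends of the interval passes to the scalar function,
      as needed when \<open>a = 0\<close> or \<open>b = T\<close>.\<close>
    have Uc: "continuous_on {0..T} (\<lambda>t. ?F (u t))"
      unfolding continuous_on_def
    proof
      fix t assume t: "t \<in> {0..T}"
      have lim: "((\<lambda>s. normLinf \<Omega> (u s - u t)) \<longlongrightarrow> 0) (at t within {0..T})"
        using u t by (auto simp: C_space_def)
      have "((\<lambda>s. (?m + 1) * normLinf \<Omega> (u s - u t)) \<longlongrightarrow> 0) (at t within {0..T})"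
        using tendsto_mult_left[OF lim, of "?m + 1"] by simp
      then have "((\<lambda>s. ?F (u s) - ?F (u t)) \<longlongrightarrow> 0) (at t within {0..T})"
      proof (rule Lim_null_comparison[rotated])
        show "\<forall>\<^sub>F s in at t within {0..T}. norm (?F (u s) - ?F (u t)) \<le> (?m + 1) * normLinf \<Omega> (u s - u t)"
          unfolding eventually_at_filter
        proof (rule always_eventually, intro allI impI)
          fix s assume "s \<in> {0..T}"
          then show "norm (?F (u s) - ?F (u t)) \<le> (?m + 1) * normLinf \<Omega> (u s - u t)"
            using mean_on_norm_bound[OF Linf_diff[OF M(1) uL uL] B, of s t] mean_on_diff[OF uL uL B, of s t] t
            by (simp add: fun_diff_def)
        qed
      qed
      then show "((\<lambda>t. ?F (u t)) \<longlongrightarrow> ?F (u t)) (at t within {0..T})" by (simp add: LIM_zero_iff)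
    qed
    have "?F (u b) - ?F (u a) = (\<integral>t. indicator {a<..<b} t * ?F (w t) \<partial>?I)"
    proof (rule weak_derivative_integral[OF h Uc Wi _ ab])
      fix \<phi> assume "\<phi> \<in> test_functions {0<..<T}"
      then obtain J where
        J1: "has_bochner_integral_in ?I (Linf \<Omega>) (normLinf \<Omega>) (\<lambda>t x. deriv \<phi> t * u t x) J" and
        J2: "has_bochner_integral_in ?I (Linf \<Omega>) (normLinf \<Omega>) (\<lambda>t x. \<phi> t * w t x) (- J)"
        using weak unfolding weak_time_derivative_def by blast
      have "(\<integral>t. deriv \<phi> t * ?F (u t) \<partial>?I) = ?F J"
        using mean_on_bochner_integral(2)[OF Il B J1] by (simp only: mean_on_scale)
      moreover have "(\<integral>t. \<phi> t * ?F (w t) \<partial>?I) = ?F (- J)"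
        using mean_on_bochner_integral(2)[OF Il B J2] by (simp only: mean_on_scale)
      moreover have "?F (- J) = - ?F J" by (simp add: mean_on_def)
      ultimately show "(\<integral>t. deriv \<phi> t * ?F (u t) \<partial>?I) = - (\<integral>t. \<phi> t * ?F (w t) \<partial>?I)" by simp
    qed
    moreover have "?F (\<lambda>x. u b x - u a x - (b - a) * z x) = ?F (u b) - ?F (u a) - (b - a) * ?F z"
      using mean_on_linear[OF d z B, of 1 "- (b - a)"] mean_on_diff[OF uab(2,1) B] by (simp add: algebra_simps)
    ultimately have "?F (\<lambda>x. u b x - u a x - (b - a) * z x)
        = (\<integral>t. indicator {a<..<b} t * ?F (w t) \<partial>?I) - (\<integral>t. indicator {a<..<b} t * ?F z \<partial>?I)"
      unfolding Iab by (simp only:)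
    also have "\<dots> = (\<integral>t. indicator {a<..<b} t * ?F (w t) - indicator {a<..<b} t * ?F z \<partial>?I)"
      by (rule Bochner_Integration.integral_diff[symmetric, OF wi iab[of "?F z"]])
    also have "\<bar>\<dots>\<bar> \<le> (\<integral>t. \<bar>indicator {a<..<b} t * ?F (w t) - indicator {a<..<b} t * ?F z\<bar> \<partial>?I)"
      by (rule integral_abs_bound)
    also have "\<dots> \<le> (\<integral>t. indicator {a<..<b} t * (\<kappa> * ?m) \<partial>?I)"
    proof (rule integral_mono_AE[OF _ iab[of "\<kappa> * ?m"]])
      show "integrable ?I (\<lambda>t. \<bar>indicator {a<..<b} t * ?F (w t) - indicator {a<..<b} t * ?F z\<bar>)"
        by (intro integrable_abs Bochner_Integration.integrable_diff wi iab[of "?F z"])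
      show "AE t in ?I. \<bar>indicator {a<..<b} t * ?F (w t) - indicator {a<..<b} t * ?F z\<bar> \<le> indicator {a<..<b} t * (\<kappa> * ?m)"
        using wL \<kappa>
      proof eventually_elim
        case (elim t)
        show ?case
        proof (cases "t \<in> {a<..<b}")
          case True
          have "\<bar>?F (\<lambda>x. w t x - z x)\<bar> \<le> \<kappa> * ?m"
            using elim(2) True by (intro mean_on_bound[OF Linf_diff[OF M(1) elim(1) z] B]) simp
          then show ?thesis using True mean_on_diff[OF elim(1) z B] by simp
        qed simp
      qed
    qed
    also have "\<dots> = \<kappa> * (b - a) * ?m" unfolding Iab by simp
    finally show "\<bar>?F (\<lambda>x. u b x - u a x - (b - a) * z x)\<bar> \<le> \<kappa> * (b - a) * ?m" .
  qed
qed

end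

section \<open>The consistency error\<close>

text \<open>Every ball around a point of the closed interval meets the open one in a nonempty open
  set, which is not null; so a property valid almost everywhere holds arbitrarily close to
  \<open>t\<close>, end points included.\<close>

lemma AE_interval_dense:
  fixes t T \<delta> :: real
  assumes P: "AE t in lebesgue_on {0<..<T}. P t" and t: "t \<in> {0..T}" and T: "0 < T" and \<delta>: "0 < \<delta>"
  shows "\<exists>s\<in>{0<..<T}. \<bar>s - t\<bar> < \<delta> \<and> P s"
proof (rule ccontr)
  assume n: "\<not> ?thesis"
  define W where "W = {0<..<T} \<inter> ball t \<delta>"
  have W: "open W" by (simp add: W_def open_Int)
  have "t \<in> ball t \<delta> \<inter> closure {0<..<T}" using t T \<delta> by simp
  then have "ball t \<delta> \<inter> {0<..<T} \<noteq> {}"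
    using open_Int_closure_eq_empty[OF open_ball, of t \<delta> "{0<..<T}"] by blast
  then have ne: "W \<noteq> {}" by (simp add: W_def inf_commute)
  have "AE s in lebesgue. s \<in> {0<..<T} \<longrightarrow> P s" using P by (simp add: AE_restrict_space_iff)
  then have "AE s in lebesgue. s \<notin> W"
  proof eventually_elim
    case (elim s)
    then show ?case using n by (auto simp: W_def dist_real_def)
  qed
  moreover have "W \<in> sets lebesgue" using W by auto
  ultimately have "W \<in> null_sets lebesgue" by (subst AE_iff_null_sets) auto
  then have "negligible W" by (simp add: negligible_iff_null_sets)
  then show False using open_not_negligible[OF W ne] by simp
qed

context bounded_domain
begin

text \<open>Bounds at a nearby good time transfer to \<open>t\<close> with an error of at most
  \<open>1 / Suc n\<close> by norm continuity, and countably many null sets are discarded in the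
  limit. Admissibility is thereby available at every time, in particular at 0.\<close>

lemma C_space_bounds_everywhere:
  assumes u: "u \<in> C_space {0..T} (Linf \<Omega>) (normLinf \<Omega>)" and T: "0 < T"
    and ae: "AE t in lebesgue_on {0<..<T}. AE x in lebesgue_on \<Omega>. l \<le> u t x \<and> u t x \<le> r"
    and t: "t \<in> {0..T}"
  shows "AE x in lebesgue_on \<Omega>. l \<le> u t x \<and> u t x \<le> r"
proof -
  have uL: "u t \<in> Linf \<Omega>" if "t \<in> {0..T}" for t using u that by (auto simp: C_space_def)
  have "AE x in lebesgue_on \<Omega>. l - 1 / real (Suc n) \<le> u t x \<and> u t x \<le> r + 1 / real (Suc n)" for n
  proof -
    have "((\<lambda>s. normLinf \<Omega> (u s - u t)) \<longlongrightarrow> 0) (at t within {0..T})" using u t by (auto simp: C_space_def)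
    then have "\<forall>\<^sub>F s in at t within {0..T}. normLinf \<Omega> (u s - u t) < 1 / real (Suc n)"
      by (rule order_tendstoD) simp
    then obtain \<delta> where \<delta>: "\<delta> > 0" "\<forall>s\<in>{0..T}. s \<noteq> t \<and> dist s t < \<delta> \<longrightarrow> normLinf \<Omega> (u s - u t) < 1 / real (Suc n)"
      unfolding eventually_at by auto
    obtain s where s: "s \<in> {0<..<T}" "\<bar>s - t\<bar> < \<delta>" "AE x in lebesgue_on \<Omega>. l \<le> u s x \<and> u s x \<le> r"
      using AE_interval_dense[OF ae t T \<delta>(1)] by auto
    show ?thesis
    \<comment> \<open>The limit at \<open>t\<close> says nothing about \<open>t\<close> itself; if
      \<open>t\<close> happens to be a good time, its own bounds are used.\<close>
    proof (cases "s = t")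
      case True
      have "0 \<le> 1 / real (Suc n)" by simp
      note n = this
      from s(3) show ?thesis unfolding True by eventually_elim (use n in linarith)
    next
      case False
      have sT: "s \<in> {0..T}" using s(1) by auto
      have lt: "normLinf \<Omega> (u s - u t) < 1 / real (Suc n)" using \<delta>(2) sT s(2) False by (simp add: dist_real_def)
      have "AE x in lebesgue_on \<Omega>. \<bar>u s x - u t x\<bar> \<le> normLinf \<Omega> (u s - u t)"
        using Linf_AE_norm[OF Linf_diff[OF M(1) uL[OF sT] uL[OF t]]] by (simp add: fun_diff_def)
      then show ?thesis using s(3) by eventually_elim (use lt in linarith)
    qed
  qed
  then have "AE x in lebesgue_on \<Omega>. \<forall>n. l - 1 / real (Suc n) \<le> u t x \<and> u t x \<le> r + 1 / real (Suc n)"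
    by (simp add: AE_all_countable)
  then show ?thesis
  proof eventually_elim
    case (elim x)
    have z: "(\<lambda>n. 1 / real (Suc n)) \<longlonglongrightarrow> 0" by (intro LIMSEQ_Suc lim_1_over_n)
    have "(\<lambda>n. l - 1 / real (Suc n)) \<longlonglongrightarrow> l - 0" "(\<lambda>n. r + 1 / real (Suc n)) \<longlonglongrightarrow> r + 0"
      by (intro tendsto_intros z)+
    then show ?case using elim by (auto intro: LIMSEQ_le_const LIMSEQ_le_const2)
  qed
qed

text \<open>The increment bound with \<open>z = 0\<close> and the essential bound of the
  derivative.\<close>

lemma weak_derivative_lipschitz:
  assumes h: "smooth_step h" and T: "0 < T"
    and u: "u \<in> C_space {0..T} (Linf \<Omega>) (normLinf \<Omega>)"
    and w: "w \<in> Linf_space (lebesgue_on {0<..<T}) (Linf \<Omega>) (normLinf \<Omega>)"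
    and weak: "weak_time_derivative T \<Omega> u w"
  shows "\<exists>L\<ge>0. \<forall>s\<in>{0..T}. \<forall>t\<in>{0..T}. AE x in lebesgue_on \<Omega>. \<bar>u t x - u s x\<bar> \<le> L * \<bar>t - s\<bar>"
proof -
  obtain C where C: "AE t in lebesgue_on {0<..<T}. normLinf \<Omega> (w t) \<le> C" using w by (auto simp: Linf_space_def)
  have wL: "AE t in lebesgue_on {0<..<T}. w t \<in> Linf \<Omega>" using w by (auto simp: Linf_space_def strongly_measurable_def)
  define L where "L = max 0 C"
  have inc: "AE x in lebesgue_on \<Omega>. \<bar>u b x - u a x\<bar> \<le> L * (b - a)" if ab: "0 \<le> a" "a < b" "b \<le> T" for a b
  proof -
    have "AE x in lebesgue_on \<Omega>. \<bar>u b x - u a x - (b - a) * 0\<bar> \<le> L * (b - a)"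
    proof (rule weak_derivative_increment_bound[OF h T u w weak ab Linf_const[OF M(1)]])
      show "AE t in lebesgue_on {0<..<T}. t \<in> {a<..<b} \<longrightarrow> (AE x in lebesgue_on \<Omega>. \<bar>w t x - 0\<bar> \<le> L)"
        using C wL
      proof eventually_elim
        case (elim t)
        have "AE x in lebesgue_on \<Omega>. \<bar>w t x - 0\<bar> \<le> L"
          using Linf_AE_norm[OF elim(2)] by eventually_elim (use elim(1) in \<open>simp add: L_def\<close>)
        then show ?case by simp
      qed
    qed
    then show ?thesis by simp
  qed
  have "AE x in lebesgue_on \<Omega>. \<bar>u t x - u s x\<bar> \<le> L * \<bar>t - s\<bar>" if st: "s \<in> {0..T}" "t \<in> {0..T}" for s t
  proof (cases s t rule: linorder_cases)
    case less
    then show ?thesis using inc[of s t] st by simp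
  next
    case equal
    then show ?thesis by simp
  next
    case greater
    then have "AE x in lebesgue_on \<Omega>. \<bar>u s x - u t x\<bar> \<le> L * (s - t)" using inc[of t s] st by simp
    then show ?thesis using greater by (simp add: abs_minus_commute)
  qed
  moreover have "0 \<le> L" by (simp add: L_def)
  ultimately show ?thesis by blast
qed

end

lemma (in convex_body) C01_Linf_C11_bounds:
  assumes g: "g \<in> C01_space {0..T} (Linf_space M (C11_space Y) (C11_norm Y)) (Linf_norm M (C11_norm Y))"
    and T: "0 \<le> T"
  shows "\<exists>L N. 0 \<le> L \<and> 0 \<le> N \<and> (\<forall>s\<in>{0..T}. \<forall>t\<in>{0..T}.
    AE x in M. g t x \<in> C11_space Y \<and> C11_norm Y (g t x) \<le> N \<and> C11_norm Y (g t x - g s x) \<le> L * \<bar>t - s\<bar>)"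
proof -
  have gL: "g t \<in> Linf_space M (C11_space Y) (C11_norm Y)" if "t \<in> {0..T}" for t
    using g that by (auto simp: C01_space_def)
  obtain L0 where L0: "\<forall>s\<in>{0..T}. \<forall>t\<in>{0..T}. Linf_norm M (C11_norm Y) (g s - g t) \<le> L0 * \<bar>s - t\<bar>"
    using g by (auto simp: C01_space_def)
  define L where "L = max 0 L0"
  have L: "AE x in M. C11_norm Y (g t x - g s x) \<le> L * \<bar>t - s\<bar>" if st: "s \<in> {0..T}" "t \<in> {0..T}" for s t
  proof -
    have "Linf_norm M (C11_norm Y) (g t - g s) \<le> L0 * \<bar>t - s\<bar>" using L0 st by blast
    also have "\<dots> \<le> L * \<bar>t - s\<bar>" by (intro mult_right_mono) (simp_all add: L_def)
    finally have le: "Linf_norm M (C11_norm Y) (g t - g s) \<le> L * \<bar>t - s\<bar>" .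
    show ?thesis using Linf_C11_diff_AE[OF gL[OF st(2)] gL[OF st(1)]]
      by eventually_elim (use le in simp)
  qed
  have C: "AE x in M. g t x \<in> C11_space Y" if "t \<in> {0..T}" for t
    using gL[OF that] by (auto simp: Linf_space_def strongly_measurable_def)
  have 0: "0 \<in> {0..T}" using T by simp
  obtain N0 where N0: "AE x in M. C11_norm Y (g 0 x) \<le> N0" using gL[OF 0] by (auto simp: Linf_space_def)
  \<comment> \<open>The norm at time 0 plus the drift over length \<open>T\<close> bounds the norm
    at every time.\<close>
  define N where "N = max 0 (L * T + N0)"
  have "AE x in M. g t x \<in> C11_space Y \<and> C11_norm Y (g t x) \<le> N \<and> C11_norm Y (g t x - g s x) \<le> L * \<bar>t - s\<bar>"
    if s: "s \<in> {0..T}" and t: "t \<in> {0..T}" for s t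
    using L[OF s t] L[OF 0 t] C[OF t] C[OF 0] N0
  proof eventually_elim
    case (elim x)
    have "L * \<bar>t - 0\<bar> \<le> L * T" using t by (intro mult_left_mono) (auto simp: L_def)
    then have "C11_norm Y (g t x) \<le> N"
      using C11_norm_diff(3)[OF elim(3,4)] elim(2,5) unfolding N_def by linarith
    then show ?case using elim by simp
  qed
  moreover have "0 \<le> L" "0 \<le> N" by (auto simp: L_def N_def)
  ultimately show ?thesis by blast
qed

text \<open>Up to \<open>\<omega>\<close> the derivative is largest at \<open>\<omega>\<close>,
  because the exponent is negative; the distance of the damage from 1 keeps it finite.\<close>

lemma one_minus_powr_lipschitz:
  fixes \<alpha> \<omega> a b :: real
  assumes \<alpha>: "0 \<le> \<alpha>" and \<omega>: "\<omega> < 1" and ab: "a \<le> \<omega>" "b \<le> \<omega>"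
  shows "\<bar>(1 - a) powr (- \<alpha>) - (1 - b) powr (- \<alpha>)\<bar> \<le> \<alpha> * (1 - \<omega>) powr (- \<alpha> - 1) * \<bar>a - b\<bar>"
proof -
  have "norm ((1 - a) powr (- \<alpha>) - (1 - b) powr (- \<alpha>)) \<le> \<alpha> * (1 - \<omega>) powr (- \<alpha> - 1) * norm (a - b)"
  proof (rule field_differentiable_bound[of "{..\<omega>}" _ "\<lambda>x. \<alpha> * (1 - x) powr (- \<alpha> - 1)"])
    fix x assume x: "x \<in> {..\<omega>}"
    show "((\<lambda>x. (1 - x) powr (- \<alpha>)) has_field_derivative \<alpha> * (1 - x) powr (- \<alpha> - 1)) (at x within {..\<omega>})"
      using x \<omega> by (auto intro!: derivative_eq_intros DERIV_powr)
    have "(1 - x) powr (- \<alpha> - 1) \<le> (1 - \<omega>) powr (- \<alpha> - 1)"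
      using x \<omega> \<alpha> by (intro powr_mono2') auto
    then show "norm (\<alpha> * (1 - x) powr (- \<alpha> - 1)) \<le> \<alpha> * (1 - \<omega>) powr (- \<alpha> - 1)"
      using \<alpha> by (simp add: abs_mult mult_left_mono)
  qed (use ab in auto)
  then show ?thesis by simp
qed

lemma abs_mult_diff_le:
  fixes a b c d :: real
  assumes "\<bar>a - c\<bar> \<le> A" "\<bar>b\<bar> \<le> P" "\<bar>c\<bar> \<le> N" "\<bar>b - d\<bar> \<le> D"
  shows "\<bar>a * b - c * d\<bar> \<le> A * P + N * D"
proof -
  have "a * b - c * d = (a - c) * b + c * (b - d)" by (simp add: algebra_simps)
  then have "\<bar>a * b - c * d\<bar> \<le> \<bar>a - c\<bar> * \<bar>b\<bar> + \<bar>c\<bar> * \<bar>b - d\<bar>"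
    using abs_triangle_ineq[of "(a - c) * b" "c * (b - d)"] by (simp add: abs_mult)
  also have "\<dots> \<le> A * P + N * D"
    using assms by (intro add_mono mult_mono order_trans[OF abs_ge_zero]) auto
  finally show ?thesis .
qed

text \<open>For \<open>\<tau> > T\<close> the set of admissible times is empty and the supremum in
  the extended reals is minus infinity, so one constant covers all positive
  \<open>\<tau>\<close>.\<close>

theorem lemma3p9:
  fixes T \<alpha> \<omega>\<^sub>0 \<omega>\<^sub>1 ybar h :: real
    and \<Omega> \<Gamma>\<^sub>0 \<Gamma>\<^sub>1 \<Gamma>\<^sub>2 :: "(real^2) set"
    and \<T> :: "(real^2) set set"
    and lam mu \<eta> d\<^sub>0 :: "real^2 \<Rightarrow> real"
    and f q :: "real \<Rightarrow> real^2 \<Rightarrow> real^2"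
    and g :: "real \<Rightarrow> real^2 \<Rightarrow> real^2^2 \<Rightarrow> real"
    and d\<^sub>h :: "real \<Rightarrow> real^2 \<Rightarrow> real"
  defines "Y \<equiv> cball (0 :: real^2^2) ybar"
    and "disp \<equiv> discrete_displacement \<Omega> \<Gamma>\<^sub>0 \<Gamma>\<^sub>2 \<T> lam mu f q"
  defines "r\<^sub>h \<equiv> damage_rhs \<Omega> \<eta> \<alpha> g disp"
  assumes T: "0 < T"
    and domain: "lipschitz_domain \<Omega>"
    and boundary: "\<Gamma>\<^sub>0 \<union> \<Gamma>\<^sub>1 \<union> \<Gamma>\<^sub>2 = frontier \<Omega>" "\<Gamma>\<^sub>0 \<inter> \<Gamma>\<^sub>1 = {}" "\<Gamma>\<^sub>0 \<inter> \<Gamma>\<^sub>2 = {}" "\<Gamma>\<^sub>1 \<inter> \<Gamma>\<^sub>2 = {}"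
      "\<Gamma>\<^sub>0 \<in> sets borel" "\<Gamma>\<^sub>1 \<in> sets borel" "\<Gamma>\<^sub>2 \<in> sets borel"
      "0 < emeasure hausdorff1 \<Gamma>\<^sub>0"
    and lame: "lam \<in> Linf \<Omega>" "mu \<in> Linf \<Omega>" "uniformly_elliptic \<Omega> lam mu"
    and params: "1 \<le> \<alpha>" "0 \<le> \<omega>\<^sub>0" "\<omega>\<^sub>0 \<le> \<omega>\<^sub>1" "\<omega>\<^sub>1 < 1" "0 < ybar"
    and kernel: "mollifier_kernel \<eta>"
    and mesh: "mesh \<Omega> h \<T>"
    and f: "f \<in> C01_space {0..T} (L2_space (lebesgue_on \<Omega>)) (L2_norm (lebesgue_on \<Omega>))"
    and q: "q \<in> C01_space {0..T} (L2_space (restrict_space hausdorff1 \<Gamma>\<^sub>2))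
                 (L2_norm (restrict_space hausdorff1 \<Gamma>\<^sub>2))"
    and g: "g \<in> damage_processes T \<Omega> \<alpha> \<omega>\<^sub>0 \<omega>\<^sub>1 Y"
      "g \<in> C01_space {0..T} (Linf_space (lebesgue_on \<Omega>) (C11_space Y) (C11_norm Y))
             (Linf_norm (lebesgue_on \<Omega>) (C11_norm Y))"
    and ybar: "\<And>t d. t \<in> {0..T} \<Longrightarrow> d \<in> Linf \<Omega> \<Longrightarrow> (AE x in lebesgue_on \<Omega>. 0 \<le> d x \<and> d x \<le> \<omega>\<^sub>1)
                 \<Longrightarrow> AE x in lebesgue_on \<Omega>. mollified_grad \<Omega> \<eta> (disp t d) x \<in> Y"
    and d\<^sub>0: "d\<^sub>0 \<in> initial_damage \<Omega> \<omega>\<^sub>0"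
    and d\<^sub>h: "d\<^sub>h \<in> damage_functions T \<Omega> \<omega>\<^sub>1" "solves_damage_evolution T \<Omega> r\<^sub>h d\<^sub>0 d\<^sub>h"
  shows "\<exists>C>0. \<forall>\<tau>>0.
           (SUP t\<in>{0..T - \<tau>}. esssup (lebesgue_on \<Omega>) (\<lambda>x. ereal \<bar>consistency_error r\<^sub>h d\<^sub>h t x \<tau>\<bar>))
             \<le> ereal (C * \<tau>\<^sup>2)"
proof -
  have \<Omega>: "open \<Omega>" "bounded \<Omega>" using domain by (auto simp: lipschitz_domain_def)
  interpret E: discrete_elasticity T \<omega>\<^sub>1 h \<Omega> \<Gamma>\<^sub>0 \<Gamma>\<^sub>2 \<T> lam mu \<eta> f q
    by unfold_locales (use T domain boundary lame params kernel mesh f q in auto)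
  interpret D: bounded_domain \<Omega> by unfold_locales (rule \<Omega>)+
  interpret Y: convex_body Y
    by unfold_locales (use params in \<open>auto simp: Y_def\<close>)
  let ?M = "lebesgue_on \<Omega>" and ?I = "lebesgue_on {0<..<T}"
  note M = D.M(1)
  have dC: "d\<^sub>h \<in> C_space {0..T} (Linf \<Omega>) (normLinf \<Omega>)"
    and dae: "AE t in ?I. AE x in ?M. 0 \<le> d\<^sub>h t x \<and> d\<^sub>h t x \<le> \<omega>\<^sub>1"
    using d\<^sub>h(1) by (auto simp: damage_functions_def W1inf_def)
  obtain w where w: "w \<in> Linf_space ?I (Linf \<Omega>) (normLinf \<Omega>)" "weak_time_derivative T \<Omega> d\<^sub>h w"
    and wr: "AE t in ?I. AE x in ?M. w t x = r\<^sub>h d\<^sub>h t x"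
    using d\<^sub>h(2) unfolding solves_damage_evolution_def by blast
  have dL: "d\<^sub>h t \<in> Linf \<Omega>" if "t \<in> {0..T}" for t using dC that by (auto simp: C_space_def)
  \<comment> \<open>Valid at every time and not merely almost every time: the displacement operator
    and the negative power are evaluated at each \<open>t\<close>.\<close>
  have d01: "AE x in ?M. 0 \<le> d\<^sub>h t x \<and> d\<^sub>h t x \<le> \<omega>\<^sub>1" if "t \<in> {0..T}" for t
    by (rule D.C_space_bounds_everywhere[OF dC T dae that])
  have adm: "E.admissible (d\<^sub>h t)" if "t \<in> {0..T}" for t
    using dL[OF that] d01[OF that] by (simp add: E.admissible_def)
  obtain Ld where Ld: "0 \<le> Ld"
    "\<And>s t. s \<in> {0..T} \<Longrightarrow> t \<in> {0..T} \<Longrightarrow> AE x in ?M. \<bar>d\<^sub>h t x - d\<^sub>h s x\<bar> \<le> Ld * \<bar>t - s\<bar>"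
    using D.weak_derivative_lipschitz[OF E.step T dC w] by blast
  define m where "m t x = mollified_grad \<Omega> \<eta> (disp t (d\<^sub>h t)) x" for t x
  have mY: "AE x in ?M. m t x \<in> Y" if "t \<in> {0..T}" for t
    unfolding m_def by (rule ybar[OF that dL[OF that] d01[OF that]])
  have mm: "m t \<in> borel_measurable ?M" if "t \<in> {0..T}" for t
    using E.mollified_displacement_measurable[OF that adm[OF that]]
    unfolding m_def[abs_def] disp_def by (rule borel_measurable_lebesgue_onI)
  obtain Km0 where Km0: "\<forall>s\<in>{0..T}. \<forall>t\<in>{0..T}. \<forall>x. norm (m t x - m s x) \<le> Km0 * \<bar>t - s\<bar>"
    using E.mollified_displacement_lipschitz[OF adm Ld(2,1)] unfolding m_def disp_def by blast
  define Km where "Km = max 0 Km0"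
  have Km: "norm (m t x - m s x) \<le> Km * \<bar>t - s\<bar>" if "s \<in> {0..T}" "t \<in> {0..T}" for s t x
  proof -
    have "norm (m t x - m s x) \<le> Km0 * \<bar>t - s\<bar>" using Km0 that by blast
    also have "\<dots> \<le> Km * \<bar>t - s\<bar>" by (intro mult_right_mono) (simp_all add: Km_def)
    finally show ?thesis .
  qed
  obtain Lg N where LN: "0 \<le> Lg" "0 \<le> N" and gb: "\<And>s t. s \<in> {0..T} \<Longrightarrow> t \<in> {0..T} \<Longrightarrow>
    AE x in ?M. g t x \<in> C11_space Y \<and> C11_norm Y (g t x) \<le> N \<and> C11_norm Y (g t x - g s x) \<le> Lg * \<bar>t - s\<bar>"
    using Y.C01_Linf_C11_bounds[OF g(2)] T by auto
  have gL: "g t \<in> Linf_space ?M (C11_space Y) (C11_norm Y)" if "t \<in> {0..T}" for t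
    using g(2) that by (auto simp: C01_space_def)
  define p where "p a = (1 - a) powr (- \<alpha>)" for a
  define P where "P = p \<omega>\<^sub>1"
  define Lp where "Lp = \<alpha> * (1 - \<omega>\<^sub>1) powr (- \<alpha> - 1)"
  have pP: "\<bar>p a\<bar> \<le> P" if "a \<le> \<omega>\<^sub>1" for a
    unfolding P_def p_def using that params by (simp add: powr_mono2')
  have pL: "\<bar>p a - p b\<bar> \<le> Lp * \<bar>a - b\<bar>" if "a \<le> \<omega>\<^sub>1" "b \<le> \<omega>\<^sub>1" for a b
    unfolding p_def Lp_def using that params by (intro one_minus_powr_lipschitz) auto
  have Lp: "0 \<le> Lp" using params by (simp add: Lp_def)
  have P0: "0 \<le> P" by (simp add: P_def p_def)
  have r: "r\<^sub>h d\<^sub>h t x = g t x (m t x) * p (d\<^sub>h t x)" for t x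
    by (simp add: r\<^sub>h_def damage_rhs_def m_def p_def)
  have rL: "r\<^sub>h d\<^sub>h t \<in> Linf \<Omega>" if t: "t \<in> {0..T}" for t
    unfolding Linf_space_iff[OF M]
  proof
    have "(\<lambda>x. g t x (m t x)) \<in> borel_measurable ?M"
      by (rule Y.superposition_measurable[OF M gL[OF t] mm[OF t] mY[OF t]])
    moreover have "(\<lambda>x. p (d\<^sub>h t x)) \<in> borel_measurable ?M"
    proof -
      have "d\<^sub>h t \<in> borel_measurable ?M" using dL[OF t] by (simp add: Linf_space_iff[OF M])
      then show ?thesis unfolding p_def by measurable
    qed
    ultimately show "r\<^sub>h d\<^sub>h t \<in> borel_measurable ?M"
      unfolding r[abs_def] by (rule borel_measurable_times)
    have "AE x in ?M. \<bar>r\<^sub>h d\<^sub>h t x\<bar> \<le> N * P"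
      using gb[OF t t] mY[OF t] d01[OF t]
    proof eventually_elim
      case (elim x)
      have "\<bar>g t x (m t x)\<bar> \<le> N" using Y.C11_norm_bounds(1)[of "g t x" "m t x"] elim by auto
      then show ?case unfolding r abs_mult using pP[of "d\<^sub>h t x"] elim LN(2) by (intro mult_mono) auto
    qed
    then show "\<exists>C. AE x in ?M. \<bar>r\<^sub>h d\<^sub>h t x\<bar> \<le> C" by blast
  qed
  \<comment> \<open>Product rule. \<open>Lg\<close> stems from the time dependence of
    \<open>g\<close>, \<open>N * Km\<close> from its argument, the mollified gradient, and
    \<open>Lp * Ld\<close> from the damage inside the power; \<open>P\<close> and \<open>N\<close>
    bound the respective other factor.\<close>
  define Lr where "Lr = (Lg + N * Km) * P + N * (Lp * Ld)"
  have Lr0: "0 \<le> Lr" using LN Lp Ld(1) P0 by (auto simp: Lr_def Km_def intro!: add_nonneg_nonneg mult_nonneg_nonneg)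
  have rLip: "AE x in ?M. \<bar>r\<^sub>h d\<^sub>h t x - r\<^sub>h d\<^sub>h s x\<bar> \<le> Lr * \<bar>t - s\<bar>" if s: "s \<in> {0..T}" and t: "t \<in> {0..T}" for s t
    using gb[OF s t] gb[OF s s] mY[OF t] mY[OF s] d01[OF t] d01[OF s] Ld(2)[OF s t]
  proof eventually_elim
    case (elim x)
    have gC: "g t x \<in> C11_space Y" "g s x \<in> C11_space Y" using elim by auto
    have "\<bar>g t x (m t x) - g s x (m t x)\<bar> \<le> Lg * \<bar>t - s\<bar>"
      using Y.C11_norm_bounds(1)[OF Y.C11_norm_diff(1)[OF gC] elim(3)] elim(1) by simp
    moreover have "\<bar>g s x (m t x) - g s x (m s x)\<bar> \<le> N * (Km * \<bar>t - s\<bar>)"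
    proof -
      have "\<bar>g s x (m t x) - g s x (m s x)\<bar> \<le> C11_norm Y (g s x) * norm (m t x - m s x)"
        by (rule Y.C11_norm_lipschitz[OF gC(2) elim(3,4)])
      also have "\<dots> \<le> N * (Km * \<bar>t - s\<bar>)"
        using elim(2) LN(2) by (intro mult_mono Km[OF s t]) auto
      finally show ?thesis .
    qed
    ultimately have 1: "\<bar>g t x (m t x) - g s x (m s x)\<bar> \<le> (Lg + N * Km) * \<bar>t - s\<bar>"
      by (simp add: algebra_simps)
    have 2: "\<bar>g s x (m s x)\<bar> \<le> N" using Y.C11_norm_bounds(1)[OF gC(2) elim(4)] elim(2) by simp
    have "\<bar>p (d\<^sub>h t x) - p (d\<^sub>h s x)\<bar> \<le> Lp * \<bar>d\<^sub>h t x - d\<^sub>h s x\<bar>" using elim by (intro pL) auto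
    also have "\<dots> \<le> Lp * (Ld * \<bar>t - s\<bar>)" using elim Lp by (intro mult_left_mono) auto
    finally have 3: "\<bar>p (d\<^sub>h t x) - p (d\<^sub>h s x)\<bar> \<le> Lp * (Ld * \<bar>t - s\<bar>)" .
    have "\<bar>p (d\<^sub>h t x)\<bar> \<le> P" using elim by (intro pP) auto
    from abs_mult_diff_le[OF 1 this 2 3] show ?case unfolding r Lr_def by (simp add: algebra_simps)
  qed
  \<comment> \<open>The right-hand side is frozen at time \<open>t\<close>, so
    \<open>z = r\<^sub>h d\<^sub>h t\<close>. For almost every \<open>s\<close> in the step the weak
    derivative is \<open>r\<^sub>h d\<^sub>h s\<close>, which deviates by at most
    \<open>Lr * \<tau>\<close>; the step length gives the second factor
    \<open>\<tau>\<close>.\<close>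
  have main: "AE x in ?M. \<bar>consistency_error r\<^sub>h d\<^sub>h t x \<tau>\<bar> \<le> Lr * \<tau> * \<tau>"
    if \<tau>: "0 < \<tau>" and t: "t \<in> {0..T - \<tau>}" for \<tau> t
  proof -
    have t': "t \<in> {0..T}" using t \<tau> by auto
    have "AE x in ?M. \<bar>d\<^sub>h (t + \<tau>) x - d\<^sub>h t x - (t + \<tau> - t) * r\<^sub>h d\<^sub>h t x\<bar> \<le> Lr * \<tau> * (t + \<tau> - t)"
    proof (rule D.weak_derivative_increment_bound[OF E.step T dC w _ _ _ rL[OF t']])
      show "AE s in ?I. s \<in> {t<..<t + \<tau>} \<longrightarrow> (AE x in ?M. \<bar>w s x - r\<^sub>h d\<^sub>h t x\<bar> \<le> Lr * \<tau>)"
        using wr AE_space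
      proof eventually_elim
        case (elim s)
        show ?case
        proof
          assume s: "s \<in> {t<..<t + \<tau>}"
          have "s \<in> {0..T}" using elim(2) by auto
          from elim(1) rLip[OF t' this] show "AE x in ?M. \<bar>w s x - r\<^sub>h d\<^sub>h t x\<bar> \<le> Lr * \<tau>"
          proof eventually_elim
            case (elim x)
            have "Lr * \<bar>s - t\<bar> \<le> Lr * \<tau>" using s Lr0 by (intro mult_left_mono) auto
            then show ?case using elim by simp
          qed
        qed
      qed
    qed (use t \<tau> in auto)
    then show ?thesis by (simp add: consistency_error_def)
  qed
  show ?thesis
  \<comment> \<open>\<open>Lr\<close> may be zero, while the constant has to be positive.\<close>
  proof (intro exI[of _ "Lr + 1"] conjI allI impI)
    show "0 < Lr + 1" using Lr0 by simp
    fix \<tau> :: real assume \<tau>: "0 < \<tau>"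
    show "(SUP t\<in>{0..T - \<tau>}. esssup ?M (\<lambda>x. ereal \<bar>consistency_error r\<^sub>h d\<^sub>h t x \<tau>\<bar>)) \<le> ereal ((Lr + 1) * \<tau>\<^sup>2)"
    proof (rule SUP_least, rule esssup_I)
      fix t assume t: "t \<in> {0..T - \<tau>}"
      then have tT: "t \<in> {0..T}" "t + \<tau> \<in> {0..T}" using \<tau> by auto
      have "d\<^sub>h (t + \<tau>) \<in> borel_measurable ?M" "d\<^sub>h t \<in> borel_measurable ?M" "r\<^sub>h d\<^sub>h t \<in> borel_measurable ?M"
        using dL[OF tT(1)] dL[OF tT(2)] rL[OF tT(1)] by (simp_all add: Linf_space_iff[OF M])
      then show "(\<lambda>x. ereal \<bar>consistency_error r\<^sub>h d\<^sub>h t x \<tau>\<bar>) \<in> borel_measurable ?M"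
        unfolding consistency_error_def by measurable
      have le: "Lr * \<tau> * \<tau> \<le> (Lr + 1) * \<tau>\<^sup>2" by (simp add: power2_eq_square algebra_simps)
      from main[OF \<tau> t]
      show "AE x in ?M. ereal \<bar>consistency_error r\<^sub>h d\<^sub>h t x \<tau>\<bar> \<le> ereal ((Lr + 1) * \<tau>\<^sup>2)"
        by eventually_elim (use le in simp)
    qed
  qed
qed

end
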